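(* Let $n\ge2$. The Bergman projection $\mathbf{B}_{\mathbb{G}^n}$ on the symmetrized polydisk $\mathbb{G}^n$ is $L^p(\mathbb{G}^n)$-bounded for every $$p\in\left(\frac{\sqrt{n^2-1}+n-1}{\sqrt{n^2-1}},\ \frac{\sqrt{n^2-1}+n-1}{n-1}\right).$$
   Context: $\mathbb{D}$ is the open unit disk. For $w\in\mathbb{C}^n$, $p_m(w)$ denotes the $m$-th elementary symmetric polynomial in $w_1,\dots,w_n$, and $\mathbb{G}^n=\{(p_1(w),\dots,p_n(w)):w\in\mathbb{D}^n\}$ is the $n$-dimensional symmetrized polydisk. For a bounded domain $\Omega$, $\mathbf{B}_\Omega$ is the orthogonal projection of $L^2(\Omega)$ onto $A^2(\Omega)=L^2(\Omega)\cap\mathcal{O}(\Omega)$; it is called $L^p(\Omega)$-bounded if there is $C>0$ with $\|\mathbf{B}_\Omega h\|_{L^p}\le C\|h\|_{L^p}$ for all $h\in L^2(\Omega)\cap L^p(\Omega)$. *)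

theory Defs
  imports "HOL-Analysis.Analysis"
begin

definition esym :: "nat \<Rightarrow> complex^'n \<Rightarrow> complex" where
  "esym m w = (\<Sum>S\<in>{S. card S = m}. \<Prod>i\<in>S. w $ i)"

text \<open>Symmetrized polydisk. The coordinates of C^n are labelled by 'n; iota fixes
  which coordinate carries which index m in {1..n}.\<close>
definition symm_polydisk :: "('n::finite \<Rightarrow> nat) \<Rightarrow> (complex^'n) set" where
  "symm_polydisk \<iota> = {z. \<exists>w::complex^'n. (\<forall>i. w $ i \<in> ball 0 1) \<and> (\<forall>j. z $ j = esym (\<iota> j) w)}"

definition holo_on :: "(complex^'n::finite \<Rightarrow> complex) \<Rightarrow> (complex^'n) set \<Rightarrow> bool" where
  "holo_on f \<Omega> \<longleftrightarrow> (\<forall>z\<in>\<Omega>. \<exists>f'. (f has_derivative f') (at z) \<and>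
      (\<forall>c v. f' (c *s v) = c * f' v))"

definition Lp_space :: "(complex^'n::finite) set \<Rightarrow> real \<Rightarrow> (complex^'n \<Rightarrow> complex) set" where
  "Lp_space \<Omega> p = {f. f \<in> borel_measurable (restrict_space lborel \<Omega>) \<and>
      (\<integral>\<^sup>+ x. ennreal (norm (f x) powr p) \<partial>(restrict_space lborel \<Omega>)) < \<infinity>}"

definition A2_space :: "(complex^'n::finite) set \<Rightarrow> (complex^'n \<Rightarrow> complex) set" where
  "A2_space \<Omega> = {f \<in> Lp_space \<Omega> 2. holo_on f \<Omega>}"

definition bergman_proj :: "(complex^'n::finite) set \<Rightarrow> (complex^'n \<Rightarrow> complex) \<Rightarrow> (complex^'n \<Rightarrow> complex)" where
  "bergman_proj \<Omega> h = (SOME g. g \<in> A2_space \<Omega> \<and>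
     (\<forall>\<phi>\<in>A2_space \<Omega>. (\<integral>x. (h x - g x) * cnj (\<phi> x) \<partial>(restrict_space lborel \<Omega>)) = 0))"

definition Lp_bounded :: "(complex^'n::finite) set \<Rightarrow> real \<Rightarrow> bool" where
  "Lp_bounded \<Omega> p \<longleftrightarrow> (\<exists>C>0. \<forall>h \<in> Lp_space \<Omega> 2 \<inter> Lp_space \<Omega> p.
      (\<integral>\<^sup>+ x. ennreal (norm (bergman_proj \<Omega> h x) powr p) \<partial>(restrict_space lborel \<Omega>))
        \<le> ennreal (C powr p) * (\<integral>\<^sup>+ x. ennreal (norm (h x) powr p) \<partial>(restrict_space lborel \<Omega>)))"

end

theory Submission
  imports Defs "HOL-Complex_Analysis.Complex_Analysis"
begin

text \<open>
  Let \<open>\<Phi>\<close> be the symmetrization map on the polydisc and \<open>J\<close> its Jacobian determinant, the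
  Vandermonde determinant up to sign. Pulling back by \<open>h \<mapsto> J \<cdot> (h \<circ> \<Phi>)\<close> turns the Bergman
  projection of \<open>G\<close> into that of the polydisc, acting on antisymmetric functions, and the
  \<open>L\<^sup>p\<close> norm into the norm with weight \<open>\<bar>J\<bar>\<^sup>2\<^sup>-\<^sup>p\<close>. The weighted estimate follows from Schur's test with
  test functions \<open>\<Prod>\<^sub>i (1 - \<bar>w\<^sub>i\<bar>\<^sup>2)\<^sup>-\<^sup>\<epsilon> \<cdot> \<bar>J\<bar>\<^sup>-\<^sup>s\<close>: the integrals are
  iterated, and in one variable the factor \<open>\<Prod>\<^sub>k \<bar>w - a\<^sub>k\<bar>\<^sup>-\<^sup>s\<close> is harmless as long as \<open>(n - 1) s < 1\<close>, which is where the
  range of \<open>p\<close> enters (\<open>s = p - 2\<close> for \<open>p \<ge> 2\<close> and, dually, \<open>s = (2 - p) / (p - 1)\<close> for \<open>p < 2\<close>).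

  No descent of symmetric holomorphic functions is needed: antisymmetrizing the polydisc kernel
  gives \<open>det (1 - z\<^sub>i cnj w\<^sub>j)\<^sup>-\<^sup>2\<close>, which equals \<open>J(z)\<close> times an explicit rational
  function of \<open>\<Phi>(z)\<close>. So the projection on \<open>G\<close> is a parameter integral that is visibly holomorphic.
\<close>

text \<open>Two points decide the shape of the proof. First, in the iteration the other coordinates
  act as poles a_k in arbitrary position, close to each other, to the circle or to the evaluation
  point z. The one-variable bounds therefore need constants independent of the poles, and they are
  stated for the ratios |z - a_k| / |w - a_k|, so that each integration returns the test function at
  z times a constant. The product of the n - 1 ratios is at most the sum of their (n - 1)-st powers,
  whence the condition (n - 1) s < 1. The given range of p satisfies it because sqrt(n^2 - 1) < n.
  Second, the projection is a choice among functions with the defining orthogonality, so the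
  integral operator must be shown to be square integrable and orthogonal before its norm says
  anything. Both rest on the same Schur estimate at p = 2: it bounds the operator with the absolute
  value of the kernel, and so also justifies exchanging the integrals in the proof of
  orthogonality.\<close>

no_notation fps_nth (infixl "$" 75)

section \<open>One-variable estimates\<close>

text \<open>Such a map preserves inner products with basis vectors, so the preimage of a box is a
  box with the same side lengths. It serves for real coordinates on the plane and on complex
  vectors, and for permutations of coordinates.\<close>

lemma lborel_distr_basis:
  fixes L :: "'a::euclidean_space \<Rightarrow> 'b::euclidean_space"
  assumes L: "linear L" and bij: "bij_betw L Basis Basis"
  shows "distr lborel borel L = lborel"
proof -
  have meas: "L \<in> borel_measurable borel"
    using L by (intro borel_measurable_continuous_onI linear_continuous_on linear_conv_bounded_linear[THEN iffD1])
  have inner: "L x \<bullet> L b = x \<bullet> b" if b: "b \<in> Basis" for x b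
  proof -
    have "L x = (\<Sum>i\<in>Basis. (x \<bullet> i) *\<^sub>R L i)"
      by (subst euclidean_representation[of x, symmetric]) (simp only: linear_sum[OF L] linear_scale[OF L])
    hence "L x \<bullet> L b = (\<Sum>i\<in>Basis. (x \<bullet> i) * (L i \<bullet> L b))"
      by (simp add: inner_sum_left)
    also have "\<dots> = (\<Sum>i\<in>Basis. (x \<bullet> i) * (if i = b then 1 else 0))"
    proof (intro sum.cong refl)
      fix i :: 'a assume i: "i \<in> Basis"
      have "L i \<in> Basis" "L b \<in> Basis" using bij i b by (auto simp: bij_betw_def)
      moreover have "L i = L b \<longleftrightarrow> i = b" using bij i b by (auto simp: bij_betw_def inj_on_def)
      ultimately show "(x \<bullet> i) * (L i \<bullet> L b) = (x \<bullet> i) * (if i = b then 1 else 0)"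
        by (simp add: inner_Basis)
    qed
    finally show ?thesis using b by (simp add: if_distrib[of "\<lambda>t. _ * t"] cong: if_cong)
  qed
  show ?thesis
  proof (rule lborel_eqI[symmetric])
    fix l u :: 'b
    assume le: "\<And>b. b \<in> Basis \<Longrightarrow> l \<bullet> b \<le> u \<bullet> b"
    define l' where "l' = (\<Sum>b\<in>Basis. (l \<bullet> L b) *\<^sub>R b)"
    define u' where "u' = (\<Sum>b\<in>Basis. (u \<bullet> L b) *\<^sub>R b)"
    have l': "l' \<bullet> b = l \<bullet> L b" and u': "u' \<bullet> b = u \<bullet> L b" if "b \<in> Basis" for b
      using that by (simp_all add: l'_def u'_def)
    have img: "L ` Basis = Basis" using bij by (simp add: bij_betw_def)
    have "emeasure (distr lborel borel L) (box l u) = emeasure lborel (L -` box l u)"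
      using meas by (simp add: emeasure_distr)
    also have "L -` box l u = box l' u'"
    proof -
      have "L x \<in> box l u \<longleftrightarrow> x \<in> box l' u'" for x
        unfolding mem_box by (subst img[symmetric]) (simp add: inner l' u')
      thus ?thesis by auto
    qed
    also have "emeasure lborel (box l' u') = (\<Prod>b\<in>Basis. (u' - l') \<bullet> b)"
    proof (rule emeasure_lborel_box)
      fix b :: 'a assume "b \<in> Basis"
      thus "l' \<bullet> b \<le> u' \<bullet> b" using le[of "L b"] img by (auto simp: l' u')
    qed
    also have "(\<Prod>b\<in>Basis. (u' - l') \<bullet> b) = (\<Prod>b\<in>Basis. (u - l) \<bullet> L b)"
      by (intro prod.cong) (simp_all add: inner_diff_left l' u')
    also have "\<dots> = (\<Prod>b\<in>Basis. (u - l) \<bullet> b)"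
      by (rule prod.reindex_bij_betw[OF bij])
    finally show "emeasure (distr lborel borel L) (box l u) = (\<Prod>b\<in>Basis. (u - l) \<bullet> b)" .
  qed simp
qed

text \<open>Both orders of integration are wanted because the disc is later cut into two sectors
  that are sliced in different directions.\<close>

lemma nn_integral_complex:
  assumes [measurable]: "f \<in> borel_measurable (borel :: complex measure)"
  shows "(\<integral>\<^sup>+w. f w \<partial>lborel) = (\<integral>\<^sup>+y. (\<integral>\<^sup>+x. f (Complex x y) \<partial>lborel) \<partial>lborel)" (is ?A)
    and "(\<integral>\<^sup>+w. f w \<partial>lborel) = (\<integral>\<^sup>+x. (\<integral>\<^sup>+y. f (Complex x y) \<partial>lborel) \<partial>lborel)" (is ?B)
proof -
  define L :: "real \<times> real \<Rightarrow> complex" where "L = (\<lambda>(x, y). Complex x y)"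
  have lin: "linear L" by (rule linearI) (auto simp: L_def complex_eq_iff)
  have "bij_betw L Basis Basis"
    unfolding bij_betw_def
    by (auto simp: L_def Basis_prod_def Basis_complex_def inj_on_def complex_eq_iff image_Un)
  hence d: "distr lborel borel L = lborel" by (rule lborel_distr_basis[OF lin])
  have [measurable]: "L \<in> borel_measurable borel"
    using lin by (intro borel_measurable_continuous_onI linear_continuous_on linear_conv_bounded_linear[THEN iffD1])
  have "(\<integral>\<^sup>+w. f w \<partial>lborel) = (\<integral>\<^sup>+p. f (L p) \<partial>lborel)"
    by (subst d[symmetric]) (simp add: nn_integral_distr)
  also have "\<dots> = (\<integral>\<^sup>+p. f (L p) \<partial>(lborel \<Otimes>\<^sub>M lborel))" by (simp add: lborel_prod)
  finally have e: "(\<integral>\<^sup>+w. f w \<partial>lborel) = (\<integral>\<^sup>+p. f (L p) \<partial>(lborel \<Otimes>\<^sub>M lborel))" .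
  have m: "(\<lambda>p. f (L p)) \<in> borel_measurable (lborel \<Otimes>\<^sub>M lborel)"
    unfolding lborel_prod by measurable
  show ?B unfolding e
    by (subst lborel.nn_integral_fst[OF m, symmetric]) (simp add: L_def)
  show ?A unfolding e
    by (subst lborel_pair.nn_integral_snd[OF m, symmetric]) (simp add: L_def)
qed

text \<open>Split at y = h. Below, h + y is replaced by h and y powr (-a) is integrable since a < 1;
  above, it is replaced by y and y powr (-a-b) is integrable at infinity since a + b > 1. Both
  pieces scale like h powr (1 - a - b).\<close>

lemma nn_integral_powr_near_far:
  fixes a b :: real
  assumes "0 \<le> a" "a < 1" "0 \<le> b" "1 < a + b"
  obtains C where "C > 0"
    "\<And>h. h > 0 \<Longrightarrow> (\<integral>\<^sup>+y. indicator {0<..} y * ennreal (y powr (-a) * (h + y) powr (-b)) \<partial>lborel)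
       \<le> ennreal (C * h powr (1 - a - b))"
proof
  show "1 / (1 - a) + 1 / (a + b - 1) > 0" using assms by (intro add_pos_pos divide_pos_pos) auto
next
  fix h :: real assume h: "h > 0"
  have i1: "(\<integral>\<^sup>+y. indicator {0<..h} y * ennreal (y powr (-a)) \<partial>lborel) = ennreal (h powr (1 - a) / (1 - a))"
  proof -
    have "((\<lambda>y. y powr (-a)) has_integral (h powr (-a+1) / (-a+1))) {0..h}"
      using assms h by (intro has_integral_powr_from_0) auto
    hence "((\<lambda>y. y powr (-a)) has_integral (h powr (1-a) / (1-a))) {0..h}" by simp
    hence "((\<lambda>y. y powr (-a)) has_integral (h powr (1-a) / (1-a))) {0<..h}"
      by (rule has_integral_spike_set_eq[THEN iffD1, rotated 2]) (rule negligible_subset[of "{0}"]; force)+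
    hence "((\<lambda>y. if y \<in> {0<..h} then y powr (-a) else 0) has_integral (h powr (1-a) / (1-a))) UNIV"
      by (simp only: has_integral_restrict_UNIV)
    from nn_integral_has_integral_lborel[OF _ _ this]
    have "(\<integral>\<^sup>+y. ennreal (if y \<in> {0<..h} then y powr (-a) else 0) \<partial>lborel) = ennreal (h powr (1 - a) / (1 - a))"
      by simp
    thus ?thesis by (subst nn_integral_cong[where v="\<lambda>y. ennreal (if y \<in> {0<..h} then y powr (-a) else 0)"])
         (auto simp: indicator_def)
  qed
  have i2: "(\<integral>\<^sup>+y. indicator {h..} y * ennreal (y powr (-a-b)) \<partial>lborel) = ennreal (h powr (1 - a - b) / (a + b - 1))"
  proof -
    have "((\<lambda>y. y powr (-a-b)) has_integral (-(h powr (-a-b+1)) / (-a-b+1))) {h..}"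
      using assms h by (intro has_integral_powr_to_inf) auto
    also have "-(h powr (-a-b+1)) / (-a-b+1) = h powr (1-a-b) / (a+b-1)"
      using assms by (simp add: divide_simps) (simp add: algebra_simps)
    finally have "((\<lambda>y. if y \<in> {h..} then y powr (-a-b) else 0) has_integral (h powr (1-a-b) / (a+b-1))) UNIV"
      by (simp only: has_integral_restrict_UNIV)
    from nn_integral_has_integral_lborel[OF _ _ this]
    have "(\<integral>\<^sup>+y. ennreal (if y \<in> {h..} then y powr (-a-b) else 0) \<partial>lborel) = ennreal (h powr (1 - a - b) / (a+b-1))"
      by simp
    thus ?thesis by (subst nn_integral_cong[where v="\<lambda>y. ennreal (if y \<in> {h..} then y powr (-a-b) else 0)"])
         (auto simp: indicator_def)
  qed
  have "(\<integral>\<^sup>+y. indicator {0<..} y * ennreal (y powr (-a) * (h + y) powr (-b)) \<partial>lborel)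
     \<le> (\<integral>\<^sup>+y. ennreal (h powr (-b)) * (indicator {0<..h} y * ennreal (y powr (-a))) + indicator {h..} y * ennreal (y powr (-a-b)) \<partial>lborel)"
  proof (rule nn_integral_mono)
    fix y :: real
    show "indicator {0<..} y * ennreal (y powr (-a) * (h + y) powr (-b)) \<le>
      ennreal (h powr (-b)) * (indicator {0<..h} y * ennreal (y powr (-a))) + indicator {h..} y * ennreal (y powr (-a-b))"
    proof (cases "0 < y")
      case y: True
      show ?thesis
      proof (cases "y \<le> h")
        case True
        have "(h + y) powr (-b) \<le> h powr (-b)" using assms h y by (intro powr_mono2') auto
        hence "ennreal (y powr (-a) * (h + y) powr (-b)) \<le> ennreal (h powr (-b) * y powr (-a))"
          by (subst mult.commute[of "h powr (-b)"]) (intro ennreal_leI mult_left_mono, auto)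
        also have "\<dots> = ennreal (h powr (-b)) * (indicator {0<..h} y * ennreal (y powr (-a)))"
          using True y by (simp add: ennreal_mult)
        also have "\<dots> \<le> \<dots> + indicator {h..} y * ennreal (y powr (-a-b))" by simp
        finally show ?thesis using y by (simp add: indicator_def)
      next
        case False
        have "(h + y) powr (-b) \<le> y powr (-b)" using assms h y by (intro powr_mono2') auto
        hence "y powr (-a) * (h + y) powr (-b) \<le> y powr (-a) * y powr (-b)" by (intro mult_left_mono) auto
        also have "\<dots> = y powr (-a-b)" by (simp add: powr_add[symmetric])
        finally show ?thesis using False y by (auto simp: indicator_def intro: ennreal_leI)
      qed
    qed simp
  qed
  also have "\<dots> = ennreal (h powr (-b)) * ennreal (h powr (1 - a) / (1 - a)) + ennreal (h powr (1 - a - b) / (a + b - 1))"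
    by (simp add: nn_integral_add nn_integral_cmult i1 i2)
  also have "\<dots> = ennreal (h powr (-b) * (h powr (1 - a) / (1 - a)) + h powr (1 - a - b) / (a + b - 1))"
    using assms by (subst ennreal_plus) (auto simp flip: ennreal_mult')
  also have "h powr (-b) * (h powr (1 - a) / (1 - a)) + h powr (1 - a - b) / (a + b - 1) = 
     (1 / (1 - a) + 1 / (a + b - 1)) * h powr (1 - a - b)"
  proof -
    have "h powr (-b) * h powr (1 - a) = h powr (1 - a - b)" by (simp add: powr_add[symmetric] algebra_simps)
    thus ?thesis by (simp add: algebra_simps)
  qed
  finally show "(\<integral>\<^sup>+y. indicator {0<..} y * ennreal (y powr (-a) * (h + y) powr (-b)) \<partial>lborel)
     \<le> ennreal ((1 / (1 - a) + 1 / (a + b - 1)) * h powr (1 - a - b))" .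
qed

lemma nn_integral_even_le:
  assumes [measurable]: "f \<in> borel_measurable (borel :: real measure)"
  shows "(\<integral>\<^sup>+x. indicator {x. \<bar>x\<bar> < c} x * f (c - \<bar>x\<bar>) \<partial>lborel) \<le> 2 * (\<integral>\<^sup>+u. indicator {0<..} u * f u \<partial>lborel)"
    and "(\<integral>\<^sup>+x. indicator {x. 0 < \<bar>x\<bar>} x * f \<bar>x\<bar> \<partial>lborel) \<le> 2 * (\<integral>\<^sup>+u. indicator {0<..} u * f u \<partial>lborel)"
proof -
  define F where "F = (\<lambda>u. indicator {0<..} u * f u)"
  have [measurable]: "F \<in> borel_measurable borel" unfolding F_def by measurable
  have shift: "(\<integral>\<^sup>+x. F (t + c * x) \<partial>lborel) = (\<integral>\<^sup>+u. F u \<partial>lborel)" if "\<bar>c\<bar> = 1" for c t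
    using nn_integral_real_affine[of F c t] that by auto
  have "(\<integral>\<^sup>+x. indicator {x. \<bar>x\<bar> < c} x * f (c - \<bar>x\<bar>) \<partial>lborel) \<le> (\<integral>\<^sup>+x. F (c + (-1) * x) + F (c + 1 * x) \<partial>lborel)"
  proof (rule nn_integral_mono)
    fix x :: real
    show "indicator {x. \<bar>x\<bar> < c} x * f (c - \<bar>x\<bar>) \<le> F (c + (-1) * x) + F (c + 1 * x)"
      by (cases "x \<ge> 0") (auto simp: F_def indicator_def)
  qed
  also have "\<dots> = 2 * (\<integral>\<^sup>+u. F u \<partial>lborel)"
    using shift[of "-1" c] shift[of 1 c] by (subst nn_integral_add) (auto simp flip: mult_2)
  finally show "(\<integral>\<^sup>+x. indicator {x. \<bar>x\<bar> < c} x * f (c - \<bar>x\<bar>) \<partial>lborel) \<le> 2 * (\<integral>\<^sup>+u. indicator {0<..} u * f u \<partial>lborel)"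
    by (simp add: F_def)
  have "(\<integral>\<^sup>+x. indicator {x. 0 < \<bar>x\<bar>} x * f \<bar>x\<bar> \<partial>lborel) \<le> (\<integral>\<^sup>+x. F (0 + (-1) * x) + F (0 + 1 * x) \<partial>lborel)"
  proof (rule nn_integral_mono)
    fix x :: real
    show "indicator {x. 0 < \<bar>x\<bar>} x * f \<bar>x\<bar> \<le> F (0 + (-1) * x) + F (0 + 1 * x)"
      by (cases "x \<ge> 0") (auto simp: F_def indicator_def)
  qed
  also have "\<dots> = 2 * (\<integral>\<^sup>+u. F u \<partial>lborel)"
    using shift[of "-1" 0] shift[of 1 0] by (subst nn_integral_add) (auto simp flip: mult_2)
  finally show "(\<integral>\<^sup>+x. indicator {x. 0 < \<bar>x\<bar>} x * f \<bar>x\<bar> \<partial>lborel) \<le> 2 * (\<integral>\<^sup>+u. indicator {0<..} u * f u \<partial>lborel)"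
    by (simp add: F_def)
qed

text \<open>Model of the integrand on a horizontal slice: u is the distance to the circle along the
  slice, y the height relative to the singular point, and \<delta> will be 1 - |z|. The exponents 2
  - s and s add up to the order 2 of the Bergman kernel.\<close>

definition slab_kernel :: "real \<Rightarrow> real \<Rightarrow> real \<Rightarrow> real \<Rightarrow> real \<Rightarrow> real" where
  "slab_kernel s e \<delta> u y = u powr (-e) * (\<delta> + u + \<bar>y\<bar>) powr (-(2 - s)) * \<bar>y\<bar> powr (-s)"

lemma slab_kernel_measurable [measurable]:
  assumes [measurable]: "f \<in> borel_measurable M" "g \<in> borel_measurable M"
  shows "(\<lambda>x. slab_kernel s e \<delta> (f x) (g x)) \<in> borel_measurable M"
  unfolding slab_kernel_def by measurable

lemma slab_kernel_nonneg: "slab_kernel s e \<delta> u y \<ge> 0"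
  by (simp add: slab_kernel_def)

text \<open>Folding the slice at its two ends turns x into u > 0, and enlarging the range to all u >
  0 removes the dependence on \<open>X y\<close>, so the integrals can be exchanged. The y-integral
  then gives (\<delta> + u) powr (-1), and the u-integral gives \<delta> powr (-e). The factor 4
  counts the two foldings, in x and in y.\<close>

lemma slab_integral_bound:
  fixes s e :: real
  assumes s: "0 \<le> s" "s < 1" and e: "0 < e" "e < 1"
  obtains C where "C > 0"
    "\<And>\<delta> b (X :: real \<Rightarrow> real). \<delta> > 0 \<Longrightarrow> X \<in> borel_measurable borel \<Longrightarrow>
      (\<integral>\<^sup>+y. (\<integral>\<^sup>+x. indicator {x. \<bar>x\<bar> < X y} x * ennreal (slab_kernel s e \<delta> (X y - \<bar>x\<bar>) (y - b)) \<partial>lborel) \<partial>lborel)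
        \<le> ennreal (C * \<delta> powr (-e))"
proof -
  obtain C1 where C1: "C1 > 0" 
    "\<And>h. h > 0 \<Longrightarrow> (\<integral>\<^sup>+y. indicator {0<..} y * ennreal (y powr (-s) * (h + y) powr (-(2 - s))) \<partial>lborel)
       \<le> ennreal (C1 * h powr (1 - s - (2 - s)))"
    by (rule nn_integral_powr_near_far[of s "2 - s"]) (use s in auto)
  obtain C2 where C2: "C2 > 0" 
    "\<And>h. h > 0 \<Longrightarrow> (\<integral>\<^sup>+y. indicator {0<..} y * ennreal (y powr (-e) * (h + y) powr (-1)) \<partial>lborel)
       \<le> ennreal (C2 * h powr (1 - e - 1))"
    by (rule nn_integral_powr_near_far[of e 1]) (use e in auto)
  show ?thesis
  proof (rule that[of "4 * C1 * C2"])
    show "4 * C1 * C2 > 0" using C1 C2 by simp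
  next
    fix \<delta> b :: real and X :: "real \<Rightarrow> real"
    assume d: "\<delta> > 0" and [measurable]: "X \<in> borel_measurable borel"
    let ?k = "slab_kernel s e \<delta>"
    have "(\<integral>\<^sup>+y. (\<integral>\<^sup>+x. indicator {x. \<bar>x\<bar> < X y} x * ennreal (?k (X y - \<bar>x\<bar>) (y - b)) \<partial>lborel) \<partial>lborel)
       \<le> (\<integral>\<^sup>+y. 2 * (\<integral>\<^sup>+u. indicator {0<..} u * ennreal (?k u (y - b)) \<partial>lborel) \<partial>lborel)"
      by (intro nn_integral_mono nn_integral_even_le(1)) measurable
    also have "\<dots> = 2 * (\<integral>\<^sup>+y. (\<integral>\<^sup>+u. indicator {0<..} u * ennreal (?k u (y - b)) \<partial>lborel) \<partial>lborel)"
      by (rule nn_integral_cmult) measurable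
    also have "(\<integral>\<^sup>+y. (\<integral>\<^sup>+u. indicator {0<..} u * ennreal (?k u (y - b)) \<partial>lborel) \<partial>lborel)
       = (\<integral>\<^sup>+u. (\<integral>\<^sup>+y. indicator {0<..} u * ennreal (?k u (y - b)) \<partial>lborel) \<partial>lborel)"
      by (rule lborel_pair.Fubini') measurable
    also have "\<dots> \<le> (\<integral>\<^sup>+u. ennreal (2 * C1) * (indicator {0<..} u * ennreal (u powr (-e) * (\<delta> + u) powr (-1))) \<partial>lborel)"
    proof (rule nn_integral_mono)
      fix u :: real
      show "(\<integral>\<^sup>+y. indicator {0<..} u * ennreal (?k u (y - b)) \<partial>lborel)
        \<le> ennreal (2 * C1) * (indicator {0<..} u * ennreal (u powr (-e) * (\<delta> + u) powr (-1)))"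
      proof (cases "u > 0")
        case u: True
        define g where "g = (\<lambda>y. ennreal (y powr (-s) * (\<delta> + u + y) powr (-(2 - s))))"
        have gm[measurable]: "g \<in> borel_measurable borel" unfolding g_def by measurable
        have "(\<integral>\<^sup>+y. ennreal (?k u (y - b)) \<partial>lborel) = (\<integral>\<^sup>+y. ennreal (?k u y) \<partial>lborel)"
          using nn_integral_real_affine[of "\<lambda>y. ennreal (?k u y)" 1 "-b"] by simp
        also have "\<dots> = (\<integral>\<^sup>+y. ennreal (u powr (-e)) * (indicator {y. 0 < \<bar>y\<bar>} y * g \<bar>y\<bar>) \<partial>lborel)"
          by (intro nn_integral_cong) 
             (auto simp: slab_kernel_def g_def indicator_def ennreal_mult[symmetric] mult_ac)
        also have "\<dots> = ennreal (u powr (-e)) * (\<integral>\<^sup>+y. indicator {y. 0 < \<bar>y\<bar>} y * g \<bar>y\<bar> \<partial>lborel)"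
          by (rule nn_integral_cmult) measurable
        also have "\<dots> \<le> ennreal (u powr (-e)) * (2 * (\<integral>\<^sup>+y. indicator {0<..} y * g y \<partial>lborel))"
          by (intro mult_left_mono nn_integral_even_le(2)) auto
        also have "\<dots> \<le> ennreal (u powr (-e)) * (2 * ennreal (C1 * (\<delta> + u) powr (1 - s - (2 - s))))"
          unfolding g_def using d u by (intro mult_left_mono C1(2)) auto
        also have "\<dots> = ennreal (2 * C1 * (u powr (-e) * (\<delta> + u) powr (-1)))"
        proof -
          have "2 * ennreal (C1 * (\<delta> + u) powr (1 - s - (2 - s))) = ennreal (2 * (C1 * (\<delta> + u) powr (-1)))"
            using C1(1) by (subst ennreal_mult) auto
          thus ?thesis using C1(1) by (simp add: ennreal_mult[symmetric] mult_ac)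
        qed
        finally show ?thesis using u C1(1) by (simp add: ennreal_mult[symmetric])
      qed simp
    qed
    also have "\<dots> = ennreal (2 * C1) * (\<integral>\<^sup>+u. indicator {0<..} u * ennreal (u powr (-e) * (\<delta> + u) powr (-1)) \<partial>lborel)"
      by (rule nn_integral_cmult) measurable
    also have "2 * \<dots> \<le> 2 * (ennreal (2 * C1) * ennreal (C2 * \<delta> powr (1 - e - 1)))"
      by (intro mult_left_mono C2(2) d) auto
    also have "\<dots> = ennreal (4 * C1 * C2 * \<delta> powr (-e))"
    proof -
      have "ennreal (2 * C1) * ennreal (C2 * \<delta> powr (1 - e - 1)) = ennreal (2 * C1 * (C2 * \<delta> powr (1 - e - 1)))"
        using C1(1) C2(1) by (intro ennreal_mult[symmetric]) auto
      moreover have "2 * ennreal t = ennreal (2 * t)" if "t \<ge> 0" for t using that by (subst ennreal_mult) auto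
      ultimately have "2 * (ennreal (2 * C1) * ennreal (C2 * \<delta> powr (1 - e - 1))) = ennreal (2 * (2 * C1 * (C2 * \<delta> powr (1 - e - 1))))"
        using C1(1) C2(1) by simp
      thus ?thesis by (simp add: mult_ac)
    qed
    finally show "(\<integral>\<^sup>+y. (\<integral>\<^sup>+x. indicator {x. \<bar>x\<bar> < X y} x * ennreal (?k (X y - \<bar>x\<bar>) (y - b)) \<partial>lborel) \<partial>lborel)
        \<le> ennreal (4 * C1 * C2 * \<delta> powr (-e))" 
      by (auto elim!: order_trans simp: mult_left_mono)
  qed
qed

text \<open>In the sector \<open>\<bar>y\<bar> \<le> \<bar>x\<bar>\<close> of the disc the defect \<open>1 - x\<^sup>2 - y\<^sup>2\<close> is comparable to
  the horizontal distance \<open>sqrt (1 - y\<^sup>2) - \<bar>x\<bar>\<close> to the circle.\<close>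
lemma disc_sector_bound:
  fixes x y :: real
  assumes xy: "x\<^sup>2 + y\<^sup>2 < 1" "\<bar>y\<bar> \<le> \<bar>x\<bar>" and yb: "y \<noteq> b" and d: "\<delta> > 0"
    and r: "\<bar>y - b\<bar> \<le> r" and s: "0 \<le> s" "s < 1" and e: "0 < e" "e < 1"
  shows "\<bar>x\<bar> < sqrt (1 - y\<^sup>2)"
    "(\<delta> + (1 - x\<^sup>2 - y\<^sup>2) + r) powr (-(2 - s)) * r powr (-s) * (1 - x\<^sup>2 - y\<^sup>2) powr (-e)
      \<le> 8 * slab_kernel s e \<delta> (sqrt (1 - y\<^sup>2) - \<bar>x\<bar>) (y - b)"
proof -
  define X where "X = sqrt (1 - y\<^sup>2)"
  define u where "u = X - \<bar>x\<bar>"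
  define q where "q = 1 - x\<^sup>2 - y\<^sup>2"
  have yx: "y\<^sup>2 \<le> x\<^sup>2" using xy(2) by (simp add: abs_le_square_iff)
  have y2: "y\<^sup>2 \<le> 1/2" using xy yx by simp
  have X2: "X\<^sup>2 = 1 - y\<^sup>2" unfolding X_def using y2 by simp
  \<comment> \<open>In the sector y^2 is at most 1/2, so 1 - y^2 is at least 1/2, hence at least
    1/4. This keeps the second factor in q = u * (X + |x|) away from 0.\<close>
  have "X \<ge> sqrt ((1/2)\<^sup>2)" unfolding X_def using y2 by (intro real_sqrt_le_mono) (simp add: power2_eq_square)
  hence X: "X \<ge> 1/2" by simp
  show 1: "\<bar>x\<bar> < sqrt (1 - y\<^sup>2)" 
    by (rule real_less_rsqrt) (use xy in simp)
  hence u: "u > 0" by (simp add: u_def X_def)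
  have "q = u * (X + \<bar>x\<bar>)" using X2 by (simp add: q_def u_def algebra_simps power2_eq_square)
  also have "\<dots> \<ge> u * (1/2)" using u X by (intro mult_left_mono) auto
  finally have q: "q \<ge> u / 2" by simp
  have yb': "\<bar>y - b\<bar> > 0" using yb by simp
  have half: "(A / 2) powr (-k) = A powr (-k) * 2 powr k" if "A > 0" for A k :: real
    proof -
    have "(A / 2) powr (-k) = A powr (-k) / 2 powr (-k)" by (rule powr_divide)
    thus ?thesis by (simp add: powr_minus divide_simps)
  qed
  have a: "(\<delta> + q + r) powr (-(2 - s)) \<le> 4 * (\<delta> + u + \<bar>y - b\<bar>) powr (-(2 - s))"
  proof -
    have "(\<delta> + q + r) powr (-(2 - s)) \<le> ((\<delta> + u + \<bar>y - b\<bar>) / 2) powr (-(2 - s))"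
      using d u q r s yb' by (intro powr_mono2') (auto simp: field_simps)
    also have "\<dots> = (\<delta> + u + \<bar>y - b\<bar>) powr (-(2 - s)) * 2 powr (2 - s)"
      using d u by (intro half) auto
    also have "\<dots> \<le> (\<delta> + u + \<bar>y - b\<bar>) powr (-(2 - s)) * 2 powr 2"
      using s by (intro mult_left_mono powr_mono) auto
    finally show ?thesis by simp
  qed
  have b: "q powr (-e) \<le> 2 * u powr (-e)"
  proof -
    have "q powr (-e) \<le> (u / 2) powr (-e)"
      using u q e by (intro powr_mono2') auto
    also have "\<dots> = u powr (-e) * 2 powr e"
      using u by (intro half) auto
    also have "\<dots> \<le> u powr (-e) * 2 powr 1"
      using e by (intro mult_left_mono powr_mono) auto
    finally show ?thesis by simp
  qed
  have c: "r powr (-s) \<le> \<bar>y - b\<bar> powr (-s)"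
    using yb' r s by (intro powr_mono2') auto
  have "(\<delta> + q + r) powr (-(2 - s)) * r powr (-s) * q powr (-e) \<le>
    (4 * (\<delta> + u + \<bar>y - b\<bar>) powr (-(2 - s))) * \<bar>y - b\<bar> powr (-s) * (2 * u powr (-e))"
    by (intro mult_mono a b c) auto
  thus "(\<delta> + (1 - x\<^sup>2 - y\<^sup>2) + r) powr (-(2 - s)) * r powr (-s) * (1 - x\<^sup>2 - y\<^sup>2) powr (-e)
      \<le> 8 * slab_kernel s e \<delta> (sqrt (1 - y\<^sup>2) - \<bar>x\<bar>) (y - b)"
    unfolding q_def[symmetric] X_def[symmetric] u_def[symmetric] by (simp add: slab_kernel_def mult_ac)
qed

section \<open>Weighted kernel integrals over the disc\<close>

lemma borel_measurable_cnj [measurable]: "cnj \<in> borel_measurable borel"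
  by (intro borel_measurable_continuous_onI continuous_intros)

text \<open>The horizontal distance to the circle controls the defect 1 - |w|^2 only away from the
  top and bottom of the disc. The disc is therefore covered by the two sectors bounded by the
  diagonals, each sliced along its own axis, and the distance to b is bounded below by one
  coordinate of w - b.\<close>

lemma disc_point_bound:
  fixes s e :: real
  assumes s: "0 \<le> s" "s < 1" and e: "0 < e" "e < 1"
  obtains C where "C > 0"
    "\<And>\<delta> b. \<delta> > 0 \<Longrightarrow>
      (\<integral>\<^sup>+w. indicator (ball 0 1) w * ennreal ((\<delta> + (1 - (norm w)\<^sup>2) + norm (w - b)) powr (-(2 - s)) 
          * norm (w - b) powr (-s) * (1 - (norm w)\<^sup>2) powr (-e)) \<partial>(lborel :: complex measure))
        \<le> ennreal (C * \<delta> powr (-e))"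
proof -
  obtain C where C: "C > 0"
    "\<And>\<delta> b (X :: real \<Rightarrow> real). \<delta> > 0 \<Longrightarrow> X \<in> borel_measurable borel \<Longrightarrow>
      (\<integral>\<^sup>+y. (\<integral>\<^sup>+x. indicator {x. \<bar>x\<bar> < X y} x * ennreal (slab_kernel s e \<delta> (X y - \<bar>x\<bar>) (y - b)) \<partial>lborel) \<partial>lborel)
        \<le> ennreal (C * \<delta> powr (-e))"
    by (rule slab_integral_bound[OF s e]) blast
  define X where "X = (\<lambda>y. sqrt (1 - y\<^sup>2))"
  have X[measurable]: "X \<in> borel_measurable borel" unfolding X_def by measurable
  show ?thesis
  proof (rule that[of "16 * C"])
    show "16 * C > 0" using C by simp
  next
    fix \<delta> :: real and b :: complex assume d: "\<delta> > 0"
    define f where "f = (\<lambda>w. ennreal ((\<delta> + (1 - (norm w)\<^sup>2) + norm (w - b)) powr (-(2 - s)) 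
          * norm (w - b) powr (-s) * (1 - (norm w)\<^sup>2) powr (-e)))"
    have f[measurable]: "f \<in> borel_measurable borel" unfolding f_def by measurable
    define A1 where "A1 = {w \<in> ball 0 1. \<bar>Im w\<bar> \<le> \<bar>Re w\<bar>}"
    define A2 where "A2 = {w \<in> ball 0 1. \<bar>Re w\<bar> \<le> \<bar>Im w\<bar>}"
    have [measurable]: "A1 \<in> sets borel" "A2 \<in> sets borel" unfolding A1_def A2_def by measurable
    have half: "(\<integral>\<^sup>+y. (\<integral>\<^sup>+x. indicator A (c x y) * f (c x y) \<partial>lborel) \<partial>lborel) \<le> 8 * ennreal (C * \<delta> powr (-e))"
      if A: "\<And>x y. c x y \<in> A \<Longrightarrow> norm (c x y) < 1 \<and> \<bar>y\<bar> \<le> \<bar>x\<bar>"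
        and c: "\<And>x y. (norm (c x y))\<^sup>2 = x\<^sup>2 + y\<^sup>2" "\<And>x y. \<bar>y - b'\<bar> \<le> norm (c x y - b)" for A b' and c :: "real \<Rightarrow> real \<Rightarrow> complex"
    proof -
      have "(\<integral>\<^sup>+y. (\<integral>\<^sup>+x. indicator A (c x y) * f (c x y) \<partial>lborel) \<partial>lborel)
        \<le> (\<integral>\<^sup>+y. (\<integral>\<^sup>+x. 8 * (indicator {x. \<bar>x\<bar> < X y} x * ennreal (slab_kernel s e \<delta> (X y - \<bar>x\<bar>) (y - b'))) \<partial>lborel) \<partial>lborel)"
      \<comment> \<open>On the slice y = b' the convention \<open>0 powr (-s) = 0\<close> makes the
        model kernel vanish, so the pointwise bound is claimed off this null set only.\<close>
      proof (rule nn_integral_mono_AE, rule AE_mp[OF AE_lborel_singleton[of b']], intro AE_I2 impI nn_integral_mono)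
        fix x y :: real assume y: "y \<noteq> b'"
        show "indicator A (c x y) * f (c x y) \<le> 8 * (indicator {x. \<bar>x\<bar> < X y} x * ennreal (slab_kernel s e \<delta> (X y - \<bar>x\<bar>) (y - b')))"
        proof (cases "c x y \<in> A")
          case True
          hence "(norm (c x y))\<^sup>2 < 1" using A[of x y] by (simp add: abs_square_less_1)
          hence xy: "x\<^sup>2 + y\<^sup>2 < 1" "\<bar>y\<bar> \<le> \<bar>x\<bar>" using A[OF True] by (simp_all add: c(1))
          note * = disc_sector_bound[OF xy y d c(2) s e]
          have "f (c x y) \<le> ennreal (8 * slab_kernel s e \<delta> (X y - \<bar>x\<bar>) (y - b'))"
            unfolding f_def c(1) X_def using *(2)[of x] by (intro ennreal_leI) (simp add: algebra_simps)
          also have "\<dots> = 8 * ennreal (slab_kernel s e \<delta> (X y - \<bar>x\<bar>) (y - b'))"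
            by (subst ennreal_mult) (auto simp: slab_kernel_nonneg)
          finally show ?thesis using *(1) True by (simp add: X_def)
        qed simp
      qed
      also have "\<dots> = 8 * (\<integral>\<^sup>+y. (\<integral>\<^sup>+x. (indicator {x. \<bar>x\<bar> < X y} x * ennreal (slab_kernel s e \<delta> (X y - \<bar>x\<bar>) (y - b'))) \<partial>lborel) \<partial>lborel)"
        by (subst nn_integral_cmult[symmetric], measurable) (intro nn_integral_cong nn_integral_cmult, measurable)
      also have "\<dots> \<le> 8 * ennreal (C * \<delta> powr (-e))"
        by (intro mult_left_mono C(2) d X) auto
      finally show ?thesis .
    qed
    have "(\<integral>\<^sup>+w. indicator (ball 0 1) w * f w \<partial>lborel) \<le> (\<integral>\<^sup>+w. indicator A1 w * f w + indicator A2 w * f w \<partial>lborel)"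
      by (intro nn_integral_mono) (auto simp: A1_def A2_def indicator_def)
    also have "\<dots> = (\<integral>\<^sup>+w. indicator A1 w * f w \<partial>lborel) + (\<integral>\<^sup>+w. indicator A2 w * f w \<partial>lborel)"
      by (rule nn_integral_add) measurable
    also have "(\<integral>\<^sup>+w. indicator A1 w * f w \<partial>lborel) 
       = (\<integral>\<^sup>+y. (\<integral>\<^sup>+x. indicator A1 (Complex x y) * f (Complex x y) \<partial>lborel) \<partial>lborel)"
      by (rule nn_integral_complex(1)) measurable
    also have "\<dots> \<le> 8 * ennreal (C * \<delta> powr (-e))"
      by (rule half[where b' = "Im b"])
         (use abs_Im_le_cmod[of "Complex _ _ - b"] in \<open>auto simp: A1_def cmod_power2\<close>)
    also have "(\<integral>\<^sup>+w. indicator A2 w * f w \<partial>lborel) 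
       = (\<integral>\<^sup>+x. (\<integral>\<^sup>+y. indicator A2 (Complex x y) * f (Complex x y) \<partial>lborel) \<partial>lborel)"
      by (rule nn_integral_complex(2)) measurable
    also have "\<dots> \<le> 8 * ennreal (C * \<delta> powr (-e))"
      by (rule half[where b' = "Re b" and c = "\<lambda>y x. Complex x y"])
         (use abs_Re_le_cmod[of "Complex _ _ - b"] in \<open>auto simp: A2_def cmod_power2\<close>)
    also have "8 * ennreal (C * \<delta> powr (-e)) + 8 * ennreal (C * \<delta> powr (-e)) = ennreal (16 * C * \<delta> powr (-e))"
    proof -
      have "8 * ennreal t = ennreal (8 * t)" if "t \<ge> 0" for t using that by (subst ennreal_mult) auto
      thus ?thesis using C by (simp flip: ennreal_plus)
    qed
    finally show "(\<integral>\<^sup>+w. indicator (ball 0 1) w * ennreal ((\<delta> + (1 - (norm w)\<^sup>2) + norm (w - b)) powr (-(2 - s)) 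
          * norm (w - b) powr (-s) * (1 - (norm w)\<^sup>2) powr (-e)) \<partial>(lborel :: complex measure))
        \<le> ennreal (16 * C * \<delta> powr (-e))"
      by (simp add: f_def add_mono)
  qed
qed

lemma ball_in_borel [measurable]: "ball (c :: 'a::metric_space) r \<in> sets borel"
  by simp

text \<open>The first bound comes from |1 - z cnj w|^2 - |z - w|^2 = (1 - |z|^2)(1 - |w|^2), the
  others from the triangle inequality. Together they show that |1 - z cnj w| dominates the sum of
  both boundary distances and |z - w|.\<close>

lemma norm_one_minus_cnj_ge:
  fixes z w :: complex
  assumes z: "norm z < 1" and w: "norm w < 1"
  shows "norm (z - w) \<le> norm (1 - z * cnj w)" "1 - norm z \<le> norm (1 - z * cnj w)"
    "1 - (norm w)\<^sup>2 \<le> 2 * norm (1 - z * cnj w)" "0 < norm (1 - z * cnj w)"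
proof -
  have zw: "norm z * norm w \<le> norm z" "norm z * norm w \<le> norm w"
    using z w by (auto intro: mult_left_le mult_left_le_one_le)
  have "1 - norm z * norm w \<le> norm (1 - z * cnj w)"
    using norm_triangle_ineq2[of 1 "z * cnj w"] by (simp add: norm_mult)
  thus a: "1 - norm z \<le> norm (1 - z * cnj w)" and b: "0 < norm (1 - z * cnj w)" 
    using zw z by linarith+
  have "1 - norm w \<le> norm (1 - z * cnj w)" 
    using norm_triangle_ineq2[of 1 "z * cnj w"] zw by (simp add: norm_mult)
  hence "(1 - norm w) * 2 \<le> norm (1 - z * cnj w) * 2" by (rule mult_right_mono) simp
  moreover have "1 - (norm w)\<^sup>2 \<le> (1 - norm w) * 2"
  proof -
    have "1 - (norm w)\<^sup>2 = (1 - norm w) * (1 + norm w)" by (simp add: power2_eq_square algebra_simps)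
    also have "\<dots> \<le> (1 - norm w) * 2" using w by (intro mult_left_mono) auto
    finally show ?thesis .
  qed
  ultimately show "1 - (norm w)\<^sup>2 \<le> 2 * norm (1 - z * cnj w)" by (metis order_trans mult.commute)
  have "(norm (1 - z * cnj w))\<^sup>2 - (norm (z - w))\<^sup>2 = (1 - (norm z)\<^sup>2) * (1 - (norm w)\<^sup>2)"
    unfolding cmod_power2 by (simp add: power2_eq_square algebra_simps)
  moreover have "\<dots> \<ge> 0" using z w by (intro mult_nonneg_nonneg) (auto simp: power_le_one)
  ultimately have "(norm (z - w))\<^sup>2 \<le> (norm (1 - z * cnj w))\<^sup>2" by linarith
  thus "norm (z - w) \<le> norm (1 - z * cnj w)" by (rule power2_le_imp_le) simp
qed

text \<open>Where \<open>\<bar>w - a\<bar> \<ge> \<bar>w - z\<bar>\<close> the singularity may be moved to \<open>z\<close>; elsewhere the kernel is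
  dominated by its value with \<open>z\<close> replaced by \<open>a\<close>.\<close>
lemma disc_two_point_bound:
  fixes s e :: real
  assumes s: "0 \<le> s" "s < 1" and e: "0 < e" "e < 1"
  obtains C where "C > 0"
    "\<And>z a. norm z < 1 \<Longrightarrow>
      (\<integral>\<^sup>+w. indicator (ball 0 1) w * ennreal (norm (1 - z * cnj w) powr (-(2 - s)) 
          * norm (w - a) powr (-s) * (1 - (norm w)\<^sup>2) powr (-e)) \<partial>(lborel :: complex measure))
        \<le> ennreal (C * (1 - norm z) powr (-e))"
proof -
  define f where "f = (\<lambda>\<delta> b (w :: complex). (\<delta> + (1 - (norm w)\<^sup>2) + norm (w - b)) powr (-(2 - s)) 
          * norm (w - b) powr (-s) * (1 - (norm w)\<^sup>2) powr (-e))"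
  have [measurable]: "(\<lambda>w. f \<delta> b w) \<in> borel_measurable borel" for \<delta> b unfolding f_def by measurable
  have fm: "(\<lambda>w. indicator (ball 0 1) w * ennreal (f \<delta> b w)) \<in> borel_measurable borel" for \<delta> b unfolding f_def by measurable
  obtain C where C: "C > 0"
    "\<And>\<delta> b. \<delta> > 0 \<Longrightarrow> (\<integral>\<^sup>+w. indicator (ball 0 1) w * ennreal (f \<delta> b w) \<partial>lborel) \<le> ennreal (C * \<delta> powr (-e))"
    unfolding f_def by (rule disc_point_bound[OF s e]) blast
  show ?thesis
  proof (rule that[of "32 * C"])
    show "32 * C > 0" using C by simp
  next
    fix z a :: complex assume z: "norm z < 1"
    have "(\<integral>\<^sup>+w. indicator (ball 0 1) w * ennreal (norm (1 - z * cnj w) powr (-(2 - s)) 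
          * norm (w - a) powr (-s) * (1 - (norm w)\<^sup>2) powr (-e)) \<partial>lborel)
       \<le> (\<integral>\<^sup>+w. ennreal 16 * (indicator (ball 0 1) w * ennreal (f (1 - norm z) z w)) + ennreal 16 * (indicator (ball 0 1) w * ennreal (f (1 - norm z) a w)) \<partial>lborel)"
    proof (rule nn_integral_mono_AE, rule AE_mp[OF AE_lborel_singleton[of z]], rule AE_mp[OF AE_lborel_singleton[of a]],
          intro AE_I2 impI)
      fix w assume wa: "w \<noteq> a" and wz: "w \<noteq> z"
      show "indicator (ball 0 1) w * ennreal (norm (1 - z * cnj w) powr (-(2 - s)) 
          * norm (w - a) powr (-s) * (1 - (norm w)\<^sup>2) powr (-e)) \<le>
          ennreal 16 * (indicator (ball 0 1) w * ennreal (f (1 - norm z) z w)) + ennreal 16 * (indicator (ball 0 1) w * ennreal (f (1 - norm z) a w))"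
      proof (cases "norm w < 1")
        case w: True
        define q where "q = 1 - (norm w)\<^sup>2"
        define N where "N = norm (1 - z * cnj w)"
        note ge = norm_one_minus_cnj_ge[OF z w, folded N_def q_def]
        have q: "q > 0" using w by (simp add: q_def power_less_one_iff abs_square_less_1)
        have key: "N powr (-(2 - s)) * norm (w - a) powr (-s) * q powr (-e) \<le> 16 * f (1 - norm z) b w"
          if b: "w \<noteq> b" "norm (w - b) \<le> norm (w - z)" "norm (w - b) \<le> norm (w - a)" for b
        proof -
          let ?m = "(1 - norm z) + q + norm (w - b)"
          have m: "?m > 0" using z q by (intro add_pos_nonneg) auto
          \<comment> \<open>The three summands of \<open>?m\<close> are at most N, 2 N and N; the
            last because b is no farther from w than z is.\<close>
          have "?m \<le> 4 * N" using ge b by (simp add: norm_minus_commute)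
          hence "N powr (-(2 - s)) \<le> (?m / 4) powr (-(2 - s))"
            using s m by (intro powr_mono2') auto
          also have "\<dots> = ?m powr (-(2 - s)) / 4 powr (-(2 - s))" by (rule powr_divide)
          also have "\<dots> = ?m powr (-(2 - s)) * 4 powr (2 - s)" by (simp only: powr_minus divide_inverse inverse_inverse_eq)
          also have "\<dots> \<le> ?m powr (-(2 - s)) * 4 powr 2" using s by (intro mult_left_mono powr_mono) auto
          finally have 1: "N powr (-(2 - s)) \<le> 16 * ?m powr (-(2 - s))" by simp
          have 2: "norm (w - a) powr (-s) \<le> norm (w - b) powr (-s)"
            using b s by (intro powr_mono2') auto
          have "N powr (-(2 - s)) * norm (w - a) powr (-s) * q powr (-e) \<le>
             (16 * ?m powr (-(2 - s))) * norm (w - b) powr (-s) * q powr (-e)"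
            by (intro mult_mono 1 2) auto
          thus ?thesis by (simp add: f_def q_def mult_ac)
        qed
        have f0: "f (1 - norm z) b w \<ge> 0" for b by (simp add: f_def)
        have "N powr (-(2 - s)) * norm (w - a) powr (-s) * q powr (-e) \<le> 16 * f (1 - norm z) z w + 16 * f (1 - norm z) a w"
          using key[of z] key[of a] wa wz f0[of a] f0[of z] by (cases "norm (w - z) \<le> norm (w - a)") auto
        hence "ennreal (N powr (-(2 - s)) * norm (w - a) powr (-s) * q powr (-e)) 
            \<le> ennreal (16 * f (1 - norm z) z w + 16 * f (1 - norm z) a w)"
          by (rule ennreal_leI)
        thus ?thesis using w f0 by (simp add: N_def q_def ennreal_mult' flip: ennreal_numeral)
      qed simp
    qed
    also have "\<dots> = ennreal 16 * (\<integral>\<^sup>+w. indicator (ball 0 1) w * ennreal (f (1 - norm z) z w) \<partial>lborel) 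
       + ennreal 16 * (\<integral>\<^sup>+w. indicator (ball 0 1) w * ennreal (f (1 - norm z) a w) \<partial>lborel)"
      by (simp add: nn_integral_add nn_integral_cmult fm)
    also have "\<dots> \<le> ennreal 16 * ennreal (C * (1 - norm z) powr (-e)) + ennreal 16 * ennreal (C * (1 - norm z) powr (-e))"
      using z by (intro add_mono mult_left_mono C(2)) auto
    also have "\<dots> = ennreal (32 * C * (1 - norm z) powr (-e))"
    proof -
      have "ennreal 16 * ennreal t + ennreal 16 * ennreal t = ennreal (32 * t)" if "t \<ge> 0" for t
        using that by (subst (1 2) ennreal_mult[symmetric]) (auto simp flip: ennreal_plus)
      from this[of "C * (1 - norm z) powr (-e)"] show ?thesis using C by (simp add: mult.assoc)
    qed
    finally show "(\<integral>\<^sup>+w. indicator (ball 0 1) w * ennreal (norm (1 - z * cnj w) powr (-(2 - s)) 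
          * norm (w - a) powr (-s) * (1 - (norm w)\<^sup>2) powr (-e)) \<partial>lborel) \<le> ennreal (32 * C * (1 - norm z) powr (-e))" .
  qed
qed

text \<open>Subadditivity of a power with exponent at most 1: the fractions 1 / (1 + t) and t / (1 +
  t) lie in the unit interval, where x is at most x powr s.\<close>

lemma one_plus_powr_le:
  fixes t s :: real
  assumes "t \<ge> 0" "0 \<le> s" "s \<le> 1"
  shows "(1 + t) powr s \<le> 1 + t powr s"
proof -
  have le: "x \<le> x powr s" if "0 \<le> x" "x \<le> 1" for x
    using that assms powr_mono'[of s 1 x] by auto
  have "1 = 1 / (1 + t) + t / (1 + t)" using assms by (simp add: divide_simps)
  also have "\<dots> \<le> (1 / (1 + t)) powr s + (t / (1 + t)) powr s"
    using assms by (intro add_mono le) auto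
  also have "\<dots> = (1 + t powr s) / (1 + t) powr s"
    using assms by (simp add: powr_divide add_divide_distrib)
  finally show ?thesis using assms by (simp add: divide_simps split: if_splits)
qed

text \<open>The ratio is at most 1 + |z - w| / |w - a|, and |z - w| is at most |1 - z cnj w|. So its
  s-th power costs at most s orders of the kernel in exchange for a pole of order s at a, which is
  the situation of the two-point bound; the summand 1 is the case s = 0 of that bound.\<close>

lemma disc_ratio_bound:
  fixes s e :: real
  assumes s: "0 \<le> s" "s < 1" and e: "0 < e" "e < 1"
  obtains C where "C > 0"
    "\<And>z a. norm z < 1 \<Longrightarrow>
      (\<integral>\<^sup>+w. indicator (ball 0 1) w * ennreal (norm (1 - z * cnj w) powr (-2) 
          * (norm (z - a) / norm (w - a)) powr s * (1 - (norm w)\<^sup>2) powr (-e)) \<partial>(lborel :: complex measure))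
        \<le> ennreal (C * (1 - (norm z)\<^sup>2) powr (-e))"
proof -
  define f where "f = (\<lambda>s z a w. norm (1 - z * cnj w) powr (-(2 - s)) 
          * norm (w - a) powr (-s) * (1 - (norm w)\<^sup>2) powr (-e))" for s :: real and z a w :: complex
  have [measurable]: "(\<lambda>w. f s z a w) \<in> borel_measurable borel" for s z a unfolding f_def by measurable
  have f0: "f s z a w \<ge> 0" for s z a w by (simp add: f_def)
  obtain C where C: "C > 0"
    "\<And>z a. norm z < 1 \<Longrightarrow> (\<integral>\<^sup>+w. indicator (ball 0 1) w * ennreal (f s z a w) \<partial>lborel) \<le> ennreal (C * (1 - norm z) powr (-e))"
    unfolding f_def by (rule disc_two_point_bound[OF s e]) blast
  obtain C' where C': "C' > 0"
    "\<And>z a. norm z < 1 \<Longrightarrow> (\<integral>\<^sup>+w. indicator (ball 0 1) w * ennreal (f 0 z a w) \<partial>lborel) \<le> ennreal (C' * (1 - norm z) powr (-e))"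
    unfolding f_def by (rule disc_two_point_bound[OF _ _ e, of 0]) (simp, simp, blast)
  show ?thesis
  proof (rule that[of "2 * (C + C')"])
    show "2 * (C + C') > 0" using C C' by simp
  next
    fix z a :: complex assume z: "norm z < 1"
    have "(\<integral>\<^sup>+w. indicator (ball 0 1) w * ennreal (norm (1 - z * cnj w) powr (-2) 
          * (norm (z - a) / norm (w - a)) powr s * (1 - (norm w)\<^sup>2) powr (-e)) \<partial>lborel)
       \<le> (\<integral>\<^sup>+w. indicator (ball 0 1) w * ennreal (f 0 z a w) + indicator (ball 0 1) w * ennreal (f s z a w) \<partial>lborel)"
    proof (rule nn_integral_mono_AE, rule AE_mp[OF AE_lborel_singleton[of a]], intro AE_I2 impI)
      fix w assume wa: "w \<noteq> a"
      show "indicator (ball 0 1) w * ennreal (norm (1 - z * cnj w) powr (-2) 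
          * (norm (z - a) / norm (w - a)) powr s * (1 - (norm w)\<^sup>2) powr (-e)) \<le>
          indicator (ball 0 1) w * ennreal (f 0 z a w) + indicator (ball 0 1) w * ennreal (f s z a w)"
      proof (cases "norm w < 1")
        case w: True
        define q where "q = 1 - (norm w)\<^sup>2"
        define N where "N = norm (1 - z * cnj w)"
        note ge = norm_one_minus_cnj_ge[OF z w, folded N_def q_def]
        have "norm (z - a) / norm (w - a) \<le> (norm (w - a) + norm (z - w)) / norm (w - a)"
          using norm_triangle_ineq[of "z - w" "w - a"] by (intro divide_right_mono) auto
        also have "\<dots> = 1 + norm (z - w) / norm (w - a)" using wa by (simp add: add_divide_distrib)
        finally have "(norm (z - a) / norm (w - a)) powr s \<le> (1 + norm (z - w) / norm (w - a)) powr s"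
          using s by (intro powr_mono2) auto
        also have "\<dots> \<le> 1 + (norm (z - w) / norm (w - a)) powr s"
          using s by (intro one_plus_powr_le) auto
        also have "\<dots> = 1 + norm (z - w) powr s * norm (w - a) powr (-s)"
          by (subst powr_divide) (simp only: powr_minus divide_inverse)
        also have "\<dots> \<le> 1 + N powr s * norm (w - a) powr (-s)"
          using s ge by (intro add_left_mono mult_right_mono powr_mono2) auto
        finally have "N powr (-2) * (norm (z - a) / norm (w - a)) powr s * q powr (-e) \<le>
           N powr (-2) * (1 + N powr s * norm (w - a) powr (-s)) * q powr (-e)"
          by (intro mult_right_mono mult_left_mono) auto
        also have "\<dots> = N powr (-2) * norm (w - a) powr (-0) * q powr (-e) + 
            (N powr (-2) * N powr s) * norm (w - a) powr (-s) * q powr (-e)"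
          using wa by (simp add: algebra_simps)
        also have "N powr (-2) * N powr s = N powr (-(2 - s))" by (simp add: powr_add[symmetric])
        finally have "N powr (-2) * (norm (z - a) / norm (w - a)) powr s * q powr (-e) \<le> f 0 z a w + f s z a w"
          by (simp add: f_def N_def q_def)
        hence "ennreal (N powr (-2) * (norm (z - a) / norm (w - a)) powr s * q powr (-e)) \<le> ennreal (f 0 z a w + f s z a w)"
          by (rule ennreal_leI)
        thus ?thesis using w f0 by (simp add: N_def q_def)
      qed simp
    qed
    also have "\<dots> = (\<integral>\<^sup>+w. indicator (ball 0 1) w * ennreal (f 0 z a w) \<partial>lborel)
        + (\<integral>\<^sup>+w. indicator (ball 0 1) w * ennreal (f s z a w) \<partial>lborel)"
      unfolding f_def by (rule nn_integral_add) measurable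
    also have "\<dots> \<le> ennreal (C' * (1 - norm z) powr (-e)) + ennreal (C * (1 - norm z) powr (-e))"
      by (intro add_mono C C' z)
    also have "\<dots> = ennreal ((C + C') * (1 - norm z) powr (-e))"
      using C(1) C'(1) by (simp add: algebra_simps flip: ennreal_plus)
    \<comment> \<open>The boundary weight has to reappear in z in exactly the form it had in w,
      namely as a power of 1 - |z|^2; this is at most twice 1 - |z|.\<close>
    also have "\<dots> \<le> ennreal (2 * (C + C') * (1 - (norm z)\<^sup>2) powr (-e))"
    proof (rule ennreal_leI)
      have "1 - (norm z)\<^sup>2 = (1 - norm z) * (1 + norm z)" by (simp add: power2_eq_square algebra_simps)
      also have "\<dots> \<le> (1 - norm z) * 2" using z by (intro mult_left_mono) auto
      finally have q: "1 - (norm z)\<^sup>2 \<le> 2 * (1 - norm z)" by simp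
      have q0: "1 - (norm z)\<^sup>2 > 0" using z by (simp add: abs_square_less_1)
      have "(1 - norm z) powr (-e) \<le> ((1 - (norm z)\<^sup>2) / 2) powr (-e)"
        using q q0 e by (intro powr_mono2') auto
      also have "\<dots> = (1 - (norm z)\<^sup>2) powr (-e) / 2 powr (-e)" by (rule powr_divide)
      also have "\<dots> = (1 - (norm z)\<^sup>2) powr (-e) * 2 powr e" by (simp only: powr_minus divide_inverse inverse_inverse_eq)
      also have "\<dots> \<le> (1 - (norm z)\<^sup>2) powr (-e) * 2 powr 1" using e by (intro mult_left_mono powr_mono) auto
      finally have "(1 - norm z) powr (-e) \<le> 2 * (1 - (norm z)\<^sup>2) powr (-e)" by simp
      hence "(C + C') * (1 - norm z) powr (-e) \<le> (C + C') * (2 * (1 - (norm z)\<^sup>2) powr (-e))"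
        using C(1) C'(1) by (intro mult_left_mono) auto
      thus "(C + C') * (1 - norm z) powr (-e) \<le> 2 * (C + C') * (1 - (norm z)\<^sup>2) powr (-e)"
        by (simp add: algebra_simps)
    qed
    finally show "(\<integral>\<^sup>+w. indicator (ball 0 1) w * ennreal (norm (1 - z * cnj w) powr (-2) 
          * (norm (z - a) / norm (w - a)) powr s * (1 - (norm w)\<^sup>2) powr (-e)) \<partial>lborel)
        \<le> ennreal (2 * (C + C') * (1 - (norm z)\<^sup>2) powr (-e))" .
  qed
qed

text \<open>Every factor is at most the largest one, and the corresponding power of the largest
  factor is one of the summands.\<close>

lemma prod_le_sum_power_card:
  fixes x :: "'a \<Rightarrow> real"
  assumes "finite A" "A \<noteq> {}" "\<And>k. k \<in> A \<Longrightarrow> x k \<ge> 0"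
  shows "(\<Prod>k\<in>A. x k) \<le> (\<Sum>k\<in>A. x k ^ card A)"
proof -
  obtain m where m: "m \<in> A" "x m = Max (x ` A)"
    using assms Max_in[of "x ` A"] by fastforce
  have "(\<Prod>k\<in>A. x k) \<le> (\<Prod>k\<in>A. x m)"
    using assms m by (intro prod_mono) auto
  also have "\<dots> = x m ^ card A" by simp
  also have "\<dots> \<le> (\<Sum>k\<in>A. x k ^ card A)"
    using assms m by (intro member_le_sum) auto
  finally show ?thesis .
qed

text \<open>Positivity of n matters at x = 0, since \<open>0 powr 0 = 0\<close> while
  \<open>0 ^ 0 = 1\<close>.\<close>

lemma powr_power_pos: "n > 0 \<Longrightarrow> (x powr a) ^ n = x powr (real n * a)" for x a :: real
  by (cases "x = 0") (auto simp: powr_power)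

text \<open>Bounding the product by the sum of its \<open>card A\<close>-th powers leaves a single
  pole in each term, of order \<open>card A * s\<close> < 1. No separation of the poles enters, so
  the constant is uniform in \<open>a\<close>.\<close>

lemma disc_weight_bound:
  fixes s e :: real and A :: "'k set"
  assumes s: "0 \<le> s" "real (card A) * s < 1" and e: "0 < e" "e < 1" and A: "finite A" "A \<noteq> {}"
  obtains C where "C > 0"
    "\<And>z a. norm z < 1 \<Longrightarrow>
      (\<integral>\<^sup>+w. indicator (ball 0 1) w * ennreal (norm (1 - z * cnj w) powr (-2) 
          * (\<Prod>k\<in>A. (norm (z - a k) / norm (w - a k)) powr s) * (1 - (norm w)\<^sup>2) powr (-e)) \<partial>(lborel :: complex measure))
        \<le> ennreal (C * (1 - (norm z)\<^sup>2) powr (-e))"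
proof -
  define t where "t = real (card A) * s"
  have t: "0 \<le> t" "t < 1" using s by (auto simp: t_def)
  define f where "f = (\<lambda>z a w. norm (1 - z * cnj w) powr (-2) 
          * (norm (z - a) / norm (w - a)) powr t * (1 - (norm w)\<^sup>2) powr (-e))" for z a w :: complex
  have [measurable]: "(\<lambda>w. f z a w) \<in> borel_measurable borel" for z a unfolding f_def by measurable
  have f0: "f z a w \<ge> 0" for z a w by (simp add: f_def)
  obtain C where C: "C > 0"
    "\<And>z a. norm z < 1 \<Longrightarrow> (\<integral>\<^sup>+w. indicator (ball 0 1) w * ennreal (f z a w) \<partial>lborel) \<le> ennreal (C * (1 - (norm z)\<^sup>2) powr (-e))"
    unfolding f_def by (rule disc_ratio_bound[OF t e]) blast
  have cA: "card A > 0" using A by (simp add: card_gt_0_iff)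
  show ?thesis
  proof (rule that[of "real (card A) * C"])
    show "real (card A) * C > 0" using C cA by simp
  next
    fix z :: complex and a :: "'k \<Rightarrow> complex" assume z: "norm z < 1"
    have "(\<integral>\<^sup>+w. indicator (ball 0 1) w * ennreal (norm (1 - z * cnj w) powr (-2) 
          * (\<Prod>k\<in>A. (norm (z - a k) / norm (w - a k)) powr s) * (1 - (norm w)\<^sup>2) powr (-e)) \<partial>lborel)
       \<le> (\<integral>\<^sup>+w. (\<Sum>k\<in>A. indicator (ball 0 1) w * ennreal (f z (a k) w)) \<partial>lborel)"
    proof (rule nn_integral_mono)
      fix w :: complex
      have "(\<Prod>k\<in>A. (norm (z - a k) / norm (w - a k)) powr s) \<le> (\<Sum>k\<in>A. ((norm (z - a k) / norm (w - a k)) powr s) ^ card A)"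
        using A by (intro prod_le_sum_power_card) auto
      also have "\<dots> = (\<Sum>k\<in>A. (norm (z - a k) / norm (w - a k)) powr t)"
        using cA by (intro sum.cong refl) (metis powr_power_pos t_def)
      finally have "norm (1 - z * cnj w) powr (-2) 
          * (\<Prod>k\<in>A. (norm (z - a k) / norm (w - a k)) powr s) * (1 - (norm w)\<^sup>2) powr (-e)
         \<le> norm (1 - z * cnj w) powr (-2) 
          * (\<Sum>k\<in>A. (norm (z - a k) / norm (w - a k)) powr t) * (1 - (norm w)\<^sup>2) powr (-e)"
        by (intro mult_right_mono mult_left_mono) auto
      also have "\<dots> = (\<Sum>k\<in>A. f z (a k) w)"
        by (simp add: f_def sum_distrib_left sum_distrib_right)
      finally have "ennreal (norm (1 - z * cnj w) powr (-2) 
          * (\<Prod>k\<in>A. (norm (z - a k) / norm (w - a k)) powr s) * (1 - (norm w)\<^sup>2) powr (-e)) \<le> (\<Sum>k\<in>A. ennreal (f z (a k) w))"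
        using f0 by (subst sum_ennreal) (auto intro: ennreal_leI)
      thus "indicator (ball 0 1) w * ennreal (norm (1 - z * cnj w) powr (-2) 
          * (\<Prod>k\<in>A. (norm (z - a k) / norm (w - a k)) powr s) * (1 - (norm w)\<^sup>2) powr (-e))
         \<le> (\<Sum>k\<in>A. indicator (ball 0 1) w * ennreal (f z (a k) w))"
        by (auto simp: indicator_def)
    qed
    also have "\<dots> = (\<Sum>k\<in>A. \<integral>\<^sup>+w. indicator (ball 0 1) w * ennreal (f z (a k) w) \<partial>lborel)"
      by (rule nn_integral_sum) measurable
    also have "\<dots> \<le> (\<Sum>k\<in>A. ennreal (C * (1 - (norm z)\<^sup>2) powr (-e)))"
      by (intro sum_mono C z)
    also have "\<dots> = ennreal (real (card A) * C * (1 - (norm z)\<^sup>2) powr (-e))"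
      using C(1) by (simp add: ennreal_of_nat_eq_real_of_nat ennreal_mult mult.assoc)
    finally show "(\<integral>\<^sup>+w. indicator (ball 0 1) w * ennreal (norm (1 - z * cnj w) powr (-2) 
          * (\<Prod>k\<in>A. (norm (z - a k) / norm (w - a k)) powr s) * (1 - (norm w)\<^sup>2) powr (-e)) \<partial>lborel)
        \<le> ennreal (real (card A) * C * (1 - (norm z)\<^sup>2) powr (-e))" .
  qed
qed

section \<open>Iteration over the polydisc\<close>

text \<open>Boxes have the same volume under both measures. The product measure is the form in which
  one coordinate after the other can be integrated out.\<close>

lemma nn_integral_lborel_vec:
  fixes f :: "'a::euclidean_space ^ 'n::finite \<Rightarrow> ennreal"
  assumes f: "f \<in> borel_measurable borel"
  shows "(\<integral>\<^sup>+w. f w \<partial>lborel) = (\<integral>\<^sup>+x. f (\<chi> i. x i) \<partial>(\<Pi>\<^sub>M i\<in>UNIV. lborel))"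
    and "(\<lambda>x. \<chi> i. x i) \<in> borel_measurable (\<Pi>\<^sub>M i\<in>(UNIV::'n set). (lborel :: 'a measure))"
proof -
  let ?P = "\<Pi>\<^sub>M i\<in>(UNIV::'n set). (lborel :: 'a measure)"
  let ?v = "\<lambda>x. (\<chi> i. x i) :: 'a ^ 'n"
  interpret product_sigma_finite "\<lambda>_::'n. lborel :: 'a measure" ..
  show v: "?v \<in> borel_measurable ?P"
  proof (subst borel_measurable_euclidean_space, safe)
    fix b :: "'a ^ 'n" assume "b \<in> Basis"
    then obtain i u where "b = axis i u" "u \<in> Basis" by (auto simp: Basis_vec_def)
    thus "(\<lambda>x. ?v x \<bullet> b) \<in> borel_measurable ?P"
      by (simp add: inner_axis)
  qed
  have mb: "w \<in> box l u \<longleftrightarrow> (\<forall>i. w $ i \<in> box (l $ i) (u $ i))" for w l u :: "'a ^ 'n"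
    by (auto simp: mem_box Basis_vec_def inner_axis)
  have bij: "bij_betw (\<lambda>(i, b). axis i b) (UNIV \<times> Basis) (Basis :: ('a ^ 'n) set)"
    unfolding bij_betw_def by (auto simp: inj_on_def Basis_vec_def axis_eq_axis)
  have "distr ?P borel ?v = lborel"
  proof (rule lborel_eqI[symmetric])
    fix l u :: "'a ^ 'n"
    assume le: "\<And>b. b \<in> Basis \<Longrightarrow> l \<bullet> b \<le> u \<bullet> b"
    have le': "l $ i \<bullet> b \<le> u $ i \<bullet> b" if "b \<in> Basis" for i b
      using le[of "axis i b"] that by (simp add: inner_axis axis_in_Basis_iff)
    have "emeasure (distr ?P borel ?v) (box l u) = emeasure ?P (?v -` box l u \<inter> space ?P)"
      using v by (simp add: emeasure_distr)
    also have "?v -` box l u \<inter> space ?P = (\<Pi>\<^sub>E i\<in>UNIV. box (l $ i) (u $ i))"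
      by (auto simp: mb space_PiM PiE_def Pi_iff)
    also have "emeasure ?P \<dots> = (\<Prod>i\<in>UNIV. emeasure lborel (box (l $ i) (u $ i)))"
      by (rule emeasure_PiM) auto
    also have "\<dots> = (\<Prod>i\<in>UNIV. ennreal (\<Prod>b\<in>Basis. (u $ i - l $ i) \<bullet> b))"
      by (intro prod.cong refl emeasure_lborel_box le')
    also have "\<dots> = ennreal (\<Prod>i\<in>UNIV. \<Prod>b\<in>Basis. (u $ i - l $ i) \<bullet> b)"
      by (intro prod_ennreal prod_nonneg) (auto simp: inner_diff_left le')
    also have "(\<Prod>i\<in>UNIV. \<Prod>b\<in>Basis. (u $ i - l $ i) \<bullet> b) = (\<Prod>(i, b)\<in>UNIV \<times> Basis. (u - l) \<bullet> axis i b)"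
      by (subst prod.cartesian_product[symmetric]) (simp add: inner_axis)
    also have "\<dots> = (\<Prod>p\<in>UNIV \<times> Basis. (u - l) \<bullet> (case p of (i, b) \<Rightarrow> axis i b))"
      by (intro prod.cong) auto
    also have "\<dots> = (\<Prod>b\<in>Basis. (u - l) \<bullet> b)"
      by (rule prod.reindex_bij_betw[OF bij])
    finally show "emeasure (distr ?P borel ?v) (box l u) = ennreal (\<Prod>b\<in>Basis. (u - l) \<bullet> b)" .
  qed simp
  thus "(\<integral>\<^sup>+w. f w \<partial>lborel) = (\<integral>\<^sup>+x. f (?v x) \<partial>?P)"
    using nn_integral_distr[of ?v ?P borel f] v f by simp
qed

lemma borel_measurable_vec_nth [measurable]:
  fixes f :: "'a \<Rightarrow> complex ^ 'n::finite"
  assumes "f \<in> borel_measurable M"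
  shows "(\<lambda>x. f x $ i) \<in> borel_measurable M"
proof -
  have "(\<lambda>v :: complex ^ 'n. v $ i) \<in> borel_measurable borel"
    by (intro borel_measurable_continuous_onI continuous_intros)
  from measurable_compose[OF assms this] show ?thesis by simp
qed

definition polydisc :: "(complex ^ 'n::finite) set" where
  "polydisc = {w. \<forall>i. w $ i \<in> ball 0 1}"

lemma polydisc_iff: "w \<in> polydisc \<longleftrightarrow> (\<forall>i. norm (w $ i) < 1)"
  by (simp add: polydisc_def)

lemma open_polydisc: "open (polydisc :: (complex ^ 'n::finite) set)"
proof -
  have "polydisc = (\<Inter>i. (\<lambda>w. w $ i) -` ball 0 1 :: (complex ^ 'n) set)"
    by (auto simp: polydisc_def)
  also have "open \<dots>"
    by (intro open_INT ballI open_vimage continuous_intros) auto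
  finally show ?thesis .
qed

lemma polydisc_borel [measurable]: "polydisc \<in> sets borel"
  by (rule borel_open[OF open_polydisc])

text \<open>The (-s)-th power of the modulus of the Vandermonde product: ordered pairs count each
  difference twice, hence the exponent \<open>- s / 2\<close>. The argument is a bare function so
  that single coordinates can be updated.\<close>

definition vdm_weight :: "real \<Rightarrow> ('n::finite \<Rightarrow> complex) \<Rightarrow> real" where
  "vdm_weight s y = (\<Prod>p\<in>{p. fst p \<noteq> snd p}. norm (y (fst p) - y (snd p)) powr (- s / 2))"

lemma vdm_weight_nonneg: "vdm_weight s y \<ge> 0"
  by (simp add: vdm_weight_def prod_nonneg)

text \<open>Only the pairs containing j change, and they contribute the (-s)-th powers of the
  distances from coordinate j to the others. Moving that coordinate from z to v thus costs exactly
  the product of ratios controlled in one variable.\<close>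

lemma vdm_weight_update:
  fixes Y :: "'n::finite \<Rightarrow> complex"
  assumes z: "\<And>k. k \<noteq> j \<Longrightarrow> Y k \<noteq> z" and v: "\<And>k. k \<noteq> j \<Longrightarrow> Y k \<noteq> v"
  shows "vdm_weight s (Y(j := v)) = vdm_weight s (Y(j := z)) * (\<Prod>k\<in>-{j}. (norm (z - Y k) / norm (v - Y k)) powr s)"
proof -
  let ?h = "\<lambda>w p. norm ((Y(j := w)) (fst p) - (Y(j := w)) (snd p)) powr (- s / 2)"
  define R where "R = {p :: 'n \<times> 'n. fst p \<noteq> snd p \<and> fst p \<noteq> j \<and> snd p \<noteq> j}"
  define A where "A = (\<lambda>k. (j, k)) ` (-{j})"
  define B where "B = (\<lambda>k. (k, j)) ` (-{j})"
  have split: "{p :: 'n \<times> 'n. fst p \<noteq> snd p} = R \<union> (A \<union> B)" 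
  proof (intro set_eqI, goal_cases)
    case (1 p)
    show ?case by (cases p) (auto simp: R_def A_def B_def)
  qed
  have eq: "vdm_weight s (Y(j := w)) = (\<Prod>p\<in>R. norm (Y (fst p) - Y (snd p)) powr (- s / 2)) 
      * (\<Prod>k\<in>-{j}. norm (w - Y k) powr (-s))" for w
  proof -
    have "vdm_weight s (Y(j := w)) = (\<Prod>p\<in>R. ?h w p) * (\<Prod>p\<in>A \<union> B. ?h w p)"
      unfolding vdm_weight_def split by (rule prod.union_disjoint) (auto simp: R_def A_def B_def)
    also have "(\<Prod>p\<in>A \<union> B. ?h w p) = (\<Prod>p\<in>A. ?h w p) * (\<Prod>p\<in>B. ?h w p)"
      by (rule prod.union_disjoint) (auto simp: A_def B_def)
    also have "(\<Prod>p\<in>A. ?h w p) = (\<Prod>k\<in>-{j}. norm (w - Y k) powr (-s/2))"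
      unfolding A_def by (subst prod.reindex) (auto simp: inj_on_def intro!: prod.cong)
    also have "(\<Prod>p\<in>B. ?h w p) = (\<Prod>k\<in>-{j}. norm (w - Y k) powr (-s/2))"
      unfolding B_def by (subst prod.reindex) (auto simp: inj_on_def norm_minus_commute intro!: prod.cong)
    also have "(\<Prod>k\<in>-{j}. norm (w - Y k) powr (-s/2)) * (\<Prod>k\<in>-{j}. norm (w - Y k) powr (-s/2)) = (\<Prod>k\<in>-{j}. norm (w - Y k) powr (-s))"
      by (simp add: prod.distrib[symmetric] powr_add[symmetric])
    also have "(\<Prod>p\<in>R. ?h w p) = (\<Prod>p\<in>R. norm (Y (fst p) - Y (snd p)) powr (- s / 2))"
      by (intro prod.cong refl) (auto simp: R_def)
    finally show ?thesis .
  qed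
  have "(\<Prod>k\<in>-{j}. norm (v - Y k) powr (-s)) = 
     (\<Prod>k\<in>-{j}. norm (z - Y k) powr (-s)) * (\<Prod>k\<in>-{j}. (norm (z - Y k) / norm (v - Y k)) powr s)"
    unfolding prod.distrib[symmetric]
  proof (intro prod.cong refl)
    fix k assume "k \<in> -{j}"
    hence "z - Y k \<noteq> 0" "v - Y k \<noteq> 0" using z[of k] v[of k] by auto
    thus "norm (v - Y k) powr (-s) = norm (z - Y k) powr (-s) * (norm (z - Y k) / norm (v - Y k)) powr s"
      by (subst powr_divide) (simp add: powr_minus divide_simps)
  qed
  thus ?thesis by (simp add: eq)
qed

text \<open>One coordinate of the kernel times the boundary factor of the test function. The
  indicator is built in, so that products can be integrated over the whole product space.\<close>

definition disc_kernel :: "real \<Rightarrow> complex \<Rightarrow> complex \<Rightarrow> real" where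
  "disc_kernel e z v = indicator (ball 0 1) v * (norm (1 - z * cnj v) powr (-2) * (1 - (norm v)\<^sup>2) powr (-e))"

lemma disc_kernel_measurable [measurable]:
  assumes [measurable]: "f \<in> borel_measurable M" 
  shows "(\<lambda>x. disc_kernel e z (f x)) \<in> borel_measurable M"
  unfolding disc_kernel_def by measurable

lemma disc_kernel_nonneg: "disc_kernel e z v \<ge> 0"
  by (simp add: disc_kernel_def)

text \<open>Coordinates outside I are frozen at y, those in I are integrated. For the new index j
  the inner integral over I is bounded by induction with y_j = v, which replaces the coordinates in
  I by those of z. The update formula then moves coordinate j from v to z_j, and the remaining
  integral over v is the one-variable bound with poles \<open>Y k\<close>, for which the constant is
  uniform.\<close>

lemma iterated_weight_bound:
  fixes s e :: real and z :: "'n::finite \<Rightarrow> complex"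
  assumes C: "C \<ge> 0" 
    "\<And>(j :: 'n) a z. norm z < 1 \<Longrightarrow>
      (\<integral>\<^sup>+w. ennreal (disc_kernel e z w * (\<Prod>k\<in>-{j}. (norm (z - a k) / norm (w - a k)) powr s)) \<partial>lborel)
        \<le> ennreal (C * (1 - (norm z)\<^sup>2) powr (-e))"
    and z: "\<And>i. norm (z i) < 1"
  shows "inj (override_on y z I) \<Longrightarrow> 
     (\<integral>\<^sup>+x. ennreal ((\<Prod>i\<in>I. disc_kernel e (z i) (x i)) * vdm_weight s (override_on y x I)) \<partial>(\<Pi>\<^sub>M i\<in>I. lborel))
     \<le> ennreal (C ^ card I * (\<Prod>i\<in>I. (1 - (norm (z i))\<^sup>2) powr (-e)) * vdm_weight s (override_on y z I))"
proof -
  interpret product_sigma_finite "\<lambda>_::'n. lborel :: complex measure" ..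
  have "finite I" by simp
  thus "inj (override_on y z I) \<Longrightarrow> ?thesis"
  proof (induction I arbitrary: y rule: finite_induct)
    case empty
    show ?case by (subst nn_integral_empty) auto
  next
    case (insert j I)
    define Y where "Y = override_on y z I"
    have Yz: "override_on y z (insert j I) = Y(j := z j)"
      using insert.hyps by (auto simp: Y_def override_on_def fun_eq_iff)
    have Yk: "Y k \<noteq> z j" if "k \<noteq> j" for k
      using insert.prems that unfolding Yz inj_def by (metis fun_upd_apply)
    have Yinj: "Y k \<noteq> Y l" if "k \<noteq> j" "l \<noteq> j" "k \<noteq> l" for k l
      using insert.prems that unfolding Yz inj_def by (metis fun_upd_apply)
    let ?F = "\<lambda>x. ennreal ((\<Prod>i\<in>insert j I. disc_kernel e (z i) (x i)) * vdm_weight s (override_on y x (insert j I)))"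
    let ?c = "C ^ card I * (\<Prod>i\<in>I. (1 - (norm (z i))\<^sup>2) powr (-e))"
    have c: "?c \<ge> 0" using C(1) by (intro mult_nonneg_nonneg prod_nonneg) auto
    have comp: "(\<lambda>x. override_on y x (insert j I) k) \<in> borel_measurable (\<Pi>\<^sub>M i\<in>insert j I. (lborel :: complex measure))" for k
      by (cases "k \<in> insert j I") (auto simp: override_on_def)
    have Fm: "?F \<in> borel_measurable (\<Pi>\<^sub>M i\<in>insert j I. (lborel :: complex measure))"
      unfolding vdm_weight_def using comp by measurable
    have comp': "(\<lambda>x. override_on (y(j := v)) x I k) \<in> borel_measurable (\<Pi>\<^sub>M i\<in>I. (lborel :: complex measure))" for k v
      by (cases "k \<in> I") (auto simp: override_on_def)
    have Fm': "(\<lambda>x. (\<Prod>i\<in>I. disc_kernel e (z i) (x i)) * vdm_weight s (override_on (y(j := v)) x I)) \<in> borel_measurable (\<Pi>\<^sub>M i\<in>I. (lborel :: complex measure))" for v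
      unfolding vdm_weight_def using comp' by measurable
    have "(\<integral>\<^sup>+x. ?F x \<partial>(\<Pi>\<^sub>M i\<in>insert j I. lborel)) = (\<integral>\<^sup>+v. (\<integral>\<^sup>+x. ?F (x(j := v)) \<partial>(\<Pi>\<^sub>M i\<in>I. lborel)) \<partial>lborel)"
      using insert.hyps Fm by (intro product_nn_integral_insert_rev) auto
    also have "\<dots> \<le> (\<integral>\<^sup>+v. ennreal (?c * vdm_weight s (Y(j := z j))) * 
        ennreal (disc_kernel e (z j) v * (\<Prod>k\<in>-{j}. (norm (z j - Y k) / norm (v - Y k)) powr s)) \<partial>lborel)"
    proof (rule nn_integral_mono_AE)
      \<comment> \<open>Almost every v avoids the finitely many values \<open>Y k\<close>; this
        keeps the configuration injective, as the induction hypothesis and the update formula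
        require.\<close>
      have "AE v in lborel. \<forall>k\<in>UNIV. v \<noteq> Y k"
        by (subst AE_finite_all) (auto intro: AE_lborel_singleton)
      thus "AE v in lborel. (\<integral>\<^sup>+x. ?F (x(j := v)) \<partial>(\<Pi>\<^sub>M i\<in>I. lborel)) \<le> ennreal (?c * vdm_weight s (Y(j := z j))) * 
        ennreal (disc_kernel e (z j) v * (\<Prod>k\<in>-{j}. (norm (z j - Y k) / norm (v - Y k)) powr s))"
      proof (rule AE_mp, intro AE_I2 impI)
        fix v assume v: "\<forall>k\<in>UNIV. v \<noteq> Y k"
        have ov: "override_on (y(j := v)) x I = override_on y (x(j := v)) (insert j I)" for x
          using insert.hyps by (auto simp: override_on_def fun_eq_iff)
        have ovz: "override_on (y(j := v)) z I = Y(j := v)"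
          using insert.hyps by (auto simp: Y_def override_on_def fun_eq_iff)
        have inj: "inj (override_on (y(j := v)) z I)"
          unfolding ovz inj_def using v Yinj by (metis UNIV_I fun_upd_apply)
        have "(\<integral>\<^sup>+x. ?F (x(j := v)) \<partial>(\<Pi>\<^sub>M i\<in>I. lborel)) = 
           (\<integral>\<^sup>+x. ennreal (disc_kernel e (z j) v) * ennreal ((\<Prod>i\<in>I. disc_kernel e (z i) (x i)) * vdm_weight s (override_on (y(j := v)) x I)) \<partial>(\<Pi>\<^sub>M i\<in>I. lborel))"
        proof (intro nn_integral_cong)
          fix x
          have "(\<Prod>i\<in>I. disc_kernel e (z i) ((x(j := v)) i)) = (\<Prod>i\<in>I. disc_kernel e (z i) (x i))"
            using insert.hyps by (intro prod.cong) auto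
          thus "?F (x(j := v)) = ennreal (disc_kernel e (z j) v) * ennreal ((\<Prod>i\<in>I. disc_kernel e (z i) (x i)) * vdm_weight s (override_on (y(j := v)) x I))"
            using insert.hyps by (simp add: ov disc_kernel_nonneg mult.assoc flip: ennreal_mult')
        qed
        also have "\<dots> = ennreal (disc_kernel e (z j) v) * (\<integral>\<^sup>+x. ennreal ((\<Prod>i\<in>I. disc_kernel e (z i) (x i)) * vdm_weight s (override_on (y(j := v)) x I)) \<partial>(\<Pi>\<^sub>M i\<in>I. lborel))"
          using Fm' by (intro nn_integral_cmult) auto
        also have "\<dots> \<le> ennreal (disc_kernel e (z j) v) * ennreal (?c * vdm_weight s (Y(j := v)))"
          using insert.IH[OF inj, unfolded ovz] by (rule mult_left_mono) simp
        also have "vdm_weight s (Y(j := v)) = vdm_weight s (Y(j := z j)) * (\<Prod>k\<in>-{j}. (norm (z j - Y k) / norm (v - Y k)) powr s)"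
          by (rule vdm_weight_update) (use Yk v[THEN bspec, symmetric] in simp_all)
        also have "ennreal (disc_kernel e (z j) v) * ennreal (?c * \<dots>) = ennreal (?c * vdm_weight s (Y(j := z j))) * 
          ennreal (disc_kernel e (z j) v * (\<Prod>k\<in>-{j}. (norm (z j - Y k) / norm (v - Y k)) powr s))"
          using c C(1) by (subst (1 2) ennreal_mult'[symmetric])
            (auto intro!: mult_nonneg_nonneg prod_nonneg simp: disc_kernel_nonneg vdm_weight_nonneg mult_ac)
        finally show "(\<integral>\<^sup>+x. ?F (x(j := v)) \<partial>(\<Pi>\<^sub>M i\<in>I. lborel)) \<le> ennreal (?c * vdm_weight s (Y(j := z j))) * 
          ennreal (disc_kernel e (z j) v * (\<Prod>k\<in>-{j}. (norm (z j - Y k) / norm (v - Y k)) powr s))" .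
      qed
    qed
    also have "\<dots> = ennreal (?c * vdm_weight s (Y(j := z j))) * 
       (\<integral>\<^sup>+v. ennreal (disc_kernel e (z j) v * (\<Prod>k\<in>-{j}. (norm (z j - Y k) / norm (v - Y k)) powr s)) \<partial>lborel)"
      by (rule nn_integral_cmult) measurable
    also have "\<dots> \<le> ennreal (?c * vdm_weight s (Y(j := z j))) * ennreal (C * (1 - (norm (z j))\<^sup>2) powr (-e))"
      by (intro mult_left_mono C(2) z) auto
    also have "\<dots> = ennreal (C ^ card (insert j I) * (\<Prod>i\<in>insert j I. (1 - (norm (z i))\<^sup>2) powr (-e)) * vdm_weight s (Y(j := z j)))"
      using insert.hyps c C(1) by (subst ennreal_mult'[symmetric])
        (auto intro!: mult_nonneg_nonneg prod_nonneg simp: vdm_weight_nonneg mult_ac)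
    finally show ?case unfolding Yz .
  qed
qed

lemma polydisc_weight_bound:
  fixes s e :: real
  assumes n: "CARD('n::finite) \<ge> 2"
    and s: "0 \<le> s" "(real CARD('n) - 1) * s < 1" and e: "0 < e" "e < 1"
  obtains C where "C > 0"
    "\<And>z :: complex ^ 'n. z \<in> polydisc \<Longrightarrow> inj (($) z) \<Longrightarrow>
      (\<integral>\<^sup>+w. indicator polydisc w * ennreal ((\<Prod>i\<in>UNIV. norm (1 - z $ i * cnj (w $ i)) powr (-2) * (1 - (norm (w $ i))\<^sup>2) powr (-e))
         * vdm_weight s (($) w)) \<partial>lborel)
        \<le> ennreal (C * (\<Prod>i\<in>UNIV. (1 - (norm (z $ i))\<^sup>2) powr (-e)) * vdm_weight s (($) z))"
proof -
  have "\<exists>C>0. \<forall>z (a :: 'n \<Rightarrow> complex). norm z < 1 \<longrightarrow>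
      (\<integral>\<^sup>+w. ennreal (disc_kernel e z w * (\<Prod>k\<in>-{j}. (norm (z - a k) / norm (w - a k)) powr s)) \<partial>lborel)
        \<le> ennreal (C * (1 - (norm z)\<^sup>2) powr (-e))" for j :: 'n
  proof -
    have card: "card (-{j}) = CARD('n) - 1" by (simp add: Compl_eq_Diff_UNIV)
    have "card (-{j}) > 0" using n card by linarith
    hence "-{j} \<noteq> {}" unfolding card_gt_0_iff by blast
    hence A: "finite (-{j})" "-{j} \<noteq> {}" by auto
    have s': "real (card (-{j})) * s < 1" using s n by (simp add: card of_nat_diff)
    obtain C where C: "C > 0"
     "\<And>z a. norm z < 1 \<Longrightarrow>
      (\<integral>\<^sup>+w. indicator (ball 0 1) w * ennreal (norm (1 - z * cnj w) powr (-2) 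
          * (\<Prod>k\<in>-{j}. (norm (z - a k) / norm (w - a k)) powr s) * (1 - (norm w)\<^sup>2) powr (-e)) \<partial>lborel)
        \<le> ennreal (C * (1 - (norm z)\<^sup>2) powr (-e))"
      by (rule disc_weight_bound[OF s(1) s' e A]) blast
    have "ennreal (disc_kernel e z w * (\<Prod>k\<in>-{j}. (norm (z - a k) / norm (w - a k)) powr s)) = 
       indicator (ball 0 1) w * ennreal (norm (1 - z * cnj w) powr (-2) 
          * (\<Prod>k\<in>-{j}. (norm (z - a k) / norm (w - a k)) powr s) * (1 - (norm w)\<^sup>2) powr (-e))" for z w and a :: "'n \<Rightarrow> complex"
      by (auto simp: disc_kernel_def indicator_def mult_ac)
    thus ?thesis by (intro exI[of _ C] conjI allI impI) (use C in \<open>simp_all only:\<close>)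
  qed
  note ex = this
  define c where "c = (\<lambda>j :: 'n. SOME C. C > 0 \<and> (\<forall>z (a :: 'n \<Rightarrow> complex). norm z < 1 \<longrightarrow>
      (\<integral>\<^sup>+w. ennreal (disc_kernel e z w * (\<Prod>k\<in>-{j}. (norm (z - a k) / norm (w - a k)) powr s)) \<partial>lborel)
        \<le> ennreal (C * (1 - (norm z)\<^sup>2) powr (-e))))"
  have "c j > 0 \<and> (\<forall>z (a :: 'n \<Rightarrow> complex). norm z < 1 \<longrightarrow>
      (\<integral>\<^sup>+w. ennreal (disc_kernel e z w * (\<Prod>k\<in>-{j}. (norm (z - a k) / norm (w - a k)) powr s)) \<partial>lborel)
        \<le> ennreal (c j * (1 - (norm z)\<^sup>2) powr (-e)))" for j
    unfolding c_def by (rule someI_ex[OF ex])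
  hence c: "\<And>j. c j > 0" "\<And>j z (a :: 'n \<Rightarrow> complex). norm z < 1 \<Longrightarrow>
      (\<integral>\<^sup>+w. ennreal (disc_kernel e z w * (\<Prod>k\<in>-{j}. (norm (z - a k) / norm (w - a k)) powr s)) \<partial>lborel)
        \<le> ennreal (c j * (1 - (norm z)\<^sup>2) powr (-e))"
    by blast+
  \<comment> \<open>The one-variable bound supplies one constant for each omitted index j; the sum
    serves for all of them.\<close>
  define C where "C = (\<Sum>j\<in>UNIV. c j)"
  have C0: "C > 0" unfolding C_def using c by (intro sum_pos) auto
  have cC: "c j \<le> C" for j unfolding C_def using c by (intro member_le_sum) (auto simp: less_imp_le)
  have C: "(\<integral>\<^sup>+w. ennreal (disc_kernel e z w * (\<Prod>k\<in>-{j}. (norm (z - a k) / norm (w - a k)) powr s)) \<partial>lborel)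
        \<le> ennreal (C * (1 - (norm z)\<^sup>2) powr (-e))" if "norm z < 1" for j z and a :: "'n \<Rightarrow> complex"
    using c(2)[OF that, where j = j and a = a] by (rule order_trans) (intro ennreal_leI mult_right_mono cC, simp)
  show ?thesis
  proof (rule that[of "C ^ CARD('n)"])
    show "C ^ CARD('n) > 0" using C0 by simp
  next
    fix z :: "complex ^ 'n" assume z: "z \<in> polydisc" and inj: "inj (($) z)"
    define F where "F = (\<lambda>w :: complex ^ 'n. ennreal ((\<Prod>i\<in>UNIV. disc_kernel e (z $ i) (w $ i)) * vdm_weight s (($) w)))"
    have F: "F \<in> borel_measurable borel" unfolding F_def vdm_weight_def by measurable
    have vl: "($) (vec_lambda x) = x" for x :: "'n \<Rightarrow> complex" by (simp add: fun_eq_iff)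
    have ov: "override_on y x UNIV = x" for x y :: "'n \<Rightarrow> complex" by (auto simp: override_on_def)
    have "(\<integral>\<^sup>+w. indicator polydisc w * ennreal ((\<Prod>i\<in>UNIV. norm (1 - z $ i * cnj (w $ i)) powr (-2) * (1 - (norm (w $ i))\<^sup>2) powr (-e))
         * vdm_weight s (($) w)) \<partial>lborel) = (\<integral>\<^sup>+w. F w \<partial>lborel)"
    proof (intro nn_integral_cong)
      fix w :: "complex ^ 'n"
      show "indicator polydisc w * ennreal ((\<Prod>i\<in>UNIV. norm (1 - z $ i * cnj (w $ i)) powr (-2) * (1 - (norm (w $ i))\<^sup>2) powr (-e))
         * vdm_weight s (($) w)) = F w"
      proof (cases "w \<in> polydisc")
        case True
        hence "(\<Prod>i\<in>UNIV. disc_kernel e (z $ i) (w $ i)) = (\<Prod>i\<in>UNIV. norm (1 - z $ i * cnj (w $ i)) powr (-2) * (1 - (norm (w $ i))\<^sup>2) powr (-e))"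
          by (intro prod.cong) (auto simp: disc_kernel_def polydisc_def)
        thus ?thesis using True by (simp add: F_def)
      next
        case False
        then obtain i where "\<not> norm (w $ i) < 1" by (auto simp: polydisc_iff)
        hence "disc_kernel e (z $ i) (w $ i) = 0" by (simp add: disc_kernel_def)
        hence "(\<Prod>i\<in>UNIV. disc_kernel e (z $ i) (w $ i)) = 0" by (intro prod_zero) auto
        thus ?thesis using False by (simp only: F_def) simp
      qed
    qed
    also have "\<dots> = (\<integral>\<^sup>+x. F (\<chi> i. x i) \<partial>(\<Pi>\<^sub>M i\<in>UNIV. lborel))"
      by (rule nn_integral_lborel_vec(1)[OF F])
    also have "\<dots> \<le> ennreal (C ^ CARD('n) * (\<Prod>i\<in>UNIV. (1 - (norm (z $ i))\<^sup>2) powr (-e)) * vdm_weight s (($) z))"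
      using iterated_weight_bound[where C = C and e = e and s = s and z = "($) z" and y = undefined and I = UNIV, OF _ C] C0 z inj
      by (auto simp: F_def ov vl polydisc_iff)
    finally show "(\<integral>\<^sup>+w. indicator polydisc w * ennreal ((\<Prod>i\<in>UNIV. norm (1 - z $ i * cnj (w $ i)) powr (-2) * (1 - (norm (w $ i))\<^sup>2) powr (-e))
         * vdm_weight s (($) w)) \<partial>lborel) \<le> ennreal (C ^ CARD('n) * (\<Prod>i\<in>UNIV. (1 - (norm (z $ i))\<^sup>2) powr (-e)) * vdm_weight s (($) z))" .
  qed
qed

section \<open>Change of variables in complex space\<close>

text \<open>The index type carries no order, so triangularity is expressed by a rank r. A
  permutation with nonzero product never increases the rank, and induction on the rank shows that it
  fixes every index; only the identity contributes to the determinant.\<close>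

lemma det_unit_triangular:
  fixes A :: "'a::comm_ring_1 ^ 'n ^ 'n" and r :: "'n \<Rightarrow> nat"
  assumes diag: "\<And>i. A $ i $ i = 1" and tri: "\<And>i j. A $ i $ j \<noteq> 0 \<Longrightarrow> i = j \<or> r j < r i"
  shows "det A = 1"
proof -
  have zero: "(\<Prod>i\<in>UNIV. A $ i $ p i) = 0" if p: "p permutes UNIV" "p \<noteq> id" for p
  proof (rule ccontr)
    assume "(\<Prod>i\<in>UNIV. A $ i $ p i) \<noteq> 0"
    hence nz: "A $ i $ p i \<noteq> 0" for i using prod_zero[of UNIV "\<lambda>i. A $ i $ p i"] by auto
    have "p i = i" for i
    proof (induction "r i" arbitrary: i rule: less_induct)
      case less
      show ?case
      proof (rule ccontr)
        assume ne: "p i \<noteq> i"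
        hence "r (p i) < r i" using tri[OF nz[of i]] by auto
        hence "p (p i) = p i" by (rule less)
        hence "p i = i" using permutes_inj[OF p(1)] by (auto dest: injD)
        with ne show False ..
      qed
    qed
    with p(2) show False by auto
  qed
  have "det A = (\<Sum>p\<in>{id}. of_int (sign p) * (\<Prod>i\<in>UNIV. A $ i $ p i))"
    unfolding det_def
    by (rule sum.mono_neutral_right) (auto simp: zero permutes_id finite_permutations)
  thus ?thesis by (simp add: diag)
qed

text \<open>The numeral type \<open>'n bit0\<close> has \<open>2 * CARD('n)\<close> elements and is a well-order, as the
  library's change of variables theorem requires of the index type.\<close>
definition re_im_index :: "'n::finite bit0 \<Rightarrow> 'n \<times> bool" where
  "re_im_index = (SOME f. bij f)"

lemma bij_re_im_index: "bij (re_im_index :: 'n::finite bit0 \<Rightarrow> 'n \<times> bool)"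
proof -
  have "card (UNIV :: 'n bit0 set) = card (UNIV :: ('n \<times> bool) set)"
    by (simp add: card_cartesian_product flip: UNIV_Times_UNIV)
  hence "\<exists>f :: 'n bit0 \<Rightarrow> 'n \<times> bool. bij f"
    by (intro finite_same_card_bij) auto
  thus ?thesis unfolding re_im_index_def by (rule someI_ex)
qed

definition to_complex_vec :: "real ^ ('n::finite bit0) \<Rightarrow> complex ^ 'n" where
  "to_complex_vec x = (\<chi> i. Complex (x $ inv re_im_index (i, False)) (x $ inv re_im_index (i, True)))"

definition to_real_vec :: "complex ^ 'n::finite \<Rightarrow> real ^ ('n bit0)" where
  "to_real_vec v = (\<chi> k. if snd (re_im_index k) then Im (v $ fst (re_im_index k)) else Re (v $ fst (re_im_index k)))"

lemma re_im_index_inv [simp]: "re_im_index (inv re_im_index p) = p" "inv re_im_index (re_im_index k) = k"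
  by (rule surj_f_inv_f[OF bij_is_surj[OF bij_re_im_index]], rule inv_f_f[OF bij_is_inj[OF bij_re_im_index]])

lemma re_im_index_eq: "re_im_index k = re_im_index l \<longleftrightarrow> k = l"
  using bij_is_inj[OF bij_re_im_index] by (rule inj_eq)

lemma to_complex_to_real [simp]: "to_complex_vec (to_real_vec v) = v"
  by (simp add: to_complex_vec_def to_real_vec_def vec_eq_iff)

lemma to_real_to_complex [simp]: "to_real_vec (to_complex_vec x) = x"
proof -
  have "to_real_vec (to_complex_vec x) $ k = x $ k" for k
  proof -
    obtain i b where ib: "re_im_index k = (i, b)" by fastforce
    hence "k = inv re_im_index (i, b)" by (metis re_im_index_inv(2))
    thus ?thesis by (cases b) (simp_all add: to_real_vec_def to_complex_vec_def)
  qed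
  thus ?thesis by (simp add: vec_eq_iff)
qed

lemma linear_to_complex_vec: "linear to_complex_vec"
  by (rule linearI) (auto simp: to_complex_vec_def vec_eq_iff complex_eq_iff)

lemma linear_to_real_vec: "linear to_real_vec"
  by (rule linearI) (auto simp: to_real_vec_def vec_eq_iff)

lemma lborel_to_complex_vec: "distr lborel borel to_complex_vec = (lborel :: (complex ^ 'n::finite) measure)"
proof (rule lborel_distr_basis[OF linear_to_complex_vec])
  have ax: "to_complex_vec (axis k 1) = axis (fst (re_im_index k)) (if snd (re_im_index k) then \<i> else 1)" for k :: "'n bit0"
  proof -
    obtain i b where ib: "re_im_index k = (i, b)" by fastforce
    hence k: "k = inv re_im_index (i, b)" by (metis re_im_index_inv(2))
    have eq: "inv re_im_index p = inv re_im_index q \<longleftrightarrow> p = q" for p q :: "'n \<times> bool"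
      by (metis re_im_index_inv(1))
    show ?thesis unfolding k by (auto simp: to_complex_vec_def axis_def vec_eq_iff complex_eq_iff eq)
  qed
  have B: "(Basis :: (real ^ 'n bit0) set) = range (\<lambda>k. axis k 1)" by (auto simp: Basis_vec_def)
  have B': "(Basis :: (complex ^ 'n) set) = range (\<lambda>(i, b). axis i (if b then \<i> else 1))"
    by (auto simp: Basis_vec_def Basis_complex_def image_iff split: prod.splits) (metis (full_types))+
  show "bij_betw to_complex_vec Basis (Basis :: (complex ^ 'n) set)"
  proof (rule bij_betw_imageI)
    show "inj_on to_complex_vec (Basis :: (real ^ 'n bit0) set)"
      by (rule inj_on_inverseI[of _ to_real_vec]) simp
    have "to_complex_vec ` (Basis :: (real ^ 'n bit0) set) 
        = range ((\<lambda>(i, b). axis i (if b then \<i> else 1)) \<circ> re_im_index)"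
      unfolding B image_image by (simp add: ax case_prod_unfold o_def)
    also have "\<dots> = (\<lambda>(i, b). axis i (if b then \<i> else 1)) ` range re_im_index"
      by (simp only: image_comp)
    also have "range re_im_index = (UNIV :: ('n \<times> bool) set)" by (rule bij_is_surj[OF bij_re_im_index])
    finally show "to_complex_vec ` (Basis :: (real ^ 'n bit0) set) = (Basis :: (complex ^ 'n) set)"
      using B' by simp
  qed
qed

section \<open>Real Jacobians of complex matrices\<close>

definition realify :: "complex ^ 'n::finite ^ 'n \<Rightarrow> real ^ ('n bit0) ^ ('n bit0)" where
  "realify A = (\<chi> k l. let a = A $ fst (re_im_index k) $ fst (re_im_index l) in
     if snd (re_im_index k) = snd (re_im_index l) then Re a else if snd (re_im_index k) then Im a else - Im a)"

lemma realify_mult_vec: "realify A *v x = to_real_vec (A *v to_complex_vec x)"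
proof -
  have "(realify A *v x) $ k = to_real_vec (A *v to_complex_vec x) $ k" for k
  proof -
    define i b where "i = fst (re_im_index k)" and "b = snd (re_im_index k)"
    define c where "c = (\<lambda>j d. if b = d then Re (A $ i $ j) else if b then Im (A $ i $ j) else - Im (A $ i $ j))"
    have "(realify A *v x) $ k = (\<Sum>l\<in>UNIV. c (fst (re_im_index l)) (snd (re_im_index l)) * x $ inv re_im_index (re_im_index l))"
      unfolding c_def i_def b_def by (simp add: matrix_vector_mult_def realify_def Let_def)
    also have "\<dots> = (\<Sum>p\<in>UNIV. c (fst p) (snd p) * x $ inv re_im_index p)"
      using sum.reindex_bij_betw[OF bij_re_im_index, of "\<lambda>p. c (fst p) (snd p) * x $ inv re_im_index p"] by simp
    also have "\<dots> = (\<Sum>j\<in>UNIV. \<Sum>d\<in>UNIV. c j d * x $ inv re_im_index (j, d))"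
      by (subst UNIV_Times_UNIV[symmetric], subst sum.cartesian_product) (simp add: case_prod_unfold)
    also have "\<dots> = (\<Sum>j\<in>UNIV. (if b then Im else Re) (A $ i $ j * to_complex_vec x $ j))"
      by (intro sum.cong refl) (cases b; simp add: UNIV_bool c_def to_complex_vec_def)
    also have "\<dots> = to_real_vec (A *v to_complex_vec x) $ k"
      by (simp add: to_real_vec_def matrix_vector_mult_def i_def b_def)
    finally show ?thesis .
  qed
  thus ?thesis by (simp add: vec_eq_iff)
qed

lemma realify_mult: "realify (A ** B) = realify A ** realify B"
  by (simp add: matrix_eq realify_mult_vec matrix_vector_mul_assoc[symmetric])

text \<open>This number equals |det A|^2. It is accessed through multiplicativity, invariance under
  transposition, and its values on unipotent triangular and on diagonal matrices.\<close>

definition real_jacobian :: "complex ^ 'n::finite ^ 'n \<Rightarrow> real" where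
  "real_jacobian A = \<bar>det (realify A)\<bar>"

lemma real_jacobian_mult: "real_jacobian (A ** B) = real_jacobian A * real_jacobian B"
  by (simp add: real_jacobian_def realify_mult det_mul abs_mult)

lemma real_jacobian_adjoint: "real_jacobian (\<chi> i j. cnj (A $ j $ i)) = real_jacobian A"
proof -
  have "realify (\<chi> i j. cnj (A $ j $ i)) = transpose (realify A)"
    by (auto simp: realify_def transpose_def vec_eq_iff Let_def)
  thus ?thesis by (simp add: real_jacobian_def det_transpose)
qed

text \<open>In real coordinates, conjugation is the reflection C that flips the imaginary parts. The
  conjugate matrix acts as C A C, and C has determinant of square 1.\<close>

lemma real_jacobian_cnj:
  fixes A :: "complex ^ 'n::finite ^ 'n"
  shows "real_jacobian (\<chi> i j. cnj (A $ i $ j)) = real_jacobian A"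
proof -
  define c :: "'n bit0 \<Rightarrow> real" where "c = (\<lambda>k. if snd (re_im_index k) then -1 else 1)"
  define C :: "real ^ ('n bit0) ^ ('n bit0)" where "C = (\<chi> k l. if k = l then c k else 0)"
  have CM: "(C ** M) $ k $ l = c k * M $ k $ l" for M :: "real ^ ('n bit0) ^ ('n bit0)" and k l
    by (simp add: C_def matrix_matrix_mult_def if_distrib[of "\<lambda>t. t * _"] cong: if_cong)
  have MC: "(M ** C) $ k $ l = M $ k $ l * c l" for M :: "real ^ ('n bit0) ^ ('n bit0)" and k l
    by (simp add: C_def matrix_matrix_mult_def if_distrib[of "\<lambda>t. _ * t"] cong: if_cong)
  have "C ** C = mat 1"
    by (auto simp: vec_eq_iff CM mat_def) (auto simp: C_def c_def)
  hence "det C * det C = 1" by (metis det_mul det_I)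
  moreover have "realify (\<chi> i j. cnj (A $ i $ j)) = C ** realify A ** C"
    by (auto simp: vec_eq_iff CM MC c_def realify_def Let_def)
  hence "det (realify (\<chi> i j. cnj (A $ i $ j))) = (det C * det C) * det (realify A)"
    by (simp add: det_mul mult_ac)
  ultimately show ?thesis by (simp add: real_jacobian_def)
qed

lemma real_jacobian_transpose: "real_jacobian (transpose A) = real_jacobian A"
  using real_jacobian_adjoint[of "\<chi> i j. cnj (A $ i $ j)"] real_jacobian_cnj[of A]
  by (simp add: transpose_def)

lemma real_jacobian_unit_triangular:
  fixes A :: "complex ^ 'n::finite ^ 'n"
  assumes diag: "\<And>i. A $ i $ i = 1" and tri: "\<And>i j. A $ i $ j \<noteq> 0 \<Longrightarrow> i = j \<or> (r j :: nat) < r i"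
  shows "real_jacobian A = 1"
proof -
  have "det (realify A) = 1"
  proof (rule det_unit_triangular[where r = "\<lambda>k. r (fst (re_im_index k))"])
    show "realify A $ k $ k = 1" for k by (simp add: realify_def diag)
    fix k l assume nz: "realify A $ k $ l \<noteq> 0"
    hence nz': "A $ fst (re_im_index k) $ fst (re_im_index l) \<noteq> 0"
      by (auto simp: realify_def Let_def split: if_splits)
    show "k = l \<or> r (fst (re_im_index l)) < r (fst (re_im_index k))"
    proof (cases "fst (re_im_index k) = fst (re_im_index l)")
      case True
      hence "snd (re_im_index k) = snd (re_im_index l)" using nz by (auto simp: realify_def Let_def diag split: if_splits)
      hence "re_im_index k = re_im_index l" using True by (simp add: prod_eq_iff)
      thus ?thesis by (simp add: re_im_index_eq)
    qed (use tri[OF nz'] in auto)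
  qed
  thus ?thesis by (simp add: real_jacobian_def)
qed

text \<open>The product of the matrix with its conjugate is real diagonal with entries |d_i|^2. Its
  realification has each of them twice, so the square of the wanted number is the square of the
  claimed product; both are nonnegative.\<close>

lemma real_jacobian_diag:
  fixes d :: "'n::finite \<Rightarrow> complex"
  shows
  "real_jacobian (\<chi> i j. if i = j then d i else 0) = (\<Prod>i\<in>UNIV. (norm (d i))\<^sup>2)"
proof -
  let ?D = "\<lambda>d. (\<chi> i j. if i = j then d i else 0) :: complex ^ 'n ^ 'n"
  have "real_jacobian (?D d) * real_jacobian (?D (\<lambda>i. cnj (d i))) = real_jacobian (?D (\<lambda>i. of_real ((norm (d i))\<^sup>2)))"
  proof -
    have "?D d ** ?D (\<lambda>i. cnj (d i)) = ?D (\<lambda>i. of_real ((norm (d i))\<^sup>2))"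
      by (auto simp: matrix_matrix_mult_def vec_eq_iff if_distrib[of "\<lambda>t. t * _"] complex_norm_square simp del: of_real_power cong: if_cong)
    thus ?thesis by (simp flip: real_jacobian_mult)
  qed
  also have "?D (\<lambda>i. cnj (d i)) = (\<chi> i j. cnj (?D d $ i $ j))" by (auto simp: vec_eq_iff)
  also have "real_jacobian \<dots> = real_jacobian (?D d)" by (rule real_jacobian_cnj)
  also have "real_jacobian (?D (\<lambda>i. of_real ((norm (d i))\<^sup>2))) = \<bar>\<Prod>k\<in>UNIV. (norm (d (fst (re_im_index k))))\<^sup>2\<bar>"
    unfolding real_jacobian_def
  proof (subst det_diagonal)
    show "realify (?D (\<lambda>i. of_real ((norm (d i))\<^sup>2))) $ k $ l = 0" if "k \<noteq> l" for k l
    proof (cases "fst (re_im_index k) = fst (re_im_index l)")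
      case True
      hence "snd (re_im_index k) \<noteq> snd (re_im_index l)" using that re_im_index_eq[of k l] by (auto simp: prod_eq_iff)
      thus ?thesis by (auto simp: realify_def)
    qed (simp add: realify_def)
  qed (simp add: realify_def)
  also have "(\<Prod>k\<in>UNIV. (norm (d (fst (re_im_index k))))\<^sup>2) = (\<Prod>p\<in>(UNIV :: ('n \<times> bool) set). (norm (d (fst p)))\<^sup>2)"
    using prod.reindex_bij_betw[OF bij_re_im_index, of "\<lambda>p. (norm (d (fst p)))\<^sup>2"] by simp
  also have "\<dots> = (\<Prod>i\<in>UNIV. \<Prod>b\<in>(UNIV :: bool set). (norm (d i))\<^sup>2)"
    by (subst UNIV_Times_UNIV[symmetric], subst prod.cartesian_product) (simp add: case_prod_unfold)
  also have "\<dots> = (\<Prod>i\<in>UNIV. (norm (d i))\<^sup>2) * (\<Prod>i\<in>UNIV. (norm (d i))\<^sup>2)"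
    by (simp add: power2_eq_square prod.distrib)
  finally have "(real_jacobian (?D d))\<^sup>2 = (\<Prod>i\<in>UNIV. (norm (d i))\<^sup>2)\<^sup>2"
    by (simp add: power2_eq_square abs_mult prod_nonneg)
  thus ?thesis
    by (subst (asm) power2_eq_iff_nonneg) (auto simp: real_jacobian_def intro!: prod_nonneg)
qed

text \<open>An open set is a countable union of compact sets, whose continuous images are
  compact.\<close>

lemma borel_image_of_open:
  fixes g :: "'a::euclidean_space \<Rightarrow> 'b::{t2_space}"
  assumes S: "open S" and g: "continuous_on S g"
  shows "g ` S \<in> sets borel"
proof -
  obtain C where C: "\<And>n::nat. compact (C n)" "\<And>n. C n \<subseteq> S" "(\<Union>n. C n) = S"
    using open_Union_compact_subsets[OF S] by metis
  have "g ` S = (\<Union>n. g ` C n)" using C(3) by blast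
  also have "\<dots> \<in> sets borel"
  proof (rule sets.countable_UN, intro image_subsetI)
    fix n
    have "compact (g ` C n)" using g C by (intro compact_continuous_image) (auto intro: continuous_on_subset)
    thus "g ` C n \<in> sets borel" by (intro borel_closed compact_imp_closed)
  qed
  finally show ?thesis .
qed

text \<open>The volume formula for images of sets, applied in real coordinates to S intersected with
  the preimage of a Borel set B, identifies Lebesgue measure on the image with a push-forward
  measure; arbitrary Borel integrands follow. Finiteness of the volume of the image lets the set
  formula be read as a finite integral, and d is a Borel function on the whole space that agrees
  with the Jacobian on S.\<close>

theorem complex_change_of_variables:
  fixes g :: "complex ^ 'n::finite \<Rightarrow> complex ^ 'n" and A :: "complex ^ 'n \<Rightarrow> complex ^ 'n ^ 'n"
  assumes S: "open S" and der: "\<And>w. w \<in> S \<Longrightarrow> (g has_derivative (\<lambda>v. A w *v v)) (at w)"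
    and inj: "inj_on g S" and fin: "emeasure lborel (g ` S) < \<infinity>"
    and d: "d \<in> borel_measurable borel" "\<And>w. w \<in> S \<Longrightarrow> real_jacobian (A w) = d w"
    and F: "F \<in> borel_measurable borel"
  shows "(\<integral>\<^sup>+w. indicator (g ` S) w * F w \<partial>lborel) = (\<integral>\<^sup>+w. indicator S w * (ennreal (d w) * F (g w)) \<partial>lborel)"
proof -
  have cont: "continuous_on S g"
    using der by (intro continuous_at_imp_continuous_on ballI has_derivative_continuous)
  have Sb[measurable]: "S \<in> sets borel" using S by simp
  have gS[measurable]: "g ` S \<in> sets borel" by (rule borel_image_of_open[OF S cont])
  have gm: "g \<in> borel_measurable (restrict_space lborel S)"
    using borel_measurable_continuous_on_restrict[OF cont] by (simp cong: measurable_cong_sets add: sets_restrict_space)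
  have cm: "to_complex_vec \<in> borel_measurable (borel :: (real ^ 'n bit0) measure)"
    using linear_to_complex_vec by (intro borel_measurable_continuous_onI linear_continuous_on linear_conv_bounded_linear[THEN iffD1])
  have key: "emeasure lborel (g ` S \<inter> B) = (\<integral>\<^sup>+w. indicator (S \<inter> g -` B) w * ennreal (d w) \<partial>lborel)" if B: "B \<in> sets borel" for B
  proof -
    define T where "T = S \<inter> g -` B"
    have Tm: "T \<in> sets borel"
      using measurable_sets[OF gm B] S by (simp add: T_def sets_restrict_space_iff space_restrict_space Int_commute)
    have gT: "g ` T = g ` S \<inter> B" by (auto simp: T_def)
    have gTm: "g ` T \<in> sets borel" using gS B by (simp add: gT)
    define h where "h = to_real_vec \<circ> g \<circ> to_complex_vec"
    define T' where "T' = (to_complex_vec :: real ^ 'n bit0 \<Rightarrow> _) -` T"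
    have T'm: "T' \<in> sets borel" using measurable_sets[OF cm Tm] by (simp add: T'_def)
    have hT: "h ` T' = to_complex_vec -` (g ` T)"
    proof (intro set_eqI iffI)
      fix x assume "x \<in> h ` T'" thus "x \<in> to_complex_vec -` (g ` T)" by (auto simp: h_def T'_def)
    next
      fix x assume "x \<in> to_complex_vec -` (g ` T)"
      then obtain w where w: "w \<in> T" "to_complex_vec x = g w" by auto
      hence "x = h (to_real_vec w)" "to_real_vec w \<in> T'"
        by (auto simp: h_def T'_def) (metis to_real_to_complex)
      thus "x \<in> h ` T'" by blast
    qed
    have hTm: "h ` T' \<in> sets borel" using measurable_sets[OF cm gTm] by (simp add: hT)
    have e: "emeasure lborel (h ` T') = emeasure lborel (g ` T)"
      unfolding hT using gTm cm
      by (subst lborel_to_complex_vec[symmetric]) (simp add: emeasure_distr)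
    have fin': "emeasure lborel (h ` T') < \<infinity>"
      unfolding e gT using gS by (intro le_less_trans[OF emeasure_mono fin]) auto
    have lm: "h ` T' \<in> lmeasurable"
      using hTm fin' by (simp add: fmeasurable_def)
    have hd: "(h has_derivative (\<lambda>y. realify (A (to_complex_vec x)) *v y)) (at x within T')" if "x \<in> T'" for x
    proof -
      have "to_complex_vec x \<in> S" using that by (auto simp: T'_def T_def)
      note dg = der[OF this]
      have dc: "(to_complex_vec has_derivative to_complex_vec) (at x)"
        using linear_to_complex_vec by (intro bounded_linear_imp_has_derivative linear_conv_bounded_linear[THEN iffD1])
      have dr: "(to_real_vec has_derivative to_real_vec) (at ((g \<circ> to_complex_vec) x))"
        using linear_to_real_vec by (intro bounded_linear_imp_has_derivative linear_conv_bounded_linear[THEN iffD1])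
      have "((to_real_vec \<circ> (g \<circ> to_complex_vec)) has_derivative (to_real_vec \<circ> ((\<lambda>v. A (to_complex_vec x) *v v) \<circ> to_complex_vec))) (at x)"
        by (rule diff_chain_at[OF diff_chain_at[OF dc dg] dr])
      thus ?thesis by (simp add: h_def o_def realify_mult_vec has_derivative_at_withinI)
    qed
    have hinj: "inj_on h T'"
    proof (rule inj_onI)
      fix x y assume xy: "x \<in> T'" "y \<in> T'" "h x = h y"
      hence "g (to_complex_vec x) = g (to_complex_vec y)" by (simp add: h_def) (metis to_complex_to_real)
      hence "to_complex_vec x = to_complex_vec y" using inj xy by (auto simp: T'_def T_def dest: inj_onD)
      thus "x = y" by (metis to_real_to_complex)
    qed
    have T'l: "T' \<in> sets lebesgue" using T'm by simp
    have "((\<lambda>x. \<bar>det (matrix (\<lambda>y. realify (A (to_complex_vec x)) *v y))\<bar>) has_integral measure lebesgue (h ` T')) T'"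
      using has_measure_differentiable_image[OF T'l hd hinj, of "measure lebesgue (h ` T')"] lm by simp
    hence "((\<lambda>x. d (to_complex_vec x)) has_integral measure lebesgue (h ` T')) T'"
      by (rule has_integral_eq[rotated]) (auto simp: T'_def T_def matrix_of_matrix_vector_mul real_jacobian_def simp flip: d(2))
    hence hi: "((\<lambda>x. if x \<in> T' then d (to_complex_vec x) else 0) has_integral measure lebesgue (h ` T')) UNIV"
      by (simp only: has_integral_restrict_UNIV)
    have dm: "(\<lambda>x. d (to_complex_vec x)) \<in> borel_measurable (borel :: (real ^ 'n bit0) measure)"
      by (rule measurable_compose[OF cm d(1)])
    have d0: "d w \<ge> 0" if "w \<in> S" for w using d(2)[OF that] by (metis abs_ge_zero real_jacobian_def)
    have "(\<integral>\<^sup>+x. ennreal (if x \<in> T' then d (to_complex_vec x) else 0) \<partial>lborel) = ennreal (measure lebesgue (h ` T'))"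
      using T'm dm d0 by (intro nn_integral_has_integral_lborel[OF _ _ hi] measurable_If_set) (auto simp: T'_def T_def)
    also have "\<dots> = emeasure lborel (h ` T')"
      using hTm fin' by (simp add: measure_def)
    also have "(\<integral>\<^sup>+x. ennreal (if x \<in> T' then d (to_complex_vec x) else 0) \<partial>lborel) =
        (\<integral>\<^sup>+x. (\<lambda>w. indicator T w * ennreal (d w)) (to_complex_vec x) \<partial>(lborel :: (real ^ 'n bit0) measure))"
      by (intro nn_integral_cong) (auto simp: T'_def indicator_def)
    also have "\<dots> = (\<integral>\<^sup>+w. indicator T w * ennreal (d w) \<partial>lborel)"
      using Tm d(1) cm by (subst lborel_to_complex_vec[symmetric], subst nn_integral_distr) auto
    finally have "emeasure lborel (g ` T) = (\<integral>\<^sup>+w. indicator T w * ennreal (d w) \<partial>lborel)" by (simp add: e)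
    thus ?thesis unfolding gT unfolding T_def .
  qed
  have eq: "density lborel (indicator (g ` S)) = distr (density (restrict_space lborel S) (\<lambda>w. ennreal (d w))) borel g"
  proof (rule measure_eqI)
    show "sets (density lborel (indicator (g ` S))) = sets (distr (density (restrict_space lborel S) (\<lambda>w. ennreal (d w))) borel g)"
      by simp
  next
    fix B assume "B \<in> sets (density lborel (indicator (g ` S)))"
    hence B: "B \<in> sets borel" by simp
    have dm: "(\<lambda>w. ennreal (d w)) \<in> borel_measurable (restrict_space lborel S)"
      using d(1) by (intro measurable_restrict_space1) simp
    have gm': "g \<in> measurable (density (restrict_space lborel S) (\<lambda>w. ennreal (d w))) borel"
      using gm by simp
    have gB: "g -` B \<inter> S \<in> sets (restrict_space lborel S)"
      using measurable_sets[OF gm B] by (simp add: space_restrict_space)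
    have "emeasure (distr (density (restrict_space lborel S) (\<lambda>w. ennreal (d w))) borel g) B
      = emeasure (density (restrict_space lborel S) (\<lambda>w. ennreal (d w))) (g -` B \<inter> S)"
      using emeasure_distr[OF gm' B] by (simp add: space_restrict_space)
    also have "\<dots> = (\<integral>\<^sup>+w. ennreal (d w) * indicator (g -` B \<inter> S) w \<partial>restrict_space lborel S)"
      by (rule emeasure_density[OF dm gB])
    also have "\<dots> = (\<integral>\<^sup>+w. indicator (S \<inter> g -` B) w * ennreal (d w) \<partial>lborel)"
      by (subst nn_integral_restrict_space) (auto simp: indicator_def intro!: nn_integral_cong)
    also have "\<dots> = emeasure lborel (g ` S \<inter> B)" using key[OF B] by simp
    also have "\<dots> = emeasure (density lborel (indicator (g ` S))) B"
      using B by (simp add: emeasure_density flip: indicator_inter_arith)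
    finally show "emeasure (density lborel (indicator (g ` S))) B = emeasure (distr (density (restrict_space lborel S) (\<lambda>w. ennreal (d w))) borel g) B" ..
  qed
  have "(\<integral>\<^sup>+w. indicator (g ` S) w * F w \<partial>lborel) = (\<integral>\<^sup>+w. F w \<partial>density lborel (indicator (g ` S)))"
    using F by (subst nn_integral_density) auto
  also have "\<dots> = (\<integral>\<^sup>+w. F (g w) \<partial>density (restrict_space lborel S) (\<lambda>w. ennreal (d w)))"
    unfolding eq using F gm by (subst nn_integral_distr) auto
  also have "\<dots> = (\<integral>\<^sup>+w. ennreal (d w) * F (g w) \<partial>restrict_space lborel S)"
    using d(1) measurable_compose[OF gm F] 
    by (subst nn_integral_density) (auto intro!: measurable_restrict_space1)
  also have "\<dots> = (\<integral>\<^sup>+w. indicator S w * (ennreal (d w) * F (g w)) \<partial>lborel)"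
    by (subst nn_integral_restrict_space) (auto simp: mult.commute)
  finally show ?thesis .
qed

section \<open>The symmetrization map and its Jacobian\<close>

text \<open>The variables are restricted to A because the partial derivatives of \<open>esym\<close>
  are elementary symmetric polynomials in all variables but one.\<close>

definition esym_on :: "'n set \<Rightarrow> nat \<Rightarrow> complex ^ 'n::finite \<Rightarrow> complex" where
  "esym_on A k w = (\<Sum>S | S \<subseteq> A \<and> card S = k. \<Prod>i\<in>S. w $ i)"

lemma esym_eq_esym_on: "esym k w = esym_on UNIV k w"
  by (simp add: esym_def esym_on_def)

lemma esym_on_0 [simp]: "esym_on A 0 w = 1"
proof -
  have "{S. S \<subseteq> A \<and> card S = 0} = {{}}" by (auto simp: card_eq_0_iff)
  thus ?thesis by (simp add: esym_on_def)
qed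

lemma esym_on_eq_0: "k > card A \<Longrightarrow> esym_on A k w = 0"
proof -
  assume k: "k > card A"
  have "S \<notin> {S. S \<subseteq> A \<and> card S = k}" for S using card_mono[of A S] k by auto
  hence "{S. S \<subseteq> A \<and> card S = k} = {}" by blast
  thus ?thesis by (simp only: esym_on_def sum.empty)
qed

lemma esym_on_insert:
  assumes j: "j \<notin> A"
  shows "esym_on (insert j A) (Suc k) w = esym_on A (Suc k) w + w $ j * esym_on A k w"
proof -
  let ?X = "{S. S \<subseteq> A \<and> card S = Suc k}" and ?Y = "{S. S \<subseteq> A \<and> card S = k}"
  have "{S. S \<subseteq> insert j A \<and> card S = Suc k} = ?X \<union> insert j ` ?Y"
  proof (intro set_eqI iffI)
    fix S assume S: "S \<in> {S. S \<subseteq> insert j A \<and> card S = Suc k}"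
    show "S \<in> ?X \<union> insert j ` ?Y"
    proof (cases "j \<in> S")
      case True
      hence "S = insert j (S - {j})" "S - {j} \<subseteq> A" "card (S - {j}) = k" using S by auto
      thus ?thesis by blast
    qed (use S in auto)
  next
    fix S assume "S \<in> ?X \<union> insert j ` ?Y"
    thus "S \<in> {S. S \<subseteq> insert j A \<and> card S = Suc k}"
    proof
      assume "S \<in> insert j ` ?Y"
      then obtain R where R: "S = insert j R" "R \<subseteq> A" "card R = k" by auto
      hence "j \<notin> R" using j by auto
      thus ?thesis using R by auto
    qed auto
  qed
  hence "esym_on (insert j A) (Suc k) w = (\<Sum>S\<in>?X. \<Prod>i\<in>S. w $ i) + (\<Sum>S\<in>insert j ` ?Y. \<Prod>i\<in>S. w $ i)"
    unfolding esym_on_def using j by (simp only:) (intro sum.union_disjoint, auto)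
  also have "(\<Sum>S\<in>insert j ` ?Y. \<Prod>i\<in>S. w $ i) = (\<Sum>S\<in>?Y. \<Prod>i\<in>insert j S. w $ i)"
    using j by (subst sum.reindex) (auto simp: inj_on_def o_def dest: insert_ident[THEN iffD1, rotated 2])
  also have "\<dots> = (\<Sum>S\<in>?Y. w $ j * (\<Prod>i\<in>S. w $ i))"
    using j by (intro sum.cong refl prod.insert) auto
  also have "\<dots> = w $ j * esym_on A k w" by (simp add: esym_on_def sum_distrib_left)
  finally show ?thesis by (simp add: esym_on_def)
qed

text \<open>Vieta's formula in homogeneous form. With x = 1 it is the generating function in t, with
  t = -1 the polynomial in x with roots w_i; both specializations are used.\<close>

lemma prod_add_eq_esym_on:
  "(\<Prod>i\<in>A. x + t * w $ i) = (\<Sum>k\<le>card A. x ^ (card A - k) * t ^ k * esym_on A k w)"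
proof -
  have "finite A" by simp
  thus ?thesis
  proof (induction A rule: finite_induct)
    case (insert j A)
    let ?c = "card A"
    let ?f = "\<lambda>k. x ^ (?c - k) * t ^ k * esym_on A k w"
    have "(\<Prod>i\<in>insert j A. x + t * w $ i) = (x + t * w $ j) * (\<Sum>k\<le>?c. ?f k)"
      using insert by simp
    also have "\<dots> = (\<Sum>k\<le>?c. x * ?f k) + (\<Sum>k\<le>?c. t * w $ j * ?f k)"
      by (simp add: distrib_right sum_distrib_left sum.distrib)
    also have "(\<Sum>k\<le>?c. x * ?f k) = (\<Sum>k\<le>Suc ?c. x ^ (Suc ?c - k) * t ^ k * esym_on A k w)"
      by (simp add: esym_on_eq_0 Suc_diff_le mult.assoc)
    also have "\<dots> = x ^ Suc ?c + (\<Sum>k\<le>?c. x ^ (?c - k) * t ^ Suc k * esym_on A (Suc k) w)"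
      by (subst sum.atMost_Suc_shift) simp
    also have "\<dots> + (\<Sum>k\<le>?c. t * w $ j * ?f k) = 
       x ^ Suc ?c + (\<Sum>k\<le>?c. x ^ (?c - k) * t ^ Suc k * esym_on (insert j A) (Suc k) w)"
      using insert.hyps by (simp add: esym_on_insert algebra_simps sum.distrib[symmetric])
    also have "\<dots> = (\<Sum>k\<le>Suc ?c. x ^ (Suc ?c - k) * t ^ k * esym_on (insert j A) k w)"
      by (subst sum.atMost_Suc_shift) simp
    finally show ?case using insert.hyps by simp
  qed simp
qed

lemma esym_Suc_delete: "esym (Suc k) w = esym_on (-{j}) (Suc k) w + w $ j * esym_on (-{j}) k w"
proof -
  have "insert j (-{j}) = UNIV" by auto
  thus ?thesis using esym_on_insert[of j "-{j}" k w] by (simp add: esym_eq_esym_on)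
qed

text \<open>Solves the deletion recursion for the polynomial without w_j. The result is a polynomial
  in w_j whose coefficients do not depend on j; this is the factorization of the Jacobian matrix
  through a Vandermonde matrix.\<close>

lemma esym_on_delete_eq: "esym_on (-{j}) k w = (\<Sum>l\<le>k. (- w $ j) ^ l * esym (k - l) w)"
proof (induction k)
  case 0
  show ?case by (simp add: esym_eq_esym_on)
next
  case (Suc k)
  have "esym_on (-{j}) (Suc k) w = esym (Suc k) w - w $ j * esym_on (-{j}) k w"
    using esym_Suc_delete[of k w j] by simp
  also have "\<dots> = esym (Suc k) w + (\<Sum>l\<le>k. (- w $ j) ^ Suc l * esym (k - l) w)"
    by (simp add: Suc sum_distrib_left sum_negf[symmetric] mult.assoc)
  also have "\<dots> = (\<Sum>l\<le>Suc k. (- w $ j) ^ l * esym (Suc k - l) w)"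
    by (subst sum.atMost_Suc_shift) simp
  finally show ?case .
qed

lemma esym_on_permute:
  assumes p: "bij p"
  shows "esym_on A k (\<chi> i. w $ p i) = esym_on (p ` A) k w"
proof -
  have inj: "inj_on p X" for X using p by (auto simp: bij_def inj_on_def inj_def)
  have "{S. S \<subseteq> p ` A \<and> card S = k} = image p ` {S. S \<subseteq> A \<and> card S = k}"
  proof (intro set_eqI iffI)
    fix S assume S: "S \<in> {S. S \<subseteq> p ` A \<and> card S = k}"
    then obtain R where "R \<subseteq> A" "S = p ` R" by (auto simp: subset_image_iff)
    thus "S \<in> image p ` {S. S \<subseteq> A \<and> card S = k}" using S by (auto simp: card_image[OF inj])
  qed (auto simp: card_image[OF inj])
  hence "esym_on (p ` A) k w = (\<Sum>S\<in>image p ` {S. S \<subseteq> A \<and> card S = k}. \<Prod>i\<in>S. w $ i)"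
    by (simp add: esym_on_def)
  also have "\<dots> = (\<Sum>S | S \<subseteq> A \<and> card S = k. \<Prod>i\<in>p ` S. w $ i)"
  proof (subst sum.reindex)
    show "inj_on (image p) {S. S \<subseteq> A \<and> card S = k}"
      by (rule inj_onI) (simp add: inj_image_eq_iff[OF bij_is_inj[OF p]])
  qed simp
  also have "\<dots> = esym_on A k (\<chi> i. w $ p i)"
    unfolding esym_on_def by (intro sum.cong refl, subst prod.reindex) (auto simp: inj)
  finally show ?thesis ..
qed

lemma esym_permute: "bij p \<Longrightarrow> esym k (\<chi> i. w $ p i) = esym k w"
  by (simp add: esym_eq_esym_on esym_on_permute bij_is_surj)

definition sym_map :: "('n::finite \<Rightarrow> nat) \<Rightarrow> complex ^ 'n \<Rightarrow> complex ^ 'n" where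
  "sym_map \<iota> w = (\<chi> j. esym (\<iota> j) w)"

text \<open>The derivative of e_k in w_j is e_(k-1) of the other variables. The truncated
  subtraction is harmless because \<iota> takes values from 1 on.\<close>

definition sym_jac :: "('n::finite \<Rightarrow> nat) \<Rightarrow> complex ^ 'n \<Rightarrow> complex ^ 'n ^ 'n" where
  "sym_jac \<iota> w = (\<chi> m j. esym_on (-{j}) (\<iota> m - 1) w)"

text \<open>Taken as a determinant, it changes sign correctly under permutations without an order on
  the factors; \<open>norm_vdm_sq\<close> relates its modulus to the product of differences.\<close>

definition vdm :: "('n::finite \<Rightarrow> nat) \<Rightarrow> complex ^ 'n \<Rightarrow> complex" where
  "vdm \<iota> w = det (sym_jac \<iota> w)"

lemma symm_polydisk_eq: "symm_polydisk \<iota> = sym_map \<iota> ` polydisc"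
  by (auto simp: symm_polydisk_def sym_map_def polydisc_def vec_eq_iff image_iff)

lemma sym_map_permute: "bij p \<Longrightarrow> sym_map \<iota> (\<chi> i. w $ p i) = sym_map \<iota> w"
  by (simp add: sym_map_def esym_permute)

lemma vdm_permute:
  assumes p: "p permutes UNIV"
  shows "vdm \<iota> (\<chi> i. w $ p i) = of_int (sign p) * vdm \<iota> w"
proof -
  have b: "bij p" using p by (simp add: permutes_bij)
  have "p ` (-{j}) = -{p j}" for j using b by (auto simp: bij_def inj_def surj_def)
  hence "sym_jac \<iota> (\<chi> i. w $ p i) = (\<chi> m j. sym_jac \<iota> w $ m $ p j)"
    by (simp add: sym_jac_def esym_on_permute[OF b])
  thus ?thesis unfolding vdm_def by (simp add: det_permute_columns[OF p])
qed

text \<open>Differentiating the monomial of S removes one index i from S. After exchanging the two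
  sums, R = S - {i} runs through the k-element sets that avoid i.\<close>

lemma has_derivative_esym:
  "(esym (Suc k) has_derivative (\<lambda>v. \<Sum>j\<in>UNIV. esym_on (-{j}) k w * v $ j)) (at w)"
proof -
  have nth: "((\<lambda>w. w $ i) has_derivative (\<lambda>v. v $ i)) (at w)" for i
    by (intro bounded_linear_imp_has_derivative bounded_linear_vec_nth)
  have "((\<lambda>w. esym (Suc k) w) has_derivative (\<lambda>v. \<Sum>S | card S = Suc k. \<Sum>i\<in>S. v $ i * (\<Prod>j\<in>S - {i}. w $ j))) (at w)"
    unfolding esym_def by (intro has_derivative_sum has_derivative_prod nth)
  also have "(\<lambda>v. \<Sum>S | card S = Suc k. \<Sum>i\<in>S. v $ i * (\<Prod>j\<in>S - {i}. w $ j)) = (\<lambda>v. \<Sum>j\<in>UNIV. esym_on (-{j}) k w * v $ j)"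
  proof
    fix v :: "complex ^ 'a"
    have "(\<Sum>S | card S = Suc k. \<Sum>i\<in>S. v $ i * (\<Prod>j\<in>S - {i}. w $ j)) 
       = (\<Sum>S | card S = Suc k. \<Sum>i | i \<in> S. v $ i * (\<Prod>j\<in>S - {i}. w $ j))" by simp
    also have "\<dots> = (\<Sum>i\<in>UNIV. \<Sum>S | card S = Suc k \<and> i \<in> S. v $ i * (\<Prod>j\<in>S - {i}. w $ j))"
      using sum.swap_restrict[of "{S :: 'a set. card S = Suc k}" UNIV "\<lambda>S i. v $ i * (\<Prod>j\<in>S - {i}. w $ j)" "\<lambda>S i. i \<in> S"] by simp
    also have "\<dots> = (\<Sum>i\<in>UNIV. esym_on (-{i}) k w * v $ i)"
    proof (intro sum.cong refl)
      fix i
      have "(\<Sum>S | card S = Suc k \<and> i \<in> S. v $ i * (\<Prod>j\<in>S - {i}. w $ j)) = (\<Sum>R | R \<subseteq> -{i} \<and> card R = k. v $ i * (\<Prod>j\<in>R. w $ j))"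
        by (rule sum.reindex_bij_witness[of _ "insert i" "\<lambda>S. S - {i}"]) (auto simp: card_insert_if)
      thus "(\<Sum>S | card S = Suc k \<and> i \<in> S. v $ i * (\<Prod>j\<in>S - {i}. w $ j)) = esym_on (-{i}) k w * v $ i"
        by (simp add: esym_on_def sum_distrib_left mult.commute)
    qed
    finally show "(\<Sum>S | card S = Suc k. \<Sum>i\<in>S. v $ i * (\<Prod>j\<in>S - {i}. w $ j)) = (\<Sum>j\<in>UNIV. esym_on (-{j}) k w * v $ j)" .
  qed
  finally show ?thesis .
qed

lemma has_derivative_vecI:
  fixes f :: "'a::real_normed_vector \<Rightarrow> 'b::euclidean_space ^ 'n::finite"
  assumes "\<And>m. ((\<lambda>x. f x $ m) has_derivative (\<lambda>v. f' v $ m)) (at a within S)"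
  shows "(f has_derivative f') (at a within S)"
proof -
  have "((\<lambda>x. f x \<bullet> b) has_derivative (\<lambda>v. f' v \<bullet> b)) (at a within S)" if b_Basis: "b \<in> Basis" for b
  proof -
    obtain i u where b: "b = axis i u" using b_Basis unfolding Basis_vec_def by blast
    show ?thesis unfolding b inner_axis by (intro has_derivative_inner_left assms)
  qed
  thus ?thesis by (subst has_derivative_componentwise_within) auto
qed

lemma has_derivative_sym_map:
  assumes \<iota>: "\<And>j. \<iota> j \<ge> 1"
  shows "(sym_map \<iota> has_derivative (\<lambda>v. sym_jac \<iota> w *v v)) (at w)"
proof -
  have "((\<lambda>w. sym_map \<iota> w $ m) has_derivative (\<lambda>v. (sym_jac \<iota> w *v v) $ m)) (at w)" for m
  proof -
    have "\<iota> m = Suc (\<iota> m - 1)" using \<iota>[of m] by simp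
    hence "(esym (\<iota> m) has_derivative (\<lambda>v. \<Sum>j\<in>UNIV. esym_on (-{j}) (\<iota> m - 1) w * v $ j)) (at w)"
      using has_derivative_esym[of "\<iota> m - 1" w] by simp
    thus ?thesis by (simp add: sym_map_def sym_jac_def matrix_vector_mult_def)
  qed
  thus ?thesis by (rule has_derivative_vecI)
qed

text \<open>With \<open>V\<close> the Vandermonde matrix of \<open>-w\<close>, \<open>T\<close> unipotent and \<open>R\<close> a signed reversal,
  the Jacobian matrix \<open>D\<close> satisfies \<open>D = T V\<^sup>T\<close> and \<open>V R D = diag(\<Prod>i\<noteq>j. w\<^sub>j - w\<^sub>i)\<close>; so every
  multiplicative, transposition invariant functional of \<open>D\<close> is determined.\<close>
lemma sym_jac_factor:
  fixes \<iota> :: "'n::finite \<Rightarrow> nat"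
  assumes \<iota>: "bij_betw \<iota> UNIV {1..CARD('n)}"
  obtains T V R :: "complex ^ 'n ^ 'n" where
    "\<And>i. T $ i $ i = 1" "\<And>i j. T $ i $ j \<noteq> 0 \<Longrightarrow> i = j \<or> \<iota> j < \<iota> i"
    "R ** R = mat 1" "sym_jac \<iota> w = T ** transpose V"
    "V ** R ** sym_jac \<iota> w = (\<chi> i j. if i = j then \<Prod>k\<in>-{i}. w $ i - w $ k else 0)"
proof -
  let ?n = "CARD('n)"
  define rev where "rev = (\<lambda>m. inv_into UNIV \<iota> (?n + 1 - \<iota> m))"
  have inj: "inj \<iota>" using \<iota> by (simp add: bij_betw_def)
  have rng: "1 \<le> \<iota> m" "\<iota> m \<le> ?n" for m using \<iota> by (auto simp: bij_betw_def)
  have \<iota>_rev: "\<iota> (rev m) = ?n + 1 - \<iota> m" for m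
  proof -
    have "?n + 1 - \<iota> m \<in> range \<iota>" using \<iota> rng[of m] by (auto simp: bij_betw_def)
    thus ?thesis by (simp add: rev_def f_inv_into_f)
  qed
  have rev_rev: "rev (rev m) = m" for m
    by (rule injD[OF inj]) (use rng[of m] in \<open>simp add: \<iota>_rev\<close>)
  have lt: "\<iota> m - 1 < ?n" for m using rng[of m] by linarith
  have bij': "bij_betw (\<lambda>m. \<iota> m - 1) UNIV {..<?n}"
  proof (rule bij_betw_imageI)
    show "inj (\<lambda>m. \<iota> m - 1)"
    proof (rule injI)
      fix x y assume "\<iota> x - 1 = \<iota> y - 1"
      hence "\<iota> x = \<iota> y" using rng[of x] rng[of y] by simp
      thus "x = y" using inj by (simp add: inj_eq)
    qed
    thus "range (\<lambda>m. \<iota> m - 1) = {..<?n}"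
      by (intro card_subset_eq) (use lt in \<open>auto simp: card_image\<close>)
  qed
  define T :: "complex ^ 'n ^ 'n" where "T = (\<chi> m l. if \<iota> l \<le> \<iota> m then esym (\<iota> m - \<iota> l) w else 0)"
  define V :: "complex ^ 'n ^ 'n" where "V = (\<chi> j l. (- w $ j) ^ (\<iota> l - 1))"
  \<comment> \<open>The reversal turns the exponent \<iota> m - 1 into n - \<iota> m, and the sign
    makes the total sign of entry m in a row of V R equal to that of (-1)^(\<iota> m - 1). Row l of
    V R against column j of the Jacobian matrix is then, by Vieta, the product of w_l - w_i over i
    different from j, which vanishes unless l = j.\<close>
  define R :: "complex ^ 'n ^ 'n" where "R = (\<chi> p m. if p = rev m then (-1) ^ (?n - 1) else 0)"
  show ?thesis
  proof (rule that[of T R V])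
    show "T $ i $ i = 1" for i by (simp add: T_def esym_eq_esym_on)
    show "i = j \<or> \<iota> j < \<iota> i" if "T $ i $ j \<noteq> 0" for i j
      using that inj by (auto simp: T_def inj_eq order.order_iff_strict split: if_splits)
    show "R ** R = mat 1"
    proof -
      have "(\<Sum>k\<in>UNIV. R $ i $ k * R $ k $ j) = (if i = j then 1 else 0)" for i j
      proof -
        have "(\<Sum>k\<in>UNIV. R $ i $ k * R $ k $ j) = (\<Sum>k\<in>UNIV. if k = rev j then R $ i $ k * (-1) ^ (?n - 1) else 0)"
          by (intro sum.cong refl) (simp add: R_def)
        also have "\<dots> = R $ i $ rev j * (-1) ^ (?n - 1)" by simp
        also have "\<dots> = (if i = j then 1 else 0)" by (simp add: R_def rev_rev flip: power_add)
        finally show ?thesis .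
      qed
      thus ?thesis by (simp add: matrix_matrix_mult_def mat_def vec_eq_iff)
    qed
    show "sym_jac \<iota> w = T ** transpose V"
    proof -
      have "sym_jac \<iota> w $ m $ j = (T ** transpose V) $ m $ j" for m j
      proof -
        have "(T ** transpose V) $ m $ j = (\<Sum>l\<in>UNIV. (\<lambda>l. if l \<le> \<iota> m - 1 then (- w $ j) ^ l * esym (\<iota> m - 1 - l) w else 0) (\<iota> l - 1))"
          using rng[of m] by (auto simp: matrix_matrix_mult_def T_def V_def transpose_def intro!: sum.cong)
            (metis One_nat_def Suc_pred' diff_Suc_eq_diff_pred  le_diff_iff less_eq_Suc_le mult.commute rng(1))+
        also have "\<dots> = (\<Sum>l<?n. if l \<le> \<iota> m - 1 then (- w $ j) ^ l * esym (\<iota> m - 1 - l) w else 0)"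
          by (rule sum.reindex_bij_betw[OF bij'])
        also have "\<dots> = (\<Sum>l\<le>\<iota> m - 1. (- w $ j) ^ l * esym (\<iota> m - 1 - l) w)"
          using rng[of m] by (intro sum.mono_neutral_cong_right) auto
        also have "\<dots> = sym_jac \<iota> w $ m $ j" by (simp add: sym_jac_def esym_on_delete_eq)
        finally show ?thesis ..
      qed
      thus ?thesis by (simp add: vec_eq_iff)
    qed
    have VR: "(V ** R) $ l $ m = (-1) ^ (\<iota> m - 1) * (w $ l) ^ (?n - \<iota> m)" for l m
    proof -
      have "(V ** R) $ l $ m = (\<Sum>k\<in>UNIV. if k = rev m then V $ l $ k * (-1) ^ (?n - 1) else 0)"
      proof -
        have "(V ** R) $ l $ m = (\<Sum>k\<in>UNIV. V $ l $ k * R $ k $ m)" by (simp add: matrix_matrix_mult_def)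
        also have "\<dots> = (\<Sum>k\<in>UNIV. if k = rev m then V $ l $ k * (-1) ^ (?n - 1) else 0)"
          by (intro sum.cong refl) (simp add: R_def)
        finally show ?thesis .
      qed
      also have "\<dots> = (- w $ l) ^ (\<iota> (rev m) - 1) * (-1) ^ (?n - 1)" by (simp add: V_def)
      also have "\<dots> = (w $ l) ^ (?n - \<iota> m) * ((-1) ^ (?n - \<iota> m) * (-1) ^ (?n - 1))"
        using rng[of m] by (simp add: \<iota>_rev power_minus[of "w $ l"] mult_ac)
      also have "(-1) ^ (?n - \<iota> m) * (-1) ^ (?n - 1) = ((-1) ^ (\<iota> m - 1) :: complex)"
      proof -
        have "(?n - \<iota> m) + (?n - 1) = 2 * (?n - \<iota> m) + (\<iota> m - 1)" using rng[of m] by simp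
        thus ?thesis by (metis (no_types, lifting) mult_1 power_add power_minus1_even)
      qed
      finally show ?thesis by simp
    qed
    show "V ** R ** sym_jac \<iota> w = (\<chi> i j. if i = j then \<Prod>k\<in>-{i}. w $ i - w $ k else 0)"
    proof -
      have "(V ** R ** sym_jac \<iota> w) $ l $ j = (if l = j then \<Prod>k\<in>-{l}. w $ l - w $ k else 0)" for l j
      proof -
        have c: "card (-{j}) = ?n - 1" by (simp add: Compl_eq_Diff_UNIV)
        have "(V ** R ** sym_jac \<iota> w) $ l $ j = (\<Sum>m\<in>UNIV. (\<lambda>k. (w $ l) ^ (?n - 1 - k) * (-1) ^ k * esym_on (-{j}) k w) (\<iota> m - 1))"
          unfolding matrix_matrix_mult_def[of "V ** R"] using rng
          by (simp add: VR sym_jac_def) (intro sum.cong refl, simp add: mult_ac)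
        also have "\<dots> = (\<Sum>k<?n. (w $ l) ^ (?n - 1 - k) * (-1) ^ k * esym_on (-{j}) k w)"
          by (rule sum.reindex_bij_betw[OF bij'])
        also have "{..<?n} = {..card (-{j})}" unfolding c set_eq_iff lessThan_iff atMost_iff using lt[of l] by (intro allI) linarith
        also have "(\<Sum>k\<le>card (-{j}). (w $ l) ^ (?n - 1 - k) * (-1) ^ k * esym_on (-{j}) k w) = (\<Prod>i\<in>-{j}. w $ l + (-1) * w $ i)"
          by (subst prod_add_eq_esym_on) (simp add: c)
        also have "\<dots> = (if l = j then \<Prod>k\<in>-{l}. w $ l - w $ k else 0)"
          by (auto intro!: prod_zero)
        finally show ?thesis .
      qed
      thus ?thesis by (simp add: vec_eq_iff)
    qed
  qed
qed

lemma real_jacobian_mat_1: "real_jacobian (mat 1 :: complex ^ 'n::finite ^ 'n) = 1"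
  by (rule real_jacobian_unit_triangular[where r = "\<lambda>_. 0"]) (auto simp: mat_def split: if_splits)

text \<open>The functionals |det| and \<open>real_jacobian\<close> are applied to the same two
  factorizations. The first gives |det D|^2 = P, the second gives \<open>real_jacobian D\<close>
  squared = P^2, where P is the product of all |w_i - w_k|.\<close>

lemma norm_vdm_sq:
  fixes \<iota> :: "'n::finite \<Rightarrow> nat"
  assumes \<iota>: "bij_betw \<iota> UNIV {1..CARD('n)}"
  shows "(norm (vdm \<iota> w))\<^sup>2 = (\<Prod>i\<in>UNIV. \<Prod>k\<in>-{i}. norm (w $ i - w $ k))" (is ?A)
    and "real_jacobian (sym_jac \<iota> w) = (norm (vdm \<iota> w))\<^sup>2" (is ?B)
proof -
  obtain T V R :: "complex ^ 'n ^ 'n" where 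
    T: "\<And>i. T $ i $ i = 1" "\<And>i j. T $ i $ j \<noteq> 0 \<Longrightarrow> i = j \<or> \<iota> j < \<iota> i" and
    R: "R ** R = mat 1" and D: "sym_jac \<iota> w = T ** transpose V"
    and VRD: "V ** R ** sym_jac \<iota> w = (\<chi> i j. if i = j then \<Prod>k\<in>-{i}. w $ i - w $ k else 0)"
    by (rule sym_jac_factor[OF \<iota>, where w = w]) (rule that)
  define P where "P = (\<Prod>i\<in>UNIV. \<Prod>k\<in>-{i}. norm (w $ i - w $ k))"
  have "det R * det R = 1" using R by (metis det_mul det_I)
  hence "norm (det R) * norm (det R) = 1" by (metis norm_mult norm_one)
  hence nR: "norm (det R) = 1" by (metis abs_norm_cancel abs_square_eq_1 power2_eq_square)
  have d1: "vdm \<iota> w = det V" unfolding vdm_def D by (simp add: det_mul det_transpose det_unit_triangular[OF T])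
  have "det V * det R * vdm \<iota> w = (\<Prod>i\<in>UNIV. \<Prod>k\<in>-{i}. w $ i - w $ k)"
    using arg_cong[OF VRD, of det] by (simp add: det_mul det_diagonal vdm_def)
  hence "norm (det V) * norm (det R) * norm (vdm \<iota> w) = P"
    by (metis (no_types, lifting) norm_mult prod_norm P_def prod.cong)
  thus A: ?A unfolding P_def[symmetric] by (simp add: nR d1 power2_eq_square)
  have "real_jacobian R * real_jacobian R = 1" using R real_jacobian_mat_1 by (metis real_jacobian_mult)
  hence rR: "real_jacobian R = 1" by (metis abs_ge_zero abs_of_nonneg abs_square_eq_1 power2_eq_square real_jacobian_def)
  have r1: "real_jacobian (sym_jac \<iota> w) = real_jacobian V" 
    unfolding D by (simp add: real_jacobian_mult real_jacobian_transpose real_jacobian_unit_triangular[OF T])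
  have "real_jacobian V * real_jacobian R * real_jacobian (sym_jac \<iota> w) = (\<Prod>i\<in>UNIV. (norm (\<Prod>k\<in>-{i}. w $ i - w $ k))\<^sup>2)"
    using arg_cong[OF VRD, of real_jacobian] by (simp add: real_jacobian_mult real_jacobian_diag)
  also have "\<dots> = P\<^sup>2" by (simp add: P_def prod_norm flip: prod_power_distrib)
  finally have "(real_jacobian (sym_jac \<iota> w))\<^sup>2 = P\<^sup>2" by (simp add: rR r1 power2_eq_square)
  hence "real_jacobian (sym_jac \<iota> w) = P"
    by (subst (asm) power2_eq_iff_nonneg) (auto simp: real_jacobian_def P_def intro!: prod_nonneg)
  thus ?B using A by (simp add: P_def)
qed

section \<open>The kernel in symmetric coordinates\<close>

text \<open>The polynomial Q(u), the product of the factors 1 - u w_l, written in the symmetric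
  coordinates s.\<close>

definition sym_den :: "('n::finite \<Rightarrow> nat) \<Rightarrow> complex ^ 'n \<Rightarrow> complex \<Rightarrow> complex" where
  "sym_den \<iota> s u = 1 + (\<Sum>j\<in>UNIV. (- u) ^ \<iota> j * s $ j)"

definition sym_den' :: "('n::finite \<Rightarrow> nat) \<Rightarrow> complex ^ 'n \<Rightarrow> complex \<Rightarrow> complex" where
  "sym_den' \<iota> s u = (\<Sum>j\<in>UNIV. - of_nat (\<iota> j) * (- u) ^ (\<iota> j - 1) * s $ j)"

text \<open>The derivative in u of u (-u)^(m-1) / Q(u), with m standing for \<iota> m. The
  denominator is a product of two inverses to match the closure rules for holomorphic dependence on
  s.\<close>

definition sym_coeff :: "('n::finite \<Rightarrow> nat) \<Rightarrow> 'n \<Rightarrow> complex ^ 'n \<Rightarrow> complex \<Rightarrow> complex" where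
  "sym_coeff \<iota> m s u = (of_nat (\<iota> m) * (- u) ^ (\<iota> m - 1) * sym_den \<iota> s u - u * (- u) ^ (\<iota> m - 1) * sym_den' \<iota> s u)
     * (inverse (sym_den \<iota> s u) * inverse (sym_den \<iota> s u))"

lemma sum_index_eq:
  assumes \<iota>: "bij_betw \<iota> UNIV {1..CARD('n)}"
  shows "(\<Sum>m\<in>(UNIV :: 'n::finite set). f (\<iota> m - 1)) = (\<Sum>k\<le>CARD('n) - 1. f k :: complex)"
    and "(\<Sum>m\<in>(UNIV :: 'n::finite set). f (\<iota> m)) = (\<Sum>k\<in>{1..CARD('n)}. f k :: complex)"
proof -
  show 2: "(\<Sum>m\<in>(UNIV :: 'n::finite set). f (\<iota> m)) = (\<Sum>k\<in>{1..CARD('n)}. f k :: complex)" for f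
    by (rule sum.reindex_bij_betw[OF \<iota>])
  have "(\<Sum>m\<in>(UNIV :: 'n set). f (\<iota> m - 1)) = (\<Sum>k\<in>{1..CARD('n)}. f (k - 1))"
    by (rule 2)
  also have "\<dots> = (\<Sum>k\<le>CARD('n) - 1. f k)"
  proof -
    obtain N where N: "CARD('n) = Suc N" by (cases "CARD('n)") auto
    show ?thesis unfolding N
      by (rule sum.reindex_bij_witness[of _ "\<lambda>k. k + 1" "\<lambda>k. k - 1"]) auto
  qed
  finally show "(\<Sum>m\<in>(UNIV :: 'n::finite set). f (\<iota> m - 1)) = (\<Sum>k\<le>CARD('n) - 1. f k :: complex)" .
qed

lemma sym_den_sym_map:
  fixes \<iota> :: "'n::finite \<Rightarrow> nat"
  assumes \<iota>: "bij_betw \<iota> UNIV {1..CARD('n)}"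
  shows "sym_den \<iota> (sym_map \<iota> w) u = (\<Prod>i\<in>UNIV. 1 - u * w $ i)"
proof -
  have "(\<Prod>i\<in>UNIV. 1 - u * w $ i) = (\<Prod>i\<in>UNIV. 1 + (- u) * w $ i)" by simp
  also have "\<dots> = (\<Sum>k\<le>CARD('n). 1 ^ (CARD('n) - k) * (- u) ^ k * esym_on UNIV k w)"
    by (rule prod_add_eq_esym_on)
  also have "\<dots> = (\<Sum>k\<le>CARD('n). (- u) ^ k * esym k w)"
    by (simp add: esym_eq_esym_on)
  also have "{..CARD('n)} = insert 0 {1..CARD('n)}" by auto
  also have "(\<Sum>k\<in>insert 0 {1..CARD('n)}. (- u) ^ k * esym k w) = 1 + (\<Sum>k\<in>{1..CARD('n)}. (- u) ^ k * esym k w)"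
    by (simp add: esym_eq_esym_on)
  also have "(\<Sum>k\<in>{1..CARD('n)}. (- u) ^ k * esym k w) = (\<Sum>j\<in>UNIV. (- u) ^ \<iota> j * esym (\<iota> j) w)"
    by (rule sum_index_eq(2)[OF \<iota>, symmetric])
  finally show ?thesis by (simp add: sym_den_def sym_map_def)
qed

text \<open>With \<open>Q(u) = \<Prod>l. 1 - u w\<^sub>l\<close> and \<open>E = Q / (1 - u w\<^sub>i)\<close>, the coefficients of \<open>E\<close> are the
  entries of the Jacobian matrix, and \<open>(1 - u w\<^sub>i)\<^sup>-\<^sup>2\<close> is the derivative of \<open>u E / Q\<close>.\<close>
lemma sum_sym_coeff:
  fixes \<iota> :: "'n::finite \<Rightarrow> nat"
  assumes \<iota>: "bij_betw \<iota> UNIV {1..CARD('n)}" and nz: "\<And>l. 1 - u * w $ l \<noteq> 0"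
  shows "(\<Sum>m\<in>UNIV. sym_coeff \<iota> m (sym_map \<iota> w) u * sym_jac \<iota> w $ m $ i) = 1 / (1 - u * w $ i)\<^sup>2"
proof -
  define n where "n = CARD('n)"
  define s where "s = sym_map \<iota> w"
  define D where "D = (\<lambda>k. esym_on (-{i}) k w)"
  define E where "E = (\<lambda>u. \<Sum>k\<le>n - 1. (- u) ^ k * D k)"
  define E1 where "E1 = (\<Sum>k\<le>n - 1. of_nat (k + 1) * (- u) ^ k * D k)"
  have c: "card (-{i}) = n - 1" by (simp add: Compl_eq_Diff_UNIV n_def)
  have Eprod: "E u = (\<Prod>l\<in>-{i}. 1 - u * w $ l)" for u
    using prod_add_eq_esym_on[of 1 "-u" w "-{i}"] by (simp add: E_def D_def c)
  have Q: "sym_den \<iota> s u = (1 - u * w $ i) * E u" for u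
  proof -
    have "UNIV = insert i (-{i})" by auto
    hence "(\<Prod>l\<in>UNIV. 1 - u * w $ l) = (\<Prod>l\<in>insert i (-{i}). 1 - u * w $ l)" by simp
    thus ?thesis unfolding s_def sym_den_sym_map[OF \<iota>] by (simp add: Eprod)
  qed
  define E' where "E' = (\<Sum>k\<le>n - 1. - of_nat k * (- u) ^ (k - 1) * D k)"
  have dE: "(E has_field_derivative E') (at u)"
    unfolding E_def E'_def by (auto intro!: derivative_eq_intros sum.cong)
  have dQ1: "(sym_den \<iota> s has_field_derivative sym_den' \<iota> s u) (at u)"
    unfolding sym_den_def[abs_def] sym_den'_def by (auto intro!: derivative_eq_intros sum.cong)
  have "((\<lambda>u. (1 - u * w $ i) * E u) has_field_derivative (- w $ i * E u + (1 - u * w $ i) * E')) (at u)"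
    by (auto intro!: derivative_eq_intros dE)
  hence dQ2: "(sym_den \<iota> s has_field_derivative (- w $ i * E u + (1 - u * w $ i) * E')) (at u)"
  proof -
    have "sym_den \<iota> s = (\<lambda>u. (1 - u * w $ i) * E u)" by (rule ext) (rule Q)
    thus ?thesis using \<open>((\<lambda>u. (1 - u * w $ i) * E u) has_field_derivative _) _\<close> by (simp only:)
  qed
  have Q': "sym_den' \<iota> s u = - w $ i * E u + (1 - u * w $ i) * E'"
    by (rule DERIV_unique[OF dQ1 dQ2])
  have E1: "E1 = E u + u * E'"
  proof -
    have "of_nat (k + 1) * (- u) ^ k * D k = (- u) ^ k * D k + u * (- of_nat k * (- u) ^ (k - 1) * D k)" for k
      by (cases k) (simp_all add: algebra_simps)
    thus ?thesis unfolding E1_def E_def E'_def by (simp only: sum.distrib sum_distrib_left)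
  qed
  have Qnz: "sym_den \<iota> s u \<noteq> 0" unfolding s_def sym_den_sym_map[OF \<iota>] using nz by simp
  hence Enz: "E u \<noteq> 0" using Q[of u] by auto
  define G where "G = (\<lambda>k. (of_nat (k + 1) * (- u) ^ k * sym_den \<iota> s u - u * (- u) ^ k * sym_den' \<iota> s u) * D k)"
  have rng: "\<iota> m \<ge> 1" for m using \<iota> by (auto simp: bij_betw_def)
  have "(\<Sum>m\<in>UNIV. sym_coeff \<iota> m s u * sym_jac \<iota> w $ m $ i) = (\<Sum>m\<in>UNIV. G (\<iota> m - 1)) * (inverse (sym_den \<iota> s u) * inverse (sym_den \<iota> s u))"
    unfolding sum_distrib_right using rng
    by (intro sum.cong refl) (simp add: sym_coeff_def G_def D_def sym_jac_def of_nat_diff)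
  also have "(\<Sum>m\<in>UNIV. G (\<iota> m - 1)) = (\<Sum>k\<le>n - 1. G k)" unfolding n_def by (rule sum_index_eq(1)[OF \<iota>])
  also have "\<dots> = E1 * sym_den \<iota> s u - u * E u * sym_den' \<iota> s u"
    unfolding G_def E1_def E_def by (simp add: algebra_simps sum_subtractf sum.distrib sum_distrib_left sum_distrib_right)
  \<comment> \<open>With Q = (1 - u w_i) E the terms containing E' cancel, and what remains is E^2
    times (1 - u w_i) + u w_i = 1.\<close>
  also have "\<dots> = (E u)\<^sup>2" unfolding Q' Q E1 by (simp add: power2_eq_square algebra_simps)
  also have "(E u)\<^sup>2 * (inverse (sym_den \<iota> s u) * inverse (sym_den \<iota> s u)) = 1 / (1 - u * w $ i)\<^sup>2"
    unfolding Q using Enz nz[of i] by (simp add: power2_eq_square divide_simps)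
  finally show ?thesis by (simp add: s_def)
qed

definition sym_kernel :: "('n::finite \<Rightarrow> nat) \<Rightarrow> complex ^ 'n \<Rightarrow> complex ^ 'n \<Rightarrow> complex" where
  "sym_kernel \<iota> s w = det (\<chi> m j. sym_coeff \<iota> m s (cnj (w $ j)))"

text \<open>\<open>sum_sym_coeff\<close> says that the kernel matrix is the transposed Jacobian
  matrix at z times a matrix depending on z through its symmetric coordinates only. Taking
  determinants splits off \<open>vdm \<iota> z\<close> without a division, so the identity also
  holds where it vanishes.\<close>

lemma det_kernel_eq:
  fixes \<iota> :: "'n::finite \<Rightarrow> nat"
  assumes \<iota>: "bij_betw \<iota> UNIV {1..CARD('n)}" and z: "z \<in> polydisc" and w: "w \<in> polydisc"
  shows "det (\<chi> i j. 1 / (1 - z $ i * cnj (w $ j))\<^sup>2) = vdm \<iota> z * sym_kernel \<iota> (sym_map \<iota> z) w"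
proof -
  have nz: "1 - cnj (w $ j) * z $ l \<noteq> 0" for j l
    using norm_one_minus_cnj_ge(4)[of "z $ l" "w $ j"] z w by (auto simp: polydisc_iff mult.commute)
  have "(\<chi> i j. 1 / (1 - z $ i * cnj (w $ j))\<^sup>2) = transpose (sym_jac \<iota> z) ** (\<chi> m j. sym_coeff \<iota> m (sym_map \<iota> z) (cnj (w $ j)))"
    using sum_sym_coeff[OF \<iota> nz]
    by (simp add: vec_eq_iff matrix_matrix_mult_def transpose_def mult.commute[of "_ $ _ $ _"] mult.commute[of "z $ _"])
  thus ?thesis by (simp add: det_mul det_transpose vdm_def sym_kernel_def)
qed

section \<open>Holomorphic dependence on a parameter, uniformly over a measure space\<close>

text \<open>\<open>L w\<close> lists the complex partial derivatives in the parameter at s0. One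
  constant B bounds values, partial derivatives, Lipschitz quotients and quadratic remainders. The
  radius is at most 1 so that squares of |s - s0| can be absorbed into |s - s0|.\<close>

definition unif_holo_with :: "'w measure \<Rightarrow> (complex ^ 'n::finite \<Rightarrow> 'w \<Rightarrow> complex) \<Rightarrow> complex ^ 'n \<Rightarrow>
    ('w \<Rightarrow> complex ^ 'n) \<Rightarrow> real \<Rightarrow> real \<Rightarrow> bool" where
  "unif_holo_with M F s0 L B d \<longleftrightarrow> d > 0 \<and> d \<le> 1 \<and> B \<ge> 0 \<and> (\<forall>s. norm (s - s0) < d \<longrightarrow> F s \<in> borel_measurable M) \<and>
     (\<forall>j. (\<lambda>w. L w $ j) \<in> borel_measurable M) \<and> (\<forall>w\<in>space M. \<forall>j. norm (L w $ j) \<le> B) \<and>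
     (\<forall>s. norm (s - s0) < d \<longrightarrow> (\<forall>w\<in>space M. norm (F s w) \<le> B \<and> norm (F s w - F s0 w) \<le> B * norm (s - s0) \<and>
        norm (F s w - F s0 w - (\<Sum>j\<in>UNIV. L w $ j * (s - s0) $ j)) \<le> B * (norm (s - s0))\<^sup>2))"

text \<open>A remainder that is quadratic, rather than merely small, uniformly in the parameter keeps the
  class stable under products and inverses without any choice of \<open>\<epsilon>\<close>.\<close>
definition unif_holo_at :: "'w measure \<Rightarrow> (complex ^ 'n::finite \<Rightarrow> 'w \<Rightarrow> complex) \<Rightarrow> complex ^ 'n \<Rightarrow> bool" where
  "unif_holo_at M F s0 \<longleftrightarrow> (\<exists>L B d. unif_holo_with M F s0 L B d)"

lemma unif_holo_withD:
  assumes "unif_holo_with M F s0 L B d"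
  shows "d > 0" "d \<le> 1" "B \<ge> 0" "\<And>s. norm (s - s0) < d \<Longrightarrow> F s \<in> borel_measurable M"
    "\<And>j. (\<lambda>w. L w $ j) \<in> borel_measurable M" "\<And>w j. w \<in> space M \<Longrightarrow> norm (L w $ j) \<le> B"
    "\<And>s w. norm (s - s0) < d \<Longrightarrow> w \<in> space M \<Longrightarrow> norm (F s w) \<le> B"
    "\<And>s w. norm (s - s0) < d \<Longrightarrow> w \<in> space M \<Longrightarrow> norm (F s w - F s0 w) \<le> B * norm (s - s0)"
    "\<And>s w. norm (s - s0) < d \<Longrightarrow> w \<in> space M \<Longrightarrow> 
       norm (F s w - F s0 w - (\<Sum>j\<in>UNIV. L w $ j * (s - s0) $ j)) \<le> B * (norm (s - s0))\<^sup>2"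
  using assms by (simp_all add: unif_holo_with_def)

lemma unif_holo_atI:
  fixes F :: "complex ^ 'n::finite \<Rightarrow> 'w \<Rightarrow> complex"
  assumes "d > 0" "\<And>s. norm (s - s0) < d \<Longrightarrow> F s \<in> borel_measurable M"
    "\<And>j. (\<lambda>w. L w $ j) \<in> borel_measurable M" "\<And>w j. w \<in> space M \<Longrightarrow> norm (L w $ j) \<le> B1"
    "\<And>s w. norm (s - s0) < d \<Longrightarrow> w \<in> space M \<Longrightarrow> norm (F s w) \<le> B2"
    "\<And>s w. norm (s - s0) < d \<Longrightarrow> w \<in> space M \<Longrightarrow> norm (F s w - F s0 w) \<le> B3 * norm (s - s0)"
    "\<And>s w. norm (s - s0) < d \<Longrightarrow> w \<in> space M \<Longrightarrow> 
       norm (F s w - F s0 w - (\<Sum>j\<in>UNIV. L w $ j * (s - s0) $ j)) \<le> B4 * (norm (s - s0))\<^sup>2"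
  shows "unif_holo_at M F s0"
proof -
  define B where "B = \<bar>B1\<bar> + \<bar>B2\<bar> + \<bar>B3\<bar> + \<bar>B4\<bar>"
  have B: "B \<ge> 0" "B1 \<le> B" "B2 \<le> B" "B3 \<le> B" "B4 \<le> B" by (auto simp: B_def)
  have le: "a * norm x \<le> B * norm x" "a * (norm x)\<^sup>2 \<le> B * (norm x)\<^sup>2" if "a \<le> B" for a and x :: "complex ^ 'n"
    using that by (auto intro!: mult_right_mono)
  have b1: "norm (L w $ j) \<le> B" if "w \<in> space M" for w j
    using assms(4)[OF that] B(2) by (rule order_trans)
  have b2: "norm (F s w) \<le> B" if "norm (s - s0) < d" "w \<in> space M" for s w
    using assms(5)[OF that] B(3) by (rule order_trans)
  have b3: "norm (F s w - F s0 w) \<le> B * norm (s - s0)" if "norm (s - s0) < d" "w \<in> space M" for s w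
    using assms(6)[OF that] le(1)[OF B(4)] by (rule order_trans)
  have b4: "norm (F s w - F s0 w - (\<Sum>j\<in>UNIV. L w $ j * (s - s0) $ j)) \<le> B * (norm (s - s0))\<^sup>2"
    if "norm (s - s0) < d" "w \<in> space M" for s w
    using assms(7)[OF that] le(2)[OF B(5)] by (rule order_trans)
  show ?thesis unfolding unif_holo_at_def unif_holo_with_def
    by (rule exI[of _ L], rule exI[of _ B], rule exI[of _ "min d 1"])
      (use assms(1-3) B(1) b1 b2 b3 b4 in \<open>auto simp del: vector_minus_component\<close>)
qed

lemma unif_holo_at_weight:
  assumes "a \<in> borel_measurable M" "\<And>w. w \<in> space M \<Longrightarrow> norm (a w) \<le> B"
  shows "unif_holo_at M (\<lambda>s. a) s0"
  by (rule unif_holo_atI[where L = "\<lambda>w. 0" and d = 1 and ?B1.0 = 0 and ?B2.0 = B and ?B3.0 = 0 and ?B4.0 = 0])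
     (use assms in auto)

lemma unif_holo_at_coord: "unif_holo_at M (\<lambda>s w. s $ j) (s0 :: complex ^ 'n::finite)"
proof (rule unif_holo_atI[where L = "\<lambda>w. axis j 1" and d = 1 and ?B1.0 = 1 and ?B2.0 = "norm s0 + 1" and ?B3.0 = 1 and ?B4.0 = 0])
  fix s :: "complex ^ 'n" assume s: "norm (s - s0) < 1"
  have n: "norm s \<le> norm s0 + norm (s - s0)" using norm_triangle_ineq[of s0 "s - s0"] by simp
  show "norm (s $ j) \<le> norm s0 + 1" using Finite_Cartesian_Product.norm_nth_le[of s j] n s by linarith
  show "norm (s $ j - s0 $ j) \<le> 1 * norm (s - s0)" using Finite_Cartesian_Product.norm_nth_le[of "s - s0" j] by simp
  show "norm (s $ j - s0 $ j - (\<Sum>k\<in>UNIV. axis j 1 $ k * (s - s0) $ k)) \<le> 0 * (norm (s - s0))\<^sup>2"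
    by (simp add: axis_def if_distrib[of "\<lambda>t. t * _"] cong: if_cong)
qed (auto simp: axis_def)

lemma unif_holo_at_add:
  assumes "unif_holo_at M F s0" "unif_holo_at M G s0"
  shows "unif_holo_at M (\<lambda>s w. F s w + G s w) s0"
proof -
  from assms(1) obtain L B d where "unif_holo_with M F s0 L B d" by (auto simp: unif_holo_at_def)
  note F = unif_holo_withD[OF this]
  from assms(2) obtain L' B' d' where "unif_holo_with M G s0 L' B' d'" by (auto simp: unif_holo_at_def)
  note G = unif_holo_withD[OF this]
  show ?thesis
  proof (rule unif_holo_atI[where L = "\<lambda>w. L w + L' w" and d = "min d d'" and ?B1.0 = "B + B'" and ?B2.0 = "B + B'" 
       and ?B3.0 = "B + B'" and ?B4.0 = "B + B'"])
    show "min d d' > 0" using F G by simp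
    fix s assume "norm (s - s0) < min d d'"
    hence s: "norm (s - s0) < d" "norm (s - s0) < d'" by auto
    show "(\<lambda>w. F s w + G s w) \<in> borel_measurable M" using F(4)[OF s(1)] G(4)[OF s(2)] by measurable
    fix w assume w: "w \<in> space M"
    show "norm (F s w + G s w) \<le> B + B'"
      using F(7)[OF s(1) w] G(7)[OF s(2) w] by (intro norm_triangle_le) simp
    have "F s w + G s w - (F s0 w + G s0 w) = (F s w - F s0 w) + (G s w - G s0 w)" by simp
    also have "norm \<dots> \<le> B * norm (s - s0) + B' * norm (s - s0)"
      by (rule norm_triangle_mono[OF F(8)[OF s(1) w] G(8)[OF s(2) w]])
    finally show "norm (F s w + G s w - (F s0 w + G s0 w)) \<le> (B + B') * norm (s - s0)" by (simp add: algebra_simps)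
    have "F s w + G s w - (F s0 w + G s0 w) - (\<Sum>j\<in>UNIV. (L w + L' w) $ j * (s - s0) $ j) = 
       (F s w - F s0 w - (\<Sum>j\<in>UNIV. L w $ j * (s - s0) $ j)) + (G s w - G s0 w - (\<Sum>j\<in>UNIV. L' w $ j * (s - s0) $ j))"
      by (simp add: distrib_right sum.distrib)
    also have "norm \<dots> \<le> B * (norm (s - s0))\<^sup>2 + B' * (norm (s - s0))\<^sup>2"
      by (rule norm_triangle_mono[OF F(9)[OF s(1) w] G(9)[OF s(2) w]])
    finally show "norm (F s w + G s w - (F s0 w + G s0 w) - (\<Sum>j\<in>UNIV. (L w + L' w) $ j * (s - s0) $ j)) \<le> (B + B') * (norm (s - s0))\<^sup>2" 
      by (simp add: algebra_simps)
  next
    show "(\<lambda>w. (L w + L' w) $ j) \<in> borel_measurable M" for j using F(5)[of j] G(5)[of j] by simp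
    show "norm ((L w + L' w) $ j) \<le> B + B'" if "w \<in> space M" for w j
      using F(6)[OF that, of j] G(6)[OF that, of j] by (auto intro: norm_triangle_le)
  qed
qed

lemma unif_holo_at_mult:
  assumes "unif_holo_at M F s0" "unif_holo_at M G s0"
  shows "unif_holo_at M (\<lambda>s w. F s w * G s w) s0"
proof -
  from assms(1) obtain L B d where "unif_holo_with M F s0 L B d" by (auto simp: unif_holo_at_def)
  note F = unif_holo_withD[OF this]
  from assms(2) obtain L' B' d' where "unif_holo_with M G s0 L' B' d'" by (auto simp: unif_holo_at_def)
  note G = unif_holo_withD[OF this]
  let ?L = "\<lambda>w. \<chi> j. F s0 w * L' w $ j + G s0 w * L w $ j"
  have F0: "norm (F s0 w) \<le> B" "norm (G s0 w) \<le> B'" if "w \<in> space M" for w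
    using F(7)[of s0 w] G(7)[of s0 w] F(1) G(1) that by auto
  show ?thesis
  proof (rule unif_holo_atI[where L = ?L and d = "min d d'" and ?B1.0 = "2 * B * B'" and ?B2.0 = "B * B'" 
       and ?B3.0 = "2 * B * B'" and ?B4.0 = "3 * B * B'"])
    show "min d d' > 0" using F G by simp
    fix s assume "norm (s - s0) < min d d'"
    hence s: "norm (s - s0) < d" "norm (s - s0) < d'" by auto
    show "(\<lambda>w. F s w * G s w) \<in> borel_measurable M" using F(4)[OF s(1)] G(4)[OF s(2)] by measurable
    fix w assume w: "w \<in> space M"
    let ?h = "norm (s - s0)"
    define f g f0 g0 where "f = F s w" and "g = G s w" and "f0 = F s0 w" and "g0 = G s0 w"
    define l l' where "l = (\<Sum>j\<in>UNIV. L w $ j * (s - s0) $ j)" and "l' = (\<Sum>j\<in>UNIV. L' w $ j * (s - s0) $ j)"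
    have nf: "norm f \<le> B" "norm f0 \<le> B" "norm (f - f0) \<le> B * ?h" "norm (f - f0 - l) \<le> B * ?h\<^sup>2"
      using F(7)[OF s(1) w] F(8)[OF s(1) w] F(9)[OF s(1) w] F0[OF w] by (auto simp: f_def f0_def l_def)
    have ng: "norm g \<le> B'" "norm g0 \<le> B'" "norm (g - g0) \<le> B' * ?h" "norm (g - g0 - l') \<le> B' * ?h\<^sup>2"
      using G(7)[OF s(2) w] G(8)[OF s(2) w] G(9)[OF s(2) w] F0[OF w] by (auto simp: g_def g0_def l'_def)
    show "norm (F s w * G s w) \<le> B * B'"
      unfolding norm_mult f_def[symmetric] g_def[symmetric] using nf ng F(3) by (intro mult_mono) auto
    have "f * g - f0 * g0 = (f - f0) * g + f0 * (g - g0)" by (simp add: algebra_simps)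
    also have "norm \<dots> \<le> (B * ?h) * B' + B * (B' * ?h)"
      using nf ng F(3) G(3) by (intro norm_triangle_mono) (auto simp: norm_mult intro!: mult_mono)
    finally show "norm (F s w * G s w - F s0 w * G s0 w) \<le> 2 * B * B' * ?h"
      by (simp add: f_def g_def f0_def g0_def algebra_simps)
    have "(\<Sum>j\<in>UNIV. ?L w $ j * (s - s0) $ j) = f0 * l' + g0 * l"
      by (simp add: l_def l'_def f0_def g0_def sum_distrib_left distrib_right sum.distrib mult.assoc)
    \<comment> \<open>Each summand is quadratic in |s - s0|: the first as a product of two Lipschitz
      increments, the others as a bounded factor times a remainder.\<close>
    hence "f * g - f0 * g0 - (\<Sum>j\<in>UNIV. ?L w $ j * (s - s0) $ j) = (f - f0) * (g - g0) + (f0 * (g - g0 - l') + g0 * (f - f0 - l))"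
      by (simp add: algebra_simps)
    also have "norm \<dots> \<le> (B * ?h) * (B' * ?h) + (B * (B' * ?h\<^sup>2) + B' * (B * ?h\<^sup>2))"
      using nf ng F(3) G(3) by (intro norm_triangle_mono) (auto simp: norm_mult intro!: mult_mono)
    finally show "norm (F s w * G s w - F s0 w * G s0 w - (\<Sum>j\<in>UNIV. ?L w $ j * (s - s0) $ j)) \<le> 3 * B * B' * ?h\<^sup>2"
      by (simp add: f_def g_def f0_def g0_def algebra_simps power2_eq_square)
  next
    have m: "F s0 \<in> borel_measurable M" "G s0 \<in> borel_measurable M" using F(4)[of s0] G(4)[of s0] F(1) G(1) by auto
    show "(\<lambda>w. ?L w $ j) \<in> borel_measurable M" for j using F(5)[of j] G(5)[of j] m by simp
    show "norm (?L w $ j) \<le> 2 * B * B'" if "w \<in> space M" for w j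
    proof -
      have "norm (F s0 w * L' w $ j + G s0 w * L w $ j) \<le> B * B' + B' * B"
        using F(6)[OF that, of j] G(6)[OF that, of j] F0[OF that] F(3) G(3)
        by (intro norm_triangle_mono) (auto simp: norm_mult intro!: mult_mono)
      thus ?thesis by (simp add: mult.commute)
    qed
  qed
qed

lemma unif_holo_at_inverse:
  assumes "unif_holo_at M F s0" and c: "c > 0" "r > 0" "\<And>s w. norm (s - s0) < r \<Longrightarrow> w \<in> space M \<Longrightarrow> c \<le> norm (F s w)"
  shows "unif_holo_at M (\<lambda>s w. inverse (F s w)) s0"
proof -
  from assms(1) obtain L B d where "unif_holo_with M F s0 L B d" by (auto simp: unif_holo_at_def)
  note F = unif_holo_withD[OF this]
  let ?L = "\<lambda>w. \<chi> j. - (inverse (F s0 w) * inverse (F s0 w) * L w $ j)"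
  have inv: "norm (inverse x) \<le> 1 / c" if "c \<le> norm x" for x :: complex
    using le_imp_inverse_le[OF that c(1)] by (simp add: norm_inverse divide_inverse)
  show ?thesis
  proof (rule unif_holo_atI[where L = ?L and d = "min d r" and ?B1.0 = "1 / c * (1 / c) * B" and ?B2.0 = "1 / c" 
       and ?B3.0 = "1 / c * (1 / c) * B" and ?B4.0 = "1 / c * (1 / c) * (1 / c) * (B * B + (B * B + B * B))"])
    show "min d r > 0" using F c by simp
    fix s assume "norm (s - s0) < min d r"
    hence s: "norm (s - s0) < d" "norm (s - s0) < r" by auto
    show "(\<lambda>w. inverse (F s w)) \<in> borel_measurable M" using F(4)[OF s(1)] by measurable
    fix w assume w: "w \<in> space M"
    let ?h = "norm (s - s0)"
    define f f0 l where "f = F s w" and "f0 = F s0 w" and "l = (\<Sum>j\<in>UNIV. L w $ j * (s - s0) $ j)"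
    have nf: "norm f \<le> B" "norm f0 \<le> B" "norm (f - f0) \<le> B * ?h" "norm (f - f0 - l) \<le> B * ?h\<^sup>2"
      using F(7)[OF s(1) w] F(8)[OF s(1) w] F(9)[OF s(1) w] F(7)[of s0, OF _ w] F(1) by (auto simp: f_def f0_def l_def)
    have cf: "c \<le> norm f" "c \<le> norm f0" using c(2) c(3)[OF s(2) w] c(3)[of s0 w] w by (auto simp: f_def f0_def)
    hence nz: "f \<noteq> 0" "f0 \<noteq> 0" using c(1) by auto
    note ni = inv[OF cf(1)] inv[OF cf(2)]
    have c0: "1 / c \<ge> 0" using c by simp
    show "norm (inverse (F s w)) \<le> 1 / c" using ni by (simp add: f_def)
    have "inverse f - inverse f0 = - (inverse f * inverse f0 * (f - f0))" using nz by (simp add: field_simps)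
    also have "norm \<dots> \<le> 1 / c * (1 / c) * (B * ?h)"
      unfolding norm_minus_cancel norm_mult using ni nf c0 by (intro mult_mono) auto
    finally show "norm (inverse (F s w) - inverse (F s0 w)) \<le> 1 / c * (1 / c) * B * ?h"
      by (simp add: f_def f0_def)
    have L: "(\<Sum>j\<in>UNIV. ?L w $ j * (s - s0) $ j) = - (inverse f0 * inverse f0 * l)"
      by (simp add: l_def f0_def sum_distrib_left sum_negf mult.assoc)
    \<comment> \<open>The linear part is estimated as increment minus remainder, which keeps the
      dimension out of the constant.\<close>
    have "norm l \<le> B * ?h + B * ?h\<^sup>2"
    proof -
      have "l = (f - f0) - (f - f0 - l)" by simp
      also have "norm \<dots> \<le> norm (f - f0) + norm (f - f0 - l)" by (rule norm_triangle_ineq4)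
      finally show ?thesis using nf by linarith
    qed
    also have "B * ?h\<^sup>2 \<le> B * ?h"
    proof (intro mult_left_mono F(3))
      have "?h * ?h \<le> ?h * 1" using s(1) F(2) by (intro mult_left_mono) auto
      thus "?h\<^sup>2 \<le> ?h" by (simp add: power2_eq_square)
    qed
    finally have nl: "norm l \<le> 2 * (B * ?h)" by simp
    \<comment> \<open>Over the common denominator f f0^2 the numerator is l (f - f0) - f0 (f - f0 -
      l), where both terms are visibly quadratic.\<close>
    have "inverse f - inverse f0 - (\<Sum>j\<in>UNIV. ?L w $ j * (s - s0) $ j) = 
       inverse f * inverse f0 * inverse f0 * (l * (f - f0) + (- ((f - f0 - l) * f0)))"
      unfolding L using nz by (simp add: field_simps)
    also have "norm \<dots> \<le> 1 / c * (1 / c) * (1 / c) * ((2 * (B * ?h)) * (B * ?h) + (B * ?h\<^sup>2) * B)"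
    proof -
      have "norm (l * (f - f0) + (- ((f - f0 - l) * f0))) \<le> (2 * (B * ?h)) * (B * ?h) + (B * ?h\<^sup>2) * B"
        using nf nl F(3) by (intro norm_triangle_mono) (auto simp: norm_mult intro!: mult_mono)
      thus ?thesis unfolding norm_mult using ni c0 by (intro mult_mono) auto
    qed
    finally show "norm (inverse (F s w) - inverse (F s0 w) - (\<Sum>j\<in>UNIV. ?L w $ j * (s - s0) $ j)) 
       \<le> 1 / c * (1 / c) * (1 / c) * (B * B + (B * B + B * B)) * ?h\<^sup>2"
      by (simp add: f_def f0_def algebra_simps power2_eq_square add_divide_distrib)
  next
    have m: "F s0 \<in> borel_measurable M" using F(4)[of s0] F(1) by auto
    show "(\<lambda>w. ?L w $ j) \<in> borel_measurable M" for j using F(5)[of j] m by simp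
    show "norm (?L w $ j) \<le> 1 / c * (1 / c) * B" if w: "w \<in> space M" for w j
    proof -
      have "c \<le> norm (F s0 w)" using c(2) c(3)[of s0 w] w by auto
      from inv[OF this] show ?thesis
        using F(6)[OF w, of j] c by (simp only: vec_lambda_beta norm_minus_cancel norm_mult) (intro mult_mono, auto)
    qed
  qed
qed

lemma unif_holo_at_sum:
  assumes "finite A" "\<And>a. a \<in> A \<Longrightarrow> unif_holo_at M (F a) s0"
  shows "unif_holo_at M (\<lambda>s w. \<Sum>a\<in>A. F a s w) s0"
  using assms
proof (induction A rule: finite_induct)
  case empty
  show ?case by (simp add: unif_holo_at_weight[where B = 0])
qed (auto intro!: unif_holo_at_add)

lemma unif_holo_at_prod:
  assumes "finite A" "\<And>a. a \<in> A \<Longrightarrow> unif_holo_at M (F a) s0"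
  shows "unif_holo_at M (\<lambda>s w. \<Prod>a\<in>A. F a s w) s0"
  using assms
proof (induction A rule: finite_induct)
  case empty
  show ?case by (simp add: unif_holo_at_weight[where B = 1])
qed (auto intro!: unif_holo_at_mult)

text \<open>Integrating the uniform quadratic remainder against |f| bounds the error of the linear
  approximation by a multiple of |s - s0|^2. The derivative is a complex linear combination of
  coordinates.\<close>

lemma holo_parametric_integral:
  fixes F :: "complex ^ 'n::finite \<Rightarrow> 'w \<Rightarrow> complex"
  assumes F: "unif_holo_at M F s0" and f: "integrable M f"
  shows "\<exists>g'. ((\<lambda>s. \<integral>w. F s w * f w \<partial>M) has_derivative g') (at s0) \<and> (\<forall>c v. g' (c *s v) = c * g' v)"
proof -
  from F obtain L B d where "unif_holo_with M F s0 L B d" by (auto simp: unif_holo_at_def)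
  note F = unif_holo_withD[OF this]
  have fm[measurable]: "f \<in> borel_measurable M" using f by auto
  have bd: "integrable M (\<lambda>w. a w * f w)" if "a \<in> borel_measurable M" "\<And>w. w \<in> space M \<Longrightarrow> norm (a w) \<le> B" for a
  proof (rule Bochner_Integration.integrable_bound[of M "\<lambda>w. B * norm (f w)"])
    show "integrable M (\<lambda>w. B * norm (f w))" using f by auto
    show "(\<lambda>w. a w * f w) \<in> borel_measurable M" using that by measurable
    show "AE w in M. norm (a w * f w) \<le> norm (B * norm (f w))"
      using that F(3) by (intro AE_I2) (auto simp: norm_mult intro!: mult_right_mono)
  qed
  define l where "l = (\<lambda>j. \<integral>w. L w $ j * f w \<partial>M)"
  define g where "g = (\<lambda>s. \<integral>w. F s w * f w \<partial>M)"
  define g' where "g' = (\<lambda>v. \<Sum>j\<in>UNIV. l j * v $ j)"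
  define K where "K = B * (\<integral>w. norm (f w) \<partial>M)"
  have iL: "integrable M (\<lambda>w. L w $ j * f w)" for j by (intro bd F)
  have K: "norm (g s - g s0 - g' (s - s0)) \<le> K * (norm (s - s0))\<^sup>2" if s: "norm (s - s0) < d" for s
  proof -
    have i: "integrable M (\<lambda>w. F s w * f w)" "integrable M (\<lambda>w. F s0 w * f w)"
      using s F(1) by (auto intro!: bd F)
    have "g' (s - s0) = (\<integral>w. (\<Sum>j\<in>UNIV. L w $ j * f w * (s - s0) $ j) \<partial>M)"
      unfolding g'_def l_def by (subst Bochner_Integration.integral_sum) (auto intro: iL)
    hence "g s - g s0 - g' (s - s0) = (\<integral>w. F s w * f w - F s0 w * f w - (\<Sum>j\<in>UNIV. L w $ j * f w * (s - s0) $ j) \<partial>M)"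
      unfolding g_def using i iL by simp
    also have "norm \<dots> \<le> (\<integral>w. norm (F s w * f w - F s0 w * f w - (\<Sum>j\<in>UNIV. L w $ j * f w * (s - s0) $ j)) \<partial>M)"
      by (rule integral_norm_bound)
    also have "\<dots> \<le> (\<integral>w. B * (norm (s - s0))\<^sup>2 * norm (f w) \<partial>M)"
    proof (rule integral_mono)
      fix w assume w: "w \<in> space M"
      have "F s w * f w - F s0 w * f w - (\<Sum>j\<in>UNIV. L w $ j * f w * (s - s0) $ j) = 
        (F s w - F s0 w - (\<Sum>j\<in>UNIV. L w $ j * (s - s0) $ j)) * f w"
        by (simp add: algebra_simps sum_distrib_left sum_distrib_right)
      thus "norm (F s w * f w - F s0 w * f w - (\<Sum>j\<in>UNIV. L w $ j * f w * (s - s0) $ j)) \<le> B * (norm (s - s0))\<^sup>2 * norm (f w)"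
        using F(9)[OF s w] by (simp add: norm_mult mult_right_mono)
    qed (use i iL f in auto)
    also have "\<dots> = K * (norm (s - s0))\<^sup>2" by (simp add: K_def)
    finally show ?thesis .
  qed
  have bl: "bounded_linear g'"
    unfolding g'_def by (intro linear_conv_bounded_linear[THEN iffD1] linearI) 
      (simp_all add: algebra_simps sum.distrib scaleR_sum_right)
  have "K \<ge> 0" unfolding K_def using F(3) by simp
  have "(g has_derivative g') (at s0)"
  proof (rule has_derivativeI[OF bl], rule Lim_null_comparison[where g = "\<lambda>s. K * norm (s - s0)"])
    show "\<forall>\<^sub>F s in at s0. norm ((g s - g s0 - g' (s - s0)) /\<^sub>R norm (s - s0)) \<le> K * norm (s - s0)"
      unfolding eventually_at
    proof (intro exI[of _ d] conjI ballI impI F(1))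
      fix s assume s: "s \<noteq> s0 \<and> dist s s0 < d"
      hence "norm (g s - g s0 - g' (s - s0)) \<le> K * (norm (s - s0))\<^sup>2" by (intro K) (simp add: dist_norm)
      thus "norm ((g s - g s0 - g' (s - s0)) /\<^sub>R norm (s - s0)) \<le> K * norm (s - s0)"
        using s by (simp add: divide_simps power2_eq_square mult.assoc)
    qed
    show "((\<lambda>s. K * norm (s - s0)) \<longlongrightarrow> 0) (at s0)"
      by (rule tendsto_eq_intros | simp)+
  qed
  moreover have "g' (c *s v) = c * g' v" for c v
    by (simp add: g'_def sum_distrib_left mult_ac)
  ultimately show ?thesis unfolding g_def by blast
qed

section \<open>Schur's test\<close>

text \<open>Young's inequality \<open>c\<^sup>p\<^sup>-\<^sup>1 x \<le> x\<^sup>p / p + (1 - 1/p) c\<^sup>p\<close> with \<open>c = t / A\<close>.\<close>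
lemma nn_integral_Jensen_powr:
  fixes p A t :: real and k f a :: "'a \<Rightarrow> real"
  assumes p: "p > 1" and A: "A > 0" and t: "t \<ge> 0"
    and [measurable]: "k \<in> borel_measurable M" "f \<in> borel_measurable M" "a \<in> borel_measurable M"
    and k: "\<And>x. x \<in> space M \<Longrightarrow> k x \<ge> 0" and f: "\<And>x. x \<in> space M \<Longrightarrow> f x \<ge> 0" and a: "AE x in M. a x > 0"
    and kA: "(\<integral>\<^sup>+x. ennreal (k x * a x) \<partial>M) \<le> ennreal A"
    and tk: "ennreal t \<le> (\<integral>\<^sup>+x. ennreal (k x * f x) \<partial>M)"
  shows "ennreal (t powr p) \<le> ennreal (A powr (p - 1)) * (\<integral>\<^sup>+x. ennreal (k x * (f x powr p * a x powr (1 - p))) \<partial>M)"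
\<comment> \<open>Both cases are trivial, the second because A > 0. Outside them c = t / A is
  positive and the right-hand integral is a real number.\<close>
proof (cases "t = 0 \<or> (\<integral>\<^sup>+x. ennreal (k x * (f x powr p * a x powr (1 - p))) \<partial>M) = \<infinity>")
  case True
  thus ?thesis using A by (auto simp: ennreal_mult_top)
next
  case False
  define c where "c = t / A"
  have t: "t > 0" using False t by simp
  have c: "c > 0" using t A by (simp add: c_def)
  define I where "I = (\<integral>\<^sup>+x. ennreal (k x * (f x powr p * a x powr (1 - p))) \<partial>M)"
  obtain b where b: "I = ennreal b" "b \<ge> 0" using False by (cases I) (auto simp: I_def)
  have young: "c powr (p - 1) * x \<le> x powr p / p + (1 - 1 / p) * c powr p" if "x \<ge> 0" for x
  proof -
    have q: "p / (p - 1) > 1" using p by (simp add: divide_simps)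
    have "x * c powr (p - 1) \<le> x powr p / p + (c powr (p - 1)) powr (p / (p - 1)) / (p / (p - 1))"
      using p q that by (intro Youngs_inequality) (auto simp: divide_simps)
    also have "(c powr (p - 1)) powr (p / (p - 1)) = c powr p" using p by (simp add: powr_powr)
    also have "c powr p / (p / (p - 1)) = (1 - 1 / p) * c powr p" using p by (simp add: divide_simps)
    finally show ?thesis by (simp add: mult.commute)
  qed
  have "ennreal (c powr (p - 1) * t) = ennreal (c powr (p - 1)) * ennreal t" using t by (simp add: ennreal_mult)
  also have "\<dots> \<le> ennreal (c powr (p - 1)) * (\<integral>\<^sup>+x. ennreal (k x * f x) \<partial>M)"
    using tk by (intro mult_left_mono) auto
  also have "\<dots> = (\<integral>\<^sup>+x. ennreal (c powr (p - 1)) * ennreal (k x * f x) \<partial>M)"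
    by (rule nn_integral_cmult[symmetric]) measurable
  also have "\<dots> \<le> (\<integral>\<^sup>+x. ennreal (1 / p) * ennreal (k x * (f x powr p * a x powr (1 - p))) + ennreal ((1 - 1 / p) * c powr p) * ennreal (k x * a x) \<partial>M)"
  proof (rule nn_integral_mono_AE)
    show "AE x in M. ennreal (c powr (p - 1)) * ennreal (k x * f x) \<le> ennreal (1 / p) * ennreal (k x * (f x powr p * a x powr (1 - p))) + ennreal ((1 - 1 / p) * c powr p) * ennreal (k x * a x)"
      using a AE_space
    proof eventually_elim
      case (elim x)
      hence ax: "a x > 0" and x: "x \<in> space M" by auto
      have "c powr (p - 1) * (k x * f x) = (k x * a x) * (c powr (p - 1) * (f x / a x))" using ax by simp
      also have "\<dots> \<le> (k x * a x) * ((f x / a x) powr p / p + (1 - 1 / p) * c powr p)"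
        using ax k[OF x] f[OF x] by (intro mult_left_mono young) auto
      also have "\<dots> = 1 / p * (k x * (a x * (f x / a x) powr p)) + (1 - 1 / p) * c powr p * (k x * a x)"
        by (simp add: algebra_simps)
      also have "a x * (f x / a x) powr p = f x powr p * (a x powr 1 / a x powr p)"
        using ax by (simp add: powr_divide)
      also have "a x powr 1 / a x powr p = a x powr (1 - p)" by (rule powr_diff[symmetric])
      finally have "ennreal (c powr (p - 1) * (k x * f x)) \<le> ennreal (1 / p * (k x * (f x powr p * a x powr (1 - p))) + (1 - 1 / p) * c powr p * (k x * a x))"
        by (rule ennreal_leI)
      also have "\<dots> = ennreal (1 / p) * ennreal (k x * (f x powr p * a x powr (1 - p))) + ennreal ((1 - 1 / p) * c powr p) * ennreal (k x * a x)"
        using p k[OF x] ax by (subst ennreal_plus) (auto simp flip: ennreal_mult')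
      finally show ?case using k[OF x] f[OF x] by (simp add: ennreal_mult)
    qed
  qed
  also have "\<dots> = ennreal (1 / p) * I + ennreal ((1 - 1 / p) * c powr p) * (\<integral>\<^sup>+x. ennreal (k x * a x) \<partial>M)"
    unfolding I_def by (simp add: nn_integral_add nn_integral_cmult)
  also have "\<dots> \<le> ennreal (1 / p) * ennreal b + ennreal ((1 - 1 / p) * c powr p) * ennreal A"
    using kA b by (intro add_mono mult_left_mono) auto
  also have "\<dots> = ennreal (1 / p * b + (1 - 1 / p) * c powr p * A)"
    using p A b by (simp flip: ennreal_mult ennreal_plus)
  finally have "c powr (p - 1) * t \<le> 1 / p * b + (1 - 1 / p) * c powr p * A"
    using p A b by (subst (asm) ennreal_le_iff) auto
  \<comment> \<open>This is the reason for the choice of c: the second term of Young's inequality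
    becomes a multiple of the left-hand side by 1 - 1/p and can be absorbed there.\<close>
  moreover have "c powr p * A = c powr (p - 1) * t"
  proof -
    have "c powr p = c powr (p - 1) * c powr 1" unfolding powr_add[symmetric] by simp
    thus ?thesis using A c t by (simp add: c_def)
  qed
  ultimately have "c powr (p - 1) * t \<le> 1 / p * b + (1 - 1 / p) * (c powr (p - 1) * t)"
    by (simp add: mult.assoc)
  hence "1 / p * (c powr (p - 1) * t) \<le> 1 / p * b" by (simp add: algebra_simps)
  hence "c powr (p - 1) * t \<le> b" using p by (simp add: divide_simps)
  hence "A powr (p - 1) * (c powr (p - 1) * t) \<le> A powr (p - 1) * b" by (intro mult_left_mono) auto
  also have "A powr (p - 1) * (c powr (p - 1) * t) = (A * c) powr (p - 1) * t powr 1"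
    using A c t by (simp add: powr_mult)
  also have "\<dots> = t powr p"
  proof -
    have "A * c = t" using A by (simp add: c_def)
    thus ?thesis by (simp only: powr_add[symmetric]) simp
  qed
  finally have "ennreal (t powr p) \<le> ennreal (A powr (p - 1) * b)" by (rule ennreal_leI)
  thus ?thesis using b by (simp add: ennreal_mult I_def)
qed

text \<open>Jensen's inequality in y for the weight \<open>k x y * a y\<close>, of mass at most
  \<open>C * a x\<close>, bounds \<open>u x powr p\<close>. Multiplication by W turns a powr (p - 1)
  into b, and after Tonelli the second test inequality applies in x. The powers a powr (1 - p) and a
  powr (p - 1) then cancel and leave W. Stated for any u dominated by the positive integral, it
  applies directly to moduli of complex integrals.\<close>

lemma schur_test:
  fixes k :: "'a \<Rightarrow> 'a \<Rightarrow> real" and f u a b W :: "'a \<Rightarrow> real"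
  assumes M: "sigma_finite_measure M" and p: "p > 1" and C: "C > 0"
    and km[measurable]: "(\<lambda>(x, y). k x y) \<in> borel_measurable (M \<Otimes>\<^sub>M M)"
    and k: "\<And>x y. x \<in> space M \<Longrightarrow> y \<in> space M \<Longrightarrow> k x y \<ge> 0"
    and [measurable]: "f \<in> borel_measurable M" "u \<in> borel_measurable M" "a \<in> borel_measurable M" 
      "b \<in> borel_measurable M" "W \<in> borel_measurable M"
    and f: "\<And>x. x \<in> space M \<Longrightarrow> f x \<ge> 0" and u: "\<And>x. x \<in> space M \<Longrightarrow> u x \<ge> 0" and W: "\<And>x. x \<in> space M \<Longrightarrow> W x \<ge> 0"
    and a: "AE x in M. a x > 0" and b: "AE x in M. b x = a x powr (p - 1) * W x"
    and ka: "AE x in M. (\<integral>\<^sup>+y. ennreal (k x y * a y) \<partial>M) \<le> ennreal (C * a x)"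
    and kb: "AE y in M. (\<integral>\<^sup>+x. ennreal (k x y * b x) \<partial>M) \<le> ennreal (C * b y)"
    and uk: "\<And>x. x \<in> space M \<Longrightarrow> ennreal (u x) \<le> (\<integral>\<^sup>+y. ennreal (k x y * f y) \<partial>M)"
  shows "(\<integral>\<^sup>+x. ennreal (u x powr p * W x) \<partial>M) \<le> ennreal (C powr p) * (\<integral>\<^sup>+x. ennreal (f x powr p * W x) \<partial>M)"
proof -
  interpret sigma_finite_measure M by (rule M)
  interpret pair_sigma_finite M M ..
  define F where "F = (\<lambda>y. f y powr p * a y powr (1 - p))"
  have [measurable]: "F \<in> borel_measurable M" unfolding F_def by measurable
  have F: "F y \<ge> 0" for y by (simp add: F_def)
  have kx: "(\<lambda>y. k x y) \<in> borel_measurable M" if "x \<in> space M" for x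
    using measurable_compose[OF measurable_Pair1'[OF that] km] by simp
  have ky: "(\<lambda>x. k x y) \<in> borel_measurable M" if "y \<in> space M" for y
    using measurable_compose[OF measurable_Pair2'[OF that] km] by simp
  have kxF: "(\<lambda>y. ennreal (k x y * F y)) \<in> borel_measurable M" if "x \<in> space M" for x
    by (rule measurable_compose[OF borel_measurable_times[OF kx[OF that]] measurable_ennreal]) measurable
  have kyb: "(\<lambda>x. ennreal (k x y * b x)) \<in> borel_measurable M" if "y \<in> space M" for y
    by (rule measurable_compose[OF borel_measurable_times[OF ky[OF that]] measurable_ennreal]) measurable
  have "(\<integral>\<^sup>+x. ennreal (u x powr p * W x) \<partial>M) \<le> (\<integral>\<^sup>+x. ennreal (C powr (p - 1) * b x) * (\<integral>\<^sup>+y. ennreal (k x y * F y) \<partial>M) \<partial>M)"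
  proof (rule nn_integral_mono_AE)
    show "AE x in M. ennreal (u x powr p * W x) \<le> ennreal (C powr (p - 1) * b x) * (\<integral>\<^sup>+y. ennreal (k x y * F y) \<partial>M)"
      using a b ka AE_space
    proof eventually_elim
      case (elim x)
      have "ennreal (u x powr p) \<le> ennreal ((C * a x) powr (p - 1)) * (\<integral>\<^sup>+y. ennreal (k x y * F y) \<partial>M)"
        unfolding F_def
        by (rule nn_integral_Jensen_powr[where a = a]) (use elim p C k f u uk a kx in auto)
      hence "ennreal (W x) * ennreal (u x powr p) \<le> ennreal (W x) * (ennreal ((C * a x) powr (p - 1)) * (\<integral>\<^sup>+y. ennreal (k x y * F y) \<partial>M))"
        by (rule mult_left_mono) simp
      also have "\<dots> = ennreal (C powr (p - 1) * b x) * (\<integral>\<^sup>+y. ennreal (k x y * F y) \<partial>M)"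
        using elim C W[of x] by (simp add: powr_mult ennreal_mult mult_ac)
      finally show ?case using W[of x] elim by (simp add: ennreal_mult mult.commute)
    qed
  qed
  also have "\<dots> = (\<integral>\<^sup>+x. (\<integral>\<^sup>+y. ennreal (C powr (p - 1)) * (ennreal (F y) * ennreal (k x y * b x)) \<partial>M) \<partial>M)"
  proof (rule nn_integral_cong_AE)
    show "AE x in M. ennreal (C powr (p - 1) * b x) * (\<integral>\<^sup>+y. ennreal (k x y * F y) \<partial>M) = 
       (\<integral>\<^sup>+y. ennreal (C powr (p - 1)) * (ennreal (F y) * ennreal (k x y * b x)) \<partial>M)"
      using b AE_space
    proof eventually_elim
      case (elim x)
      have bx: "b x \<ge> 0" using elim W[of x] by simp
      have "ennreal (C powr (p - 1) * b x) * (\<integral>\<^sup>+y. ennreal (k x y * F y) \<partial>M) = 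
         (\<integral>\<^sup>+y. ennreal (C powr (p - 1) * b x) * ennreal (k x y * F y) \<partial>M)"
        using kxF[OF elim(2)] by (intro nn_integral_cmult[symmetric])
      also have "\<dots> = (\<integral>\<^sup>+y. ennreal (C powr (p - 1)) * (ennreal (F y) * ennreal (k x y * b x)) \<partial>M)"
        using bx F k[OF elim(2)] by (intro nn_integral_cong) (simp add: ennreal_mult mult_ac)
      finally show ?case .
    qed
  qed
  also have "\<dots> = (\<integral>\<^sup>+y. (\<integral>\<^sup>+x. ennreal (C powr (p - 1)) * (ennreal (F y) * ennreal (k x y * b x)) \<partial>M) \<partial>M)"
    by (rule Fubini'[symmetric]) measurable
  also have "\<dots> \<le> (\<integral>\<^sup>+y. ennreal (C powr p) * ennreal (f y powr p * W y) \<partial>M)"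
  proof (rule nn_integral_mono_AE)
    show "AE y in M. (\<integral>\<^sup>+x. ennreal (C powr (p - 1)) * (ennreal (F y) * ennreal (k x y * b x)) \<partial>M) \<le> ennreal (C powr p) * ennreal (f y powr p * W y)"
      using a b kb AE_space
    proof eventually_elim
      case (elim y)
      have "(\<integral>\<^sup>+x. ennreal (C powr (p - 1)) * (ennreal (F y) * ennreal (k x y * b x)) \<partial>M) = 
          (\<integral>\<^sup>+x. ennreal (C powr (p - 1) * F y) * ennreal (k x y * b x) \<partial>M)"
        using F by (intro nn_integral_cong) (simp add: ennreal_mult mult.assoc)
      also have "\<dots> = ennreal (C powr (p - 1) * F y) * (\<integral>\<^sup>+x. ennreal (k x y * b x) \<partial>M)"
        using kyb[OF elim(4)] by (intro nn_integral_cmult)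
      also have "\<dots> \<le> ennreal (C powr (p - 1) * F y) * ennreal (C * b y)"
        using elim by (intro mult_left_mono) auto
      also have "\<dots> = ennreal ((C powr (p - 1) * C) * (F y * b y))"
        using F elim W[of y] C by (simp add: ennreal_mult[symmetric] mult_ac)
      also have "C powr (p - 1) * C = C powr p" using C by (simp add: powr_diff)
      also have "F y * b y = f y powr p * W y * (a y powr (1 - p) * a y powr (p - 1))"
        using elim by (simp add: F_def mult_ac)
      also have "a y powr (1 - p) * a y powr (p - 1) = 1" using elim by (simp flip: powr_add)
      finally show ?case using W[of y] elim by (simp add: ennreal_mult)
    qed
  qed
  also have "\<dots> = ennreal (C powr p) * (\<integral>\<^sup>+x. ennreal (f x powr p * W x) \<partial>M)"
    by (rule nn_integral_cmult) measurable
  finally show ?thesis .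
qed

section \<open>The polydisc kernel and its weighted bound\<close>

text \<open>This is the Bergman kernel of the polydisc times the volume; the volume is kept as a
  symbol and divided out later.\<close>

definition poly_kernel :: "complex ^ 'n::finite \<Rightarrow> complex ^ 'n \<Rightarrow> complex" where
  "poly_kernel z w = (\<Prod>i\<in>UNIV. 1 / (1 - z $ i * cnj (w $ i))\<^sup>2)"

abbreviation polydisc_measure :: "(complex ^ 'n::finite) measure" where
  "polydisc_measure \<equiv> restrict_space lborel polydisc"

lemma space_polydisc_measure [simp]: "space polydisc_measure = polydisc"
  by (simp add: space_restrict_space)

lemma borel_measurable_polydiscI:
  "f \<in> borel_measurable borel \<Longrightarrow> f \<in> borel_measurable polydisc_measure"
  by (intro measurable_restrict_space1) simp

lemma sigma_finite_polydisc_measure: "sigma_finite_measure polydisc_measure"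
  by (rule sigma_finite_measure_restrict_space) (auto intro: lborel.sigma_finite_measure_axioms)

lemma norm_poly_kernel:
  "norm (poly_kernel z w) = (\<Prod>i\<in>UNIV. norm (1 - z $ i * cnj (w $ i)) powr (-2))"
  unfolding poly_kernel_def prod_norm[symmetric]
  by (intro prod.cong refl) (auto simp: norm_inverse norm_power powr_minus divide_inverse powr_numeral)

lemma norm_poly_kernel_commute: "norm (poly_kernel z w) = norm (poly_kernel w z)"
  unfolding norm_poly_kernel
proof (intro prod.cong refl)
  fix i
  have "norm (1 - z $ i * cnj (w $ i)) = norm (cnj (1 - z $ i * cnj (w $ i)))" by (simp only: complex_mod_cnj)
  thus "norm (1 - z $ i * cnj (w $ i)) powr (-2) = norm (1 - w $ i * cnj (z $ i)) powr (-2)"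
    by (simp add: mult.commute)
qed

text \<open>Real parts, rather than the coordinates themselves, are separated because coordinates
  will be sorted by real part. Each coincidence is a real hyperplane.\<close>

lemma AE_distinct_coords: "AE w in (lborel :: (complex ^ 'n::finite) measure). inj (\<lambda>i. Re (w $ i))"
proof -
  have "AE w in (lborel :: (complex ^ 'n) measure). \<forall>p\<in>{p. fst p \<noteq> snd p}. Re (w $ fst p) \<noteq> Re (w $ snd p)"
  proof (subst AE_finite_all, simp, safe)
    fix i j :: 'n assume "fst (i, j) \<noteq> snd (i, j)"
    hence ij: "i \<noteq> j" by simp
    define a :: "complex ^ 'n" where "a = axis i 1 - axis j 1"
    have "a $ i = 1" using ij by (simp add: a_def axis_def)
    hence a: "a \<noteq> 0" by auto
    have "negligible {x. a \<bullet> x = 0}" using a by (intro negligible_hyperplane) auto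
    moreover have "a \<bullet> x = Re (x $ i) - Re (x $ j)" for x
      by (simp add: a_def inner_diff_left inner_axis')
    ultimately have "negligible {x :: complex ^ 'n. Re (x $ i) = Re (x $ j)}" by simp
    hence "{x :: complex ^ 'n. Re (x $ i) = Re (x $ j)} \<in> null_sets lebesgue" by (simp add: negligible_iff_null_sets)
    moreover have "{x :: complex ^ 'n. Re (x $ i) = Re (x $ j)} \<in> sets borel" 
      by (intro borel_closed closed_Collect_eq continuous_intros)
    ultimately have "{x :: complex ^ 'n. Re (x $ i) = Re (x $ j)} \<in> null_sets lborel"
      by (auto simp: null_sets_def)
    from AE_not_in[OF this] show "AE w in (lborel :: (complex ^ 'n) measure). Re (w $ fst (i, j)) \<noteq> Re (w $ snd (i, j))"
      by simp
  qed
  thus ?thesis by eventually_elim (auto simp: inj_def)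
qed

lemma AE_polydisc_distinct: "AE w in (polydisc_measure :: (complex ^ 'n::finite) measure). w \<in> polydisc \<and> inj (($) w)"
proof -
  have "AE w in (lborel :: (complex ^ 'n) measure). w \<in> polydisc \<longrightarrow> w \<in> polydisc \<and> inj (($) w)"
    using AE_distinct_coords by eventually_elim (auto simp: inj_def)
  thus ?thesis by (subst AE_restrict_space_iff) auto
qed

text \<open>With N = n - 1 and r = sqrt(n^2 - 1) the range reads N / r < p - 1 < r / N. Since r < N
  + 1, this gives N (p - 1) < N + 1 and N < (N + 1)(p - 1), which are the two conditions on the
  order of the poles. The last bound uses N + 1 \<le> 2 N.\<close>

lemma exponent_bounds:
  fixes n :: nat and p :: real
  assumes n: "n \<ge> 2" and lo: "(sqrt (real n ^ 2 - 1) + real n - 1) / sqrt (real n ^ 2 - 1) < p"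
    and hi: "p < (sqrt (real n ^ 2 - 1) + real n - 1) / (real n - 1)"
  shows "1 < p" "(real n - 1) * (p - 2) < 1" "(real n - 1) * ((2 - p) / (p - 1)) < 1" "(p - 1) / 2 < 1"
proof -
  define N where "N = real n - 1"
  define r where "r = sqrt (real n ^ 2 - 1)"
  have N: "N \<ge> 1" using n by (simp add: N_def)
  have n2: "real n ^ 2 - 1 > 0" using n by (simp add: power2_eq_square) (metis (no_types) less_1_mult nat_1_add_1 of_nat_1 of_nat_less_iff one_less_numeral_iff order_less_le_trans semiring_norm(76) of_nat_mult)
  hence r0: "r > 0" by (simp add: r_def)
  have r: "r < N + 1" unfolding r_def by (rule real_less_lsqrt) (use N in \<open>auto simp: N_def\<close>)
  have lo': "N / r < p - 1" using lo r0 unfolding r_def[symmetric] by (simp add: N_def field_simps)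
  have hi': "p - 1 < r / N" using hi N unfolding r_def[symmetric] by (simp add: N_def field_simps)
  show p1: "1 < p" using lo' N r0 by (smt (verit) divide_pos_pos)
  have "(p - 1) * N < r" using hi' N by (simp add: field_simps)
  hence a: "(p - 1) * N < N + 1" using r by simp
  thus "(real n - 1) * (p - 2) < 1" by (simp add: N_def[symmetric] algebra_simps)
  have "(p - 1) * N < 2 * N" using a N by linarith
  hence "p - 1 < 2" using N by (simp only: mult_less_cancel_right_pos)
  thus "(p - 1) / 2 < 1" by simp
  have "N < r * (p - 1)" using lo' r0 by (simp add: field_simps)
  also have "\<dots> < (N + 1) * (p - 1)" using r p1 by simp
  finally have "N * (2 - p) < p - 1" by (simp add: algebra_simps)
  thus "(real n - 1) * ((2 - p) / (p - 1)) < 1" using p1 by (simp add: N_def[symmetric] field_simps)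
qed

lemma poly_kernel_pair_measurable:
  "(\<lambda>(z, w :: complex ^ 'n::finite). poly_kernel z w) \<in> borel_measurable (polydisc_measure \<Otimes>\<^sub>M polydisc_measure)"
proof -
  have nth: "(\<lambda>z :: complex ^ 'n. z $ i) \<in> borel_measurable polydisc_measure" for i
    by (intro borel_measurable_polydiscI) measurable
  have f1: "(\<lambda>x. fst x $ i) \<in> borel_measurable (polydisc_measure \<Otimes>\<^sub>M (polydisc_measure :: (complex ^ 'n) measure))" for i :: 'n
    by (rule measurable_compose[OF measurable_fst nth])
  have f2: "(\<lambda>x. snd x $ i) \<in> borel_measurable ((polydisc_measure :: (complex ^ 'n) measure) \<Otimes>\<^sub>M (polydisc_measure :: (complex ^ 'n) measure))" for i :: 'n
    by (rule measurable_compose[OF measurable_snd nth])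
  show ?thesis unfolding poly_kernel_def case_prod_unfold
    by (intro borel_measurable_prod borel_measurable_divide borel_measurable_power
        borel_measurable_diff borel_measurable_times borel_measurable_const measurable_compose[OF _ borel_measurable_cnj] f1 f2)
qed

text \<open>The weight is the one that the pullback produces from the p-norm on the symmetrized
  polydisc. The type argument fixes the dimension.\<close>

definition kernel_bounded :: "'n::finite itself \<Rightarrow> real \<Rightarrow> real \<Rightarrow> bool" where
  "kernel_bounded _ p C \<longleftrightarrow> (\<forall>f u :: complex ^ 'n \<Rightarrow> real. f \<in> borel_measurable polydisc_measure \<longrightarrow> u \<in> borel_measurable polydisc_measure \<longrightarrow>
      (\<forall>z\<in>polydisc. f z \<ge> 0) \<longrightarrow> (\<forall>z\<in>polydisc. u z \<ge> 0) \<longrightarrow>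
      (\<forall>z\<in>polydisc. ennreal (u z) \<le> (\<integral>\<^sup>+w. ennreal (norm (poly_kernel z w) * f w) \<partial>polydisc_measure)) \<longrightarrow>
      (\<integral>\<^sup>+z. ennreal (u z powr p * vdm_weight (p - 2) (($) z)) \<partial>polydisc_measure) 
        \<le> ennreal (C powr p) * (\<integral>\<^sup>+z. ennreal (f z powr p * vdm_weight (p - 2) (($) z)) \<partial>polydisc_measure))"

lemma kernel_boundedD:
  fixes f u :: "complex ^ 'n::finite \<Rightarrow> real"
  assumes "kernel_bounded TYPE('n) p C" "f \<in> borel_measurable polydisc_measure" "u \<in> borel_measurable polydisc_measure"
    "\<And>z. z \<in> polydisc \<Longrightarrow> f z \<ge> 0" "\<And>z. z \<in> polydisc \<Longrightarrow> u z \<ge> 0"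
    "\<And>z. z \<in> polydisc \<Longrightarrow> ennreal (u z) \<le> (\<integral>\<^sup>+w. ennreal (norm (poly_kernel z w) * f w) \<partial>polydisc_measure)"
  shows "(\<integral>\<^sup>+z. ennreal (u z powr p * vdm_weight (p - 2) (($) z)) \<partial>polydisc_measure) 
        \<le> ennreal (C powr p) * (\<integral>\<^sup>+z. ennreal (f z powr p * vdm_weight (p - 2) (($) z)) \<partial>polydisc_measure)"
  using assms unfolding kernel_bounded_def by blast

lemma polydisc_schur:
  fixes p :: real
  assumes n: "CARD('n::finite) \<ge> 2" and p: "1 < p" "(real CARD('n) - 1) * (p - 2) < 1" 
    "(real CARD('n) - 1) * ((2 - p) / (p - 1)) < 1" "(p - 1) / 2 < 1"
  obtains C where "C > 0" "kernel_bounded TYPE('n) p C"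
proof -
  \<comment> \<open>The test functions carry Vandermonde powers -s1 and -s2, and b = a powr (p - 1)
    times the weight forces s2 = s1 (p - 1) + (p - 2). Both must be nonnegative and below 1 / (n -
    1). For p \<ge> 2 the weight is singular and s1 = 0 is admissible; for p < 2 the weight vanishes
    on the diagonals, and s1 is chosen to make s2 = 0.\<close>
  define s1 where "s1 = (if p \<ge> 2 then 0 else (2 - p) / (p - 1))"
  define s2 where "s2 = s1 * (p - 1) + (p - 2)"
  have s1: "0 \<le> s1" "(real CARD('n) - 1) * s1 < 1" using p by (auto simp: s1_def)
  have "s2 = (if p \<ge> 2 then p - 2 else 0)" using p by (simp add: s2_def s1_def)
  hence s2: "0 \<le> s2" "(real CARD('n) - 1) * s2 < 1" using p by auto
  define a where "a = (\<lambda>s e (w :: complex ^ 'n). (\<Prod>i\<in>UNIV. (1 - (norm (w $ i))\<^sup>2) powr (-e)) * vdm_weight s (($) w))"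
  have am: "a s e \<in> borel_measurable borel" for s e unfolding a_def vdm_weight_def by measurable
  have bound: "\<exists>C>0. \<forall>z\<in>polydisc. inj (($) z) \<longrightarrow> 
     (\<integral>\<^sup>+w. ennreal (norm (poly_kernel z w) * a s e w) \<partial>polydisc_measure) \<le> ennreal (C * a s e z)"
    if s: "0 \<le> s" "(real CARD('n) - 1) * s < 1" and e: "0 < e" "e < 1" for s e
  proof -
    obtain C where C: "C > 0" "\<And>z :: complex ^ 'n. z \<in> polydisc \<Longrightarrow> inj (($) z) \<Longrightarrow>
      (\<integral>\<^sup>+w. indicator polydisc w * ennreal ((\<Prod>i\<in>UNIV. norm (1 - z $ i * cnj (w $ i)) powr (-2) * (1 - (norm (w $ i))\<^sup>2) powr (-e))
         * vdm_weight s (($) w)) \<partial>lborel)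
        \<le> ennreal (C * (\<Prod>i\<in>UNIV. (1 - (norm (z $ i))\<^sup>2) powr (-e)) * vdm_weight s (($) z))"
      by (rule polydisc_weight_bound[OF n s e]) blast
    have "(\<integral>\<^sup>+w. ennreal (norm (poly_kernel z w) * a s e w) \<partial>polydisc_measure) \<le> ennreal (C * a s e z)" 
      if "z \<in> polydisc" "inj (($) z)" for z
    proof -
      have "(\<integral>\<^sup>+w. ennreal (norm (poly_kernel z w) * a s e w) \<partial>polydisc_measure) = 
        (\<integral>\<^sup>+w. indicator polydisc w * ennreal ((\<Prod>i\<in>UNIV. norm (1 - z $ i * cnj (w $ i)) powr (-2) * (1 - (norm (w $ i))\<^sup>2) powr (-e))
         * vdm_weight s (($) w)) \<partial>lborel)"
        by (subst nn_integral_restrict_space)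
           (auto simp: a_def norm_poly_kernel prod.distrib mult.assoc indicator_def intro!: nn_integral_cong)
      also have "\<dots> \<le> ennreal (C * a s e z)" using C(2)[OF that] by (simp add: a_def mult.assoc)
      finally show ?thesis .
    qed
    thus ?thesis using C(1) by blast
  qed
  \<comment> \<open>The boundary exponents of a and b must be e and e (p - 1), both strictly between
    0 and 1. The choice e = 1/2 works because p < 3.\<close>
  obtain C1 where C1: "C1 > 0" "\<And>z. z \<in> polydisc \<Longrightarrow> inj (($) z) \<Longrightarrow>
     (\<integral>\<^sup>+w. ennreal (norm (poly_kernel z w) * a s1 (1/2) w) \<partial>polydisc_measure) \<le> ennreal (C1 * a s1 (1/2) z)"
    using bound[OF s1, of "1/2"] by auto
  obtain C2 where C2: "C2 > 0" "\<And>z. z \<in> polydisc \<Longrightarrow> inj (($) z) \<Longrightarrow>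
     (\<integral>\<^sup>+w. ennreal (norm (poly_kernel z w) * a s2 ((p-1)/2) w) \<partial>polydisc_measure) \<le> ennreal (C2 * a s2 ((p-1)/2) z)"
    using bound[OF s2, of "(p-1)/2"] p by auto
  define C where "C = C1 + C2"
  have C: "C > 0" using C1(1) C2(1) by (simp add: C_def)
  have a0: "a s e z \<ge> 0" for s e z unfolding a_def by (intro mult_nonneg_nonneg prod_nonneg vdm_weight_nonneg) auto
  have pos: "(1 - (norm (z $ i))\<^sup>2) > 0" if "z \<in> polydisc" for z :: "complex ^ 'n" and i
    using that by (auto simp: polydisc_iff abs_square_less_1)
  have v0: "vdm_weight s (($) z) > 0" if "inj (($) z)" for s and z :: "complex ^ 'n"
    unfolding vdm_weight_def using that by (intro prod_pos) (auto simp: inj_eq)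
  have nm: "norm \<in> borel_measurable (borel :: complex measure)" by measurable
  have kmeas: "(\<lambda>(z, w :: complex ^ 'n). norm (poly_kernel z w)) \<in> borel_measurable (polydisc_measure \<Otimes>\<^sub>M polydisc_measure)"
    using measurable_compose[OF poly_kernel_pair_measurable nm] by (simp add: case_prod_unfold)
  show ?thesis
  proof (rule that[OF C], unfold kernel_bounded_def, intro allI impI)
    fix f u :: "complex ^ 'n \<Rightarrow> real"
    assume m: "f \<in> borel_measurable polydisc_measure" "u \<in> borel_measurable polydisc_measure"
     and nn: "\<forall>z\<in>polydisc. f z \<ge> 0" "\<forall>z\<in>polydisc. u z \<ge> 0"
     and uk: "\<forall>z\<in>polydisc. ennreal (u z) \<le> (\<integral>\<^sup>+w. ennreal (norm (poly_kernel z w) * f w) \<partial>polydisc_measure)"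
    show "(\<integral>\<^sup>+z. ennreal (u z powr p * vdm_weight (p - 2) (($) z)) \<partial>polydisc_measure) 
        \<le> ennreal (C powr p) * (\<integral>\<^sup>+z. ennreal (f z powr p * vdm_weight (p - 2) (($) z)) \<partial>polydisc_measure)"
    proof (rule schur_test[OF sigma_finite_polydisc_measure p(1) C kmeas, where a = "a s1 (1/2)" and b = "a s2 ((p-1)/2)"])
      show "AE z in polydisc_measure. a s1 (1/2) z > 0"
        using AE_polydisc_distinct
      proof eventually_elim
        case (elim z)
        have "(\<Prod>i\<in>UNIV. (1 - (norm (z $ i))\<^sup>2) powr (-(1/2))) > 0"
        proof (intro prod_pos ballI)
          fix i show "(1 - (norm (z $ i))\<^sup>2) powr (-(1/2)) > 0" using pos[of z i] elim by (subst powr_gt_zero) auto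
        qed
        thus ?case unfolding a_def using v0[of z s1] elim by (intro mult_pos_pos) auto
      qed
      show "AE z in polydisc_measure. a s2 ((p-1)/2) z = a s1 (1/2) z powr (p - 1) * vdm_weight (p - 2) (($) z)"
        using AE_polydisc_distinct
      proof eventually_elim
        case (elim z)
        have e1: "((1 - (norm (z $ i))\<^sup>2) powr (-(1/2))) powr (p - 1) = (1 - (norm (z $ i))\<^sup>2) powr (-((p-1)/2))" for i
          by (simp add: powr_powr field_simps)
        have e2: "vdm_weight s1 (($) z) powr (p - 1) * vdm_weight (p - 2) (($) z) = vdm_weight s2 (($) z)"
        proof -
          have ex: "- s1 / 2 * (p - 1) + - (p - 2) / 2 = - s2 / 2" by (simp add: s2_def algebra_simps) (simp add: field_simps)
          show ?thesis unfolding vdm_weight_def prod_powr_distrib[symmetric]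
            by (simp only: powr_powr powr_add[symmetric] ex)
        qed
        have "a s1 (1/2) z powr (p - 1) = (\<Prod>i\<in>UNIV. (1 - (norm (z $ i))\<^sup>2) powr (-((p-1)/2))) * vdm_weight s1 (($) z) powr (p - 1)"
          unfolding a_def by (simp only: powr_mult prod_powr_distrib e1)
        thus ?case unfolding a_def e2[symmetric] by (simp add: mult.assoc)
      qed
      show "AE x in polydisc_measure. (\<integral>\<^sup>+y. ennreal (norm (poly_kernel x y) * a s1 (1/2) y) \<partial>polydisc_measure) \<le> ennreal (C * a s1 (1/2) x)"
        using AE_polydisc_distinct
      proof eventually_elim
        case (elim z)
        have "C1 * a s1 (1/2) z \<le> C * a s1 (1/2) z" using C2(1) by (intro mult_right_mono a0) (simp add: C_def)
        thus ?case using C1(2)[of z] elim by (auto intro: order_trans ennreal_leI)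
      qed
      show "AE y in polydisc_measure. (\<integral>\<^sup>+x. ennreal (norm (poly_kernel x y) * a s2 ((p-1)/2) x) \<partial>polydisc_measure) \<le> ennreal (C * a s2 ((p-1)/2) y)"
        using AE_polydisc_distinct
      proof eventually_elim
        case (elim z)
        have "C2 * a s2 ((p-1)/2) z \<le> C * a s2 ((p-1)/2) z" using C1(1) by (intro mult_right_mono a0) (simp add: C_def)
        thus ?case using C2(2)[of z] elim 
          by (subst norm_poly_kernel_commute) (auto intro: order_trans ennreal_leI)
      qed
      show "vdm_weight (p - 2) (($) x) \<ge> 0" for x :: "complex ^ 'n" by (rule vdm_weight_nonneg)
      show "(\<lambda>z. vdm_weight (p - 2) (($) z)) \<in> borel_measurable polydisc_measure"
        unfolding vdm_weight_def by (intro borel_measurable_polydiscI) measurable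
    qed (use m nn uk am in \<open>auto intro: borel_measurable_polydiscI\<close>)
  qed
qed

section \<open>Mean values and the reproducing kernel of the polydisc\<close>

text \<open>Testing the formula for nonnegative integrands on indicators yields an equality of
  measures, from which integrability and complex integrals can be transported as well.\<close>

lemma restrict_space_change_of_variables:
  fixes g :: "'a::euclidean_space \<Rightarrow> 'b::euclidean_space"
  assumes S: "S \<in> sets borel" and T: "T \<in> sets borel"
    and g: "g \<in> measurable (restrict_space lborel S) (restrict_space lborel T)"
    and d: "d \<in> borel_measurable borel"
    and nn: "\<And>F. F \<in> borel_measurable borel \<Longrightarrow>
      (\<integral>\<^sup>+w. indicator T w * F w \<partial>lborel) = (\<integral>\<^sup>+w. indicator S w * (ennreal (d w) * F (g w)) \<partial>lborel)"
  shows "restrict_space lborel T = distr (density (restrict_space lborel S) (\<lambda>w. ennreal (d w))) (restrict_space lborel T) g"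
proof (rule measure_eqI)
  fix B assume "B \<in> sets (restrict_space lborel T)"
  hence B: "B \<in> sets borel" "B \<subseteq> T" using T by (auto simp: sets_restrict_space_iff)
  have dm: "(\<lambda>w. ennreal (d w)) \<in> borel_measurable (restrict_space lborel S)"
    using d by (intro measurable_restrict_space1) simp
  have gd: "g \<in> measurable (density (restrict_space lborel S) (\<lambda>w. ennreal (d w))) (restrict_space lborel T)"
    using g by simp
  have B': "B \<in> sets (restrict_space lborel T)" using B T by (simp add: sets_restrict_space_iff)
  have gB: "g -` B \<inter> S \<in> sets (restrict_space lborel S)"
    using measurable_sets[OF g B'] by (simp add: space_restrict_space)
  have "emeasure (restrict_space lborel T) B = (\<integral>\<^sup>+w. indicator T w * indicator B w \<partial>lborel)"
  proof -
    have "emeasure (restrict_space lborel T) B = emeasure lborel B"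
      using B T by (subst emeasure_restrict_space) auto
    also have "\<dots> = (\<integral>\<^sup>+w. indicator B w \<partial>lborel)" using B by simp
    also have "\<dots> = (\<integral>\<^sup>+w. indicator T w * indicator B w \<partial>lborel)"
      using B by (intro nn_integral_cong) (auto simp: indicator_def)
    finally show ?thesis .
  qed
  also have "\<dots> = (\<integral>\<^sup>+w. indicator S w * (ennreal (d w) * indicator B (g w)) \<partial>lborel)"
    using B by (intro nn) auto
  also have "\<dots> = (\<integral>\<^sup>+w. ennreal (d w) * indicator (g -` B \<inter> S) w \<partial>restrict_space lborel S)"
    using S by (subst nn_integral_restrict_space) (auto simp: indicator_def intro!: nn_integral_cong)
  also have "\<dots> = emeasure (density (restrict_space lborel S) (\<lambda>w. ennreal (d w))) (g -` B \<inter> S)"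
    by (rule emeasure_density[OF dm gB, symmetric])
  also have "\<dots> = emeasure (distr (density (restrict_space lborel S) (\<lambda>w. ennreal (d w))) (restrict_space lborel T) g) B"
    using emeasure_distr[OF gd B'] by (simp add: space_restrict_space)
  finally show "emeasure (restrict_space lborel T) B = emeasure (distr (density (restrict_space lborel S) (\<lambda>w. ennreal (d w))) (restrict_space lborel T) g) B" .
qed simp

lemma emeasure_polydisc_finite: "emeasure lborel (polydisc :: (complex ^ 'n::finite) set) < \<infinity>"
proof -
  have "bounded (polydisc :: (complex ^ 'n) set)"
  proof (rule boundedI)
    fix w :: "complex ^ 'n" assume w: "w \<in> polydisc"
    have "norm w \<le> (\<Sum>i\<in>UNIV. norm (w $ i))" by (simp add: norm_vec_def L2_set_le_sum)
    also have "\<dots> \<le> (\<Sum>i\<in>(UNIV::'n set). 1)" using w by (intro sum_mono) (auto simp: polydisc_iff less_imp_le)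
    finally show "norm w \<le> (\<Sum>i\<in>(UNIV::'n set). 1)" .
  qed
  thus ?thesis by (intro emeasure_bounded_finite)
qed

lemma finite_polydisc_measure: "finite_measure (polydisc_measure :: (complex ^ 'n::finite) measure)"
  by (rule finite_measureI) (use emeasure_polydisc_finite[where 'n = 'n] in \<open>auto simp: emeasure_restrict_space\<close>)

lemma emeasure_polydisc_pos: "measure (polydisc_measure :: (complex ^ 'n::finite) measure) polydisc > 0"
proof -
  have ne: "(0 :: complex ^ 'n) \<in> polydisc" by (simp add: polydisc_iff)
  have "emeasure lborel (polydisc :: (complex ^ 'n) set) \<noteq> 0"
  proof
    assume "emeasure lborel (polydisc :: (complex ^ 'n) set) = 0"
    hence "(polydisc :: (complex ^ 'n) set) \<in> null_sets lebesgue"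
      by (metis null_setsI polydisc_borel sets_lborel emeasure_completion null_sets_completionI)
    hence "negligible (polydisc :: (complex ^ 'n) set)" by (simp add: negligible_iff_null_sets)
    thus False using open_not_negligible[OF open_polydisc] ne by blast
  qed
  thus ?thesis using emeasure_polydisc_finite[where 'n = 'n]
    by (simp add: measure_def emeasure_restrict_space enn2real_positive_iff less_top zero_less_iff_neq_zero)
qed

text \<open>For a map acting separately in each coordinate the Jacobian matrix is diagonal. This
  covers both rotations and products of Moebius maps.\<close>

lemma bij_betw_polydisc_change:
  fixes g :: "complex ^ 'n::finite \<Rightarrow> complex ^ 'n"
  assumes g: "bij_betw g polydisc polydisc"
    and der: "\<And>w i. w \<in> polydisc \<Longrightarrow> ((\<lambda>w. g w $ i) has_derivative (\<lambda>v. c w i * v $ i)) (at w)"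
    and d: "d \<in> borel_measurable borel" "\<And>w. w \<in> polydisc \<Longrightarrow> d w = (\<Prod>i\<in>UNIV. (norm (c w i))\<^sup>2)"
  shows "polydisc_measure = distr (density polydisc_measure (\<lambda>w. ennreal (d w))) polydisc_measure g"
    and "g \<in> measurable polydisc_measure polydisc_measure"
proof -
  have img: "g ` polydisc = polydisc" using g by (simp add: bij_betw_def)
  have der': "(g has_derivative (\<lambda>v. (\<chi> i j. if i = j then c w i else 0) *v v)) (at w)" if "w \<in> polydisc" for w
  proof (rule has_derivative_vecI)
    fix m
    have "(\<lambda>v. ((\<chi> i j. if i = j then c w i else 0) *v v) $ m) = (\<lambda>v. c w m * v $ m)"
      by (simp add: matrix_vector_mult_def if_distrib[of "\<lambda>t. t * _"] fun_eq_iff cong: if_cong)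
    thus "((\<lambda>x. g x $ m) has_derivative (\<lambda>v. ((\<chi> i j. if i = j then c w i else 0) *v v) $ m)) (at w)"
      using der[OF that, of m] by simp
  qed
  have cont: "continuous_on polydisc g"
    using der' by (intro continuous_at_imp_continuous_on ballI has_derivative_continuous)
  show gm: "g \<in> measurable polydisc_measure polydisc_measure"
  proof (rule measurable_restrict_space2)
    show "g \<in> space polydisc_measure \<rightarrow> polydisc" using img by auto
    show "g \<in> polydisc_measure \<rightarrow>\<^sub>M lborel"
      using borel_measurable_continuous_on_restrict[OF cont] by (simp cong: measurable_cong_sets add: sets_restrict_space)
  qed
  show "polydisc_measure = distr (density polydisc_measure (\<lambda>w. ennreal (d w))) polydisc_measure g"
  proof (rule restrict_space_change_of_variables[OF polydisc_borel polydisc_borel gm d(1)])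
    fix F :: "complex ^ 'n \<Rightarrow> ennreal" assume F: "F \<in> borel_measurable borel"
    have "(\<integral>\<^sup>+w. indicator (g ` polydisc) w * F w \<partial>lborel) = (\<integral>\<^sup>+w. indicator polydisc w * (ennreal (d w) * F (g w)) \<partial>lborel)"
    proof (rule complex_change_of_variables[OF open_polydisc der'])
      show "inj_on g polydisc" using g by (simp add: bij_betw_def)
      show "emeasure lborel (g ` polydisc) < \<infinity>" unfolding img by (rule emeasure_polydisc_finite)
      show "real_jacobian (\<chi> i j. if i = j then c w i else 0) = d w" if "w \<in> polydisc" for w
        using that by (simp add: real_jacobian_diag d(2))
    qed (use d F in auto)
    thus "(\<integral>\<^sup>+w. indicator polydisc w * F w \<partial>lborel) = (\<integral>\<^sup>+w. indicator polydisc w * (ennreal (d w) * F (g w)) \<partial>lborel)"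
      by (simp add: img)
  qed
qed

lemma rotate_polydisc:
  fixes c :: complex
  assumes c: "norm c = 1"
  shows "(polydisc_measure :: (complex ^ 'n::finite) measure) = distr polydisc_measure polydisc_measure ((*s) c)"
    and "(*s) c \<in> measurable polydisc_measure (polydisc_measure :: (complex ^ 'n::finite) measure)"
proof -
  have nz: "c \<noteq> 0" using c by auto
  have bij: "bij_betw ((*s) c) polydisc (polydisc :: (complex ^ 'n) set)"
  proof (rule bij_betw_byWitness[where f' = "(*s) (inverse c)"])
    show "(*s) c ` polydisc \<subseteq> polydisc" "(*s) (inverse c) ` polydisc \<subseteq> polydisc"
      using c by (auto simp: polydisc_iff norm_mult norm_inverse)
  qed (use nz in \<open>auto simp: vector_smult_assoc\<close>)
  have der: "((\<lambda>w :: complex ^ 'n. (c *s w) $ i) has_derivative (\<lambda>v. c * v $ i)) (at w)" for w i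
    unfolding vector_smult_component
    by (intro bounded_linear_imp_has_derivative bounded_linear_const_mult bounded_linear_vec_nth)
  note * = bij_betw_polydisc_change[OF bij der, of "\<lambda>_. 1"]
  have "density (polydisc_measure :: (complex ^ 'n) measure) (\<lambda>w. ennreal 1) = polydisc_measure" by (simp add: density_1)
  thus "(polydisc_measure :: (complex ^ 'n::finite) measure) = distr polydisc_measure polydisc_measure ((*s) c)"
    using *(1) c by simp
  show "(*s) c \<in> measurable polydisc_measure (polydisc_measure :: (complex ^ 'n::finite) measure)"
    using *(2) c by simp
qed

lemma circle_mean_value:
  assumes "f holomorphic_on cball 0 1"
  shows "((\<lambda>t. f (exp (2 * pi * \<i> * of_real t))) has_integral f 0) {0..1::real}"
proof -
  have "((\<lambda>u. f u / (u - 0)) has_contour_integral (2 * of_real pi * \<i> * f 0)) (circlepath 0 1)"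
    using assms by (intro Cauchy_integral_circlepath_simple) auto
  hence "((\<lambda>t. f (exp (2 * pi * \<i> * of_real t)) / exp (2 * pi * \<i> * of_real t) * (2 * pi * \<i> * exp (2 * pi * \<i> * of_real t)))
     has_integral (2 * of_real pi * \<i> * f 0)) {0..1}"
  proof -
    have "circlepath 0 1 t = exp (2 * pi * \<i> * of_real t)" for t by (simp add: circlepath)
    thus ?thesis using \<open>(_ has_contour_integral _) _\<close> unfolding has_contour_integral_def
      by (elim has_integral_eq[rotated]) (simp add: vector_derivative_circlepath01)
  qed
  hence "((\<lambda>t. 2 * pi * \<i> * f (exp (2 * pi * \<i> * of_real t))) has_integral (2 * of_real pi * \<i> * f 0)) {0..1}"
    by (rule has_integral_eq[rotated]) (simp add: field_simps)
  from has_integral_mult_right[OF this, of "1 / (2 * pi * \<i>)"] show ?thesis by simp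
qed

text \<open>For fixed w the slice u -> F(u w) is holomorphic on the closed unit disc, since |u|
  \<le> 1 keeps u w in the polydisc.\<close>

lemma holo_on_slice_mean_value:
  fixes F :: "complex ^ 'n::finite \<Rightarrow> complex"
  assumes F: "holo_on F polydisc" and w: "w \<in> polydisc"
  shows "((\<lambda>t. F (exp (2 * pi * \<i> * of_real t) *s w)) has_integral F 0) {0..1::real}"
proof -
  define f where "f = (\<lambda>u. F (u *s w))"
  have "f holomorphic_on cball 0 1"
  proof (rule holomorphic_onI)
    fix u :: complex assume u: "u \<in> cball 0 1"
    have "u *s w \<in> polydisc" unfolding polydisc_iff
    proof
      fix i
      have "norm u * norm (w $ i) \<le> 1 * norm (w $ i)" using u by (intro mult_right_mono) auto
      also have "\<dots> < 1" using w by (simp add: polydisc_iff)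
      finally show "norm ((u *s w) $ i) < 1" by (simp add: norm_mult)
    qed
    then obtain F' where F': "(F has_derivative F') (at (u *s w))" "\<And>c v. F' (c *s v) = c * F' v"
      using F by (auto simp: holo_on_def)
    have "((\<lambda>u. u *s w) has_derivative (\<lambda>v. v *s w)) (at u)"
    proof (rule has_derivative_vecI)
      show "((\<lambda>u. (u *s w) $ m) has_derivative (\<lambda>v. (v *s w) $ m)) (at u)" for m
        by (auto intro!: derivative_eq_intros)
    qed
    from diff_chain_at[OF this F'(1)] have "(f has_derivative (\<lambda>v. F' (v *s w))) (at u)" by (simp add: f_def o_def)
    moreover have "(\<lambda>v. F' (v *s w)) = (*) (F' w)" by (auto simp: F'(2) mult.commute)
    ultimately have "(f has_field_derivative F' w) (at u)" by (simp add: has_field_derivative_def)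
    thus "f field_differentiable at u within cball 0 1"
      using field_differentiable_at_within field_differentiable_def by blast
  qed
  from circle_mean_value[OF this] show ?thesis by (simp add: f_def)
qed

text \<open>All coordinates are rotated by the same angle. Rotations preserve the measure, so the
  integral may be averaged over the angle; after exchanging the integrals the average along each
  orbit is F(0).\<close>

lemma polydisc_mean_value:
  fixes F :: "complex ^ 'n::finite \<Rightarrow> complex"
  assumes holo: "holo_on F polydisc" and F: "integrable polydisc_measure F"
  shows "(\<integral>w. F w \<partial>polydisc_measure) = of_real (measure polydisc_measure (polydisc :: (complex ^ 'n) set)) * F 0"
proof -
  let ?M = "polydisc_measure :: (complex ^ 'n) measure"
  define I where "I = restrict_space lborel {0..1::real}"
  define e where "e = (\<lambda>t :: real. exp (2 * pi * \<i> * of_real t))"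
  have ne: "norm (e t) = 1" for t by (simp add: e_def)
  interpret M: finite_measure ?M by (rule finite_polydisc_measure)
  interpret I: finite_measure I
    by (rule finite_measureI) (simp add: I_def space_restrict_space emeasure_restrict_space)
  interpret IM: pair_sigma_finite I ?M ..
  have em: "e \<in> borel_measurable I" unfolding e_def I_def by (intro measurable_restrict_space1) measurable
  have rot: "(\<lambda>(t, w). e t *s w) \<in> measurable (I \<Otimes>\<^sub>M ?M) ?M"
  proof (rule measurable_restrict_space2)
    show "(\<lambda>(t, w). e t *s w) \<in> space (I \<Otimes>\<^sub>M ?M) \<rightarrow> polydisc"
      by (auto simp: space_pair_measure polydisc_iff norm_mult ne)
    have nth: "(\<lambda>z :: complex ^ 'n. z $ i) \<in> borel_measurable ?M" for i
      by (intro borel_measurable_polydiscI) measurable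
    have smult: "(\<lambda>p. fst p *s snd p) \<in> borel_measurable (borel \<Otimes>\<^sub>M (borel :: (complex ^ 'n) measure))"
      unfolding borel_prod
    proof (intro borel_measurable_continuous_onI)
      show "continuous_on UNIV (\<lambda>p :: complex \<times> (complex ^ 'n). fst p *s snd p)"
        unfolding vector_scalar_mult_def by (intro continuous_intros)
    qed
    have pair: "(\<lambda>p. (e (fst p), snd p)) \<in> measurable (I \<Otimes>\<^sub>M ?M) (borel \<Otimes>\<^sub>M borel)"
    proof (rule measurable_Pair)
      show "(\<lambda>p. e (fst p)) \<in> borel_measurable (I \<Otimes>\<^sub>M ?M)" by (rule measurable_compose[OF measurable_fst em])
      have "(\<lambda>w. w) \<in> borel_measurable ?M" by (intro borel_measurable_polydiscI) measurable
      from measurable_compose[OF measurable_snd this] show "snd \<in> borel_measurable (I \<Otimes>\<^sub>M ?M)" .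
    qed
    have "(\<lambda>p. e (fst p) *s snd p) \<in> borel_measurable (I \<Otimes>\<^sub>M ?M)"
      using measurable_compose[OF pair smult] by simp
    thus "(\<lambda>(t, w). e t *s w) \<in> measurable (I \<Otimes>\<^sub>M ?M) lborel" by (simp add: case_prod_unfold)
  qed
  have Fm: "F \<in> borel_measurable ?M" using F by simp
  have Frot: "(\<lambda>(t, w). F (e t *s w)) \<in> borel_measurable (I \<Otimes>\<^sub>M ?M)"
    using measurable_compose[OF rot Fm] by (simp add: case_prod_unfold)
  have r1: "(\<integral>w. G (e t *s w) \<partial>?M) = (\<integral>w. G w \<partial>?M)" if "G \<in> borel_measurable ?M" for G :: "_ \<Rightarrow> 'b::{banach, second_countable_topology}" and t
    using rotate_polydisc[OF ne, of t, where 'n = 'n] that by (metis integral_distr)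
  have r2: "integrable ?M (\<lambda>w. F (e t *s w))" for t
    using rotate_polydisc[OF ne, of t, where 'n = 'n] F Fm by (metis integrable_distr_eq)
  have int: "integrable (I \<Otimes>\<^sub>M ?M) (\<lambda>(t, w). F (e t *s w))"
  proof (rule IM.Fubini_integrable[OF Frot])
    have "(\<lambda>t. \<integral>w. norm (F (e t *s w)) \<partial>?M) = (\<lambda>t. \<integral>w. norm (F w) \<partial>?M)"
      using r1[of "\<lambda>w. norm (F w)"] Fm by auto
    thus "integrable I (\<lambda>t. \<integral>w. norm (case (t, w) of (t, w) \<Rightarrow> F (e t *s w)) \<partial>?M)" by simp
  qed (use r2 in auto)
  have slice: "(\<integral>t. F (e t *s w) \<partial>I) = F 0" if w: "w \<in> polydisc" and i: "integrable I (\<lambda>t. F (e t *s w))" for w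
  proof -
    have hi: "((\<lambda>t. F (e t *s w)) has_integral F 0) {0..1::real}"
      unfolding e_def by (rule holo_on_slice_mean_value[OF holo w])
    have s: "set_integrable lborel {0..1} (\<lambda>t. F (e t *s w))"
      using i unfolding I_def set_integrable_def by (subst (asm) integrable_restrict_space) auto
    have "(\<integral>t. F (e t *s w) \<partial>I) = (LINT t:{0..1}|lborel. F (e t *s w))"
      unfolding I_def set_lebesgue_integral_def by (subst integral_restrict_space) auto
    also have "\<dots> = integral {0..1} (\<lambda>t. F (e t *s w))"
      by (rule set_borel_integral_eq_integral(2)[OF s])
    also have "\<dots> = F 0" using hi by (rule integral_unique)
    finally show ?thesis .
  qed
  have "(\<integral>w. F w \<partial>?M) = (\<integral>t. (\<integral>w. F (e t *s w) \<partial>?M) \<partial>I)"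
    using r1[OF Fm] by (simp add: I_def measure_restrict_space space_restrict_space)
  also have "\<dots> = (\<integral>w. (\<integral>t. F (e t *s w) \<partial>I) \<partial>?M)"
    using IM.Fubini_integral[of "\<lambda>t w. F (e t *s w)"] int by simp
  also have "\<dots> = (\<integral>w. F 0 \<partial>?M)"
  proof (rule integral_cong_AE)
    have "AE w in ?M. integrable I (\<lambda>t. F (e t *s w))"
      using IM.AE_integrable_snd[of "\<lambda>t w. F (e t *s w)"] int by simp
    thus "AE w in ?M. (\<integral>t. F (e t *s w) \<partial>I) = F 0"
      using AE_space by eventually_elim (use slice in auto)
    have "(\<lambda>(w, t). F (e t *s w)) \<in> borel_measurable (?M \<Otimes>\<^sub>M I)"
      using measurable_compose[OF measurable_pair_swap' Frot] by (simp add: case_prod_unfold)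
    from I.borel_measurable_lebesgue_integral[OF this]
    show "(\<lambda>w. \<integral>t. F (e t *s w) \<partial>I) \<in> borel_measurable ?M" by simp
  qed auto
  also have "\<dots> = of_real (measure ?M polydisc) * F 0"
    by (simp add: scaleR_conv_of_real)
  finally show ?thesis .
qed

section \<open>Closure properties of holomorphic functions\<close>

lemma holo_on_cmult_prod:
  fixes F :: "complex ^ 'n::finite \<Rightarrow> complex"
  assumes F: "holo_on F \<Omega>" and G: "holo_on G \<Omega>"
  shows "holo_on (\<lambda>w. F w * G w) \<Omega>"
  unfolding holo_on_def
proof
  fix z assume z: "z \<in> \<Omega>"
  obtain F' where F': "(F has_derivative F') (at z)" "\<And>c v. F' (c *s v) = c * F' v"
    using F z by (auto simp: holo_on_def)
  obtain G' where G': "(G has_derivative G') (at z)" "\<And>c v. G' (c *s v) = c * G' v"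
    using G z by (auto simp: holo_on_def)
  have "((\<lambda>w. F w * G w) has_derivative (\<lambda>v. F z * G' v + F' v * G z)) (at z)"
    by (rule has_derivative_mult[OF F'(1) G'(1)])
  thus "\<exists>f'. ((\<lambda>w. F w * G w) has_derivative f') (at z) \<and> (\<forall>c v. f' (c *s v) = c * f' v)"
    by (intro exI[of _ "\<lambda>v. F z * G' v + F' v * G z"]) (auto simp: F'(2) G'(2) algebra_simps)
qed

lemma holo_on_coord:
  fixes h :: "complex \<Rightarrow> complex"
  assumes "\<And>w. w \<in> \<Omega> \<Longrightarrow> (h has_field_derivative h' (w $ i)) (at (w $ i))"
  shows "holo_on (\<lambda>w :: complex ^ 'n::finite. h (w $ i)) \<Omega>"
  unfolding holo_on_def
proof
  fix w assume w: "w \<in> \<Omega>"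
  have "((\<lambda>w :: complex ^ 'n. w $ i) has_derivative (\<lambda>v. v $ i)) (at w)"
    by (intro bounded_linear_imp_has_derivative bounded_linear_vec_nth)
  from diff_chain_at[OF this assms[OF w, unfolded has_field_derivative_def]]
  have "((\<lambda>w. h (w $ i)) has_derivative (\<lambda>v. h' (w $ i) * v $ i)) (at w)" by (simp add: o_def)
  thus "\<exists>f'. ((\<lambda>w. h (w $ i)) has_derivative f') (at w) \<and> (\<forall>c v. f' (c *s v) = c * f' v)"
    by (intro exI[of _ "\<lambda>v. h' (w $ i) * v $ i"]) auto
qed

lemma holo_on_prod:
  fixes F :: "'i \<Rightarrow> complex ^ 'n::finite \<Rightarrow> complex"
  assumes "finite A" "\<And>i. i \<in> A \<Longrightarrow> holo_on (F i) \<Omega>"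
  shows "holo_on (\<lambda>w. \<Prod>i\<in>A. F i w) \<Omega>"
  using assms
proof (induction A rule: finite_induct)
  case empty
  show ?case unfolding holo_on_def by (auto intro!: exI[of _ "\<lambda>_. 0"])
qed (auto intro!: holo_on_cmult_prod)

lemma holo_on_compose:
  fixes F :: "complex ^ 'n::finite \<Rightarrow> complex" and g :: "complex ^ 'n \<Rightarrow> complex ^ 'n"
  assumes F: "holo_on F \<Omega>" and g: "\<And>w. w \<in> S \<Longrightarrow> (g has_derivative (\<lambda>v. A w *v v)) (at w)" "\<And>w. w \<in> S \<Longrightarrow> g w \<in> \<Omega>"
  shows "holo_on (\<lambda>w. F (g w)) S"
  unfolding holo_on_def
proof
  fix w assume w: "w \<in> S"
  obtain F' where F': "(F has_derivative F') (at (g w))" "\<And>c v. F' (c *s v) = c * F' v"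
    using F g(2)[OF w] by (auto simp: holo_on_def)
  have "((\<lambda>w. F (g w)) has_derivative (\<lambda>v. F' (A w *v v))) (at w)"
    using diff_chain_at[OF g(1)[OF w] F'(1)] by (simp add: o_def)
  moreover have "A w *v (c *s v) = c *s (A w *v v)" for c v
    by (simp add: vec_eq_iff matrix_vector_mult_def sum_distrib_left mult_ac)
  ultimately show "\<exists>f'. ((\<lambda>w. F (g w)) has_derivative f') (at w) \<and> (\<forall>c v. f' (c *s v) = c * f' v)"
    by (intro exI[of _ "\<lambda>v. F' (A w *v v)"]) (auto simp: F'(2))
qed

definition moebius :: "complex \<Rightarrow> complex \<Rightarrow> complex" where
  "moebius a u = (a - u) / (1 - cnj a * u)"

text \<open>The last fact is the essential one: the Jacobian of the substitution cancels the
  antiholomorphic dependence of the kernel and leaves a holomorphic function of u. It follows from 1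
  - a cnj (moebius a u) = (1 - |a|^2) / (1 - a cnj u).\<close>

lemma moebius_facts:
  assumes a: "norm a < 1" and u: "norm u < 1"
  shows "1 - cnj a * u \<noteq> 0" "norm (moebius a u) < 1" "moebius a (moebius a u) = u"
    "(moebius a has_field_derivative ((norm a)\<^sup>2 - 1) / (1 - cnj a * u)\<^sup>2) (at u)"
    "(norm (((norm a)\<^sup>2 - 1) / (1 - cnj a * u)\<^sup>2))\<^sup>2 * (1 / (1 - a * cnj (moebius a u))\<^sup>2) = 1 / (1 - cnj a * u)\<^sup>2"
proof -
  note pos = norm_one_minus_cnj_ge(4)[OF u a]
  show nz: "1 - cnj a * u \<noteq> 0" using pos by (auto simp: mult.commute)
  have na: "1 - (norm a)\<^sup>2 > 0" using a by (simp add: abs_square_less_1)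
  have nac: "complex_of_real (1 - (norm a)\<^sup>2) \<noteq> 0" using na by (metis of_real_eq_0_iff less_irrefl)
  have aa: "cnj a * a = (norm a)\<^sup>2" by (metis complex_norm_square mult.commute)
  have "(norm (1 - cnj a * u))\<^sup>2 - (norm (a - u))\<^sup>2 = (1 - (norm a)\<^sup>2) * (1 - (norm u)\<^sup>2)"
    unfolding cmod_power2 by (simp add: power2_eq_square algebra_simps)
  moreover have "\<dots> > 0" using na u by (intro mult_pos_pos) (auto simp: abs_square_less_1)
  ultimately have "(norm (a - u))\<^sup>2 < (norm (1 - cnj a * u))\<^sup>2" by linarith
  hence "norm (a - u) < norm (1 - cnj a * u)" by (rule power_less_imp_less_base) simp
  thus "norm (moebius a u) < 1" using nz by (simp add: moebius_def norm_divide divide_simps)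
  have "1 - cnj a * moebius a u = (1 - (norm a)\<^sup>2) / (1 - cnj a * u)"
    using nz aa by (simp add: moebius_def field_simps)
  moreover have "a - moebius a u = u * ((1 - (norm a)\<^sup>2) / (1 - cnj a * u))"
    using nz aa by (simp add: moebius_def field_simps)
  ultimately show "moebius a (moebius a u) = u"
    using nz nac unfolding moebius_def[of a "moebius a u"] by simp
  have "(moebius a has_field_derivative ((- 1) * (1 - cnj a * u) - (a - u) * (- cnj a)) / ((1 - cnj a * u) * (1 - cnj a * u))) (at u)"
    unfolding moebius_def[abs_def] using nz by (auto intro!: derivative_eq_intros)
  also have "(- 1) * (1 - cnj a * u) - (a - u) * (- cnj a) = (norm a)\<^sup>2 - 1"
    using aa by (simp add: algebra_simps)
  finally show "(moebius a has_field_derivative ((norm a)\<^sup>2 - 1) / (1 - cnj a * u)\<^sup>2) (at u)"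
    by (simp add: power2_eq_square)
  define r where "r = 1 - (norm a)\<^sup>2"
  define q where "q = 1 - cnj a * u"
  have cq: "cnj q \<noteq> 0" using nz by (simp add: q_def del: complex_cnj_diff)
  have "1 - a * cnj (moebius a u) = of_real r / cnj q"
  proof -
    have "1 - a * cnj (moebius a u) = (cnj q - a * cnj (a - u)) / cnj q"
    proof -
      have gen: "1 - a * (X / Q) = (Q - a * X) / Q" if "Q \<noteq> 0" for X Q :: complex using that by (simp add: field_simps)
      have "cnj (moebius a u) = cnj (a - u) / cnj q" unfolding moebius_def q_def by (rule complex_cnj_divide)
      thus ?thesis using gen[OF cq, of "cnj (a - u)"] by (simp only:)
    qed
    also have "cnj q - a * cnj (a - u) = of_real r" using aa by (simp add: q_def r_def algebra_simps)
    finally show ?thesis .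
  qed
  moreover have "norm (((norm a)\<^sup>2 - 1) / (1 - cnj a * u)\<^sup>2) = r / (norm q)\<^sup>2"
  proof -
    have "norm ((complex_of_real ((norm a)\<^sup>2 - 1))) = r" using na unfolding norm_of_real r_def by simp
    thus ?thesis by (simp add: norm_divide norm_power q_def)
  qed
  hence "complex_of_real ((norm (((norm a)\<^sup>2 - 1) / (1 - cnj a * u)\<^sup>2))\<^sup>2) = (of_real r / (q * cnj q))\<^sup>2"
    by (simp add: complex_norm_square[symmetric])
  ultimately show "(norm (((norm a)\<^sup>2 - 1) / (1 - cnj a * u)\<^sup>2))\<^sup>2 * (1 / (1 - a * cnj (moebius a u))\<^sup>2) = 1 / (1 - cnj a * u)\<^sup>2"
    using nac nz cq by (simp add: q_def[symmetric] r_def[symmetric] power_divide power_mult_distrib)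
qed

lemma poly_kernel_bound:
  assumes z: "z \<in> polydisc" and w: "w \<in> polydisc"
  shows "norm (poly_kernel z w) \<le> (\<Prod>i\<in>UNIV. (1 - norm (z $ i)) powr (-2))"
  unfolding norm_poly_kernel
proof (intro prod_mono conjI)
  fix i
  have "norm (z $ i) < 1" "norm (w $ i) < 1" using z w by (auto simp: polydisc_iff)
  thus "norm (1 - z $ i * cnj (w $ i)) powr (-2) \<le> (1 - norm (z $ i)) powr (-2)"
    by (intro powr_mono2' norm_one_minus_cnj_ge) auto
qed auto

lemma poly_kernel_measurable: "(\<lambda>w. poly_kernel z w) \<in> borel_measurable borel"
  unfolding poly_kernel_def by measurable

lemma integrable_poly_kernel:
  assumes z: "z \<in> polydisc" and f: "integrable polydisc_measure f"
  shows "integrable polydisc_measure (\<lambda>w. poly_kernel z w * f w)"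
proof (rule Bochner_Integration.integrable_bound[where f = "\<lambda>w. (\<Prod>i\<in>UNIV. (1 - norm (z $ i)) powr (-2)) * norm (f w)"])
  show "integrable polydisc_measure (\<lambda>w. (\<Prod>i\<in>UNIV. (1 - norm (z $ i)) powr (-2)) * norm (f w))"
    using f by auto
  show "(\<lambda>w. poly_kernel z w * f w) \<in> borel_measurable polydisc_measure"
    using f borel_measurable_polydiscI[OF poly_kernel_measurable] by (intro borel_measurable_times) auto
  show "AE w in polydisc_measure. norm (poly_kernel z w * f w) \<le> norm ((\<Prod>i\<in>UNIV. (1 - norm (z $ i)) powr (-2)) * norm (f w))"
    using poly_kernel_bound[OF z] by (intro AE_I2) (auto simp: norm_mult abs_mult prod_nonneg intro!: mult_right_mono order_trans[OF _ abs_ge_self])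
qed

text \<open>Substitute w = g(u) with the product of Moebius involutions exchanging 0 and z_i. The
  integrand becomes holomorphic in u, and its mean value is its value at u = 0, where the kernel
  factor is 1 and g(0) = z.\<close>

theorem poly_kernel_reproducing:
  fixes \<psi> :: "complex ^ 'n::finite \<Rightarrow> complex"
  assumes holo: "holo_on \<psi> polydisc" and int: "integrable polydisc_measure \<psi>" and z: "z \<in> polydisc"
  shows "(\<integral>w. poly_kernel z w * \<psi> w \<partial>polydisc_measure) = of_real (measure polydisc_measure (polydisc :: (complex ^ 'n) set)) * \<psi> z"
proof -
  let ?M = "polydisc_measure :: (complex ^ 'n) measure"
  define g where "g = (\<lambda>u :: complex ^ 'n. \<chi> i. moebius (z $ i) (u $ i))"
  define c where "c = (\<lambda>(u :: complex ^ 'n) i. complex_of_real ((norm (z $ i))\<^sup>2 - 1) / (1 - cnj (z $ i) * u $ i)\<^sup>2)"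
  define d where "d = (\<lambda>u. \<Prod>i\<in>UNIV. (norm (c u i))\<^sup>2)"
  define G where "G = (\<lambda>w. poly_kernel z w * \<psi> w)"
  define F where "F = (\<lambda>u. (\<Prod>i\<in>UNIV. 1 / (1 - cnj (z $ i) * u $ i)\<^sup>2) * \<psi> (g u))"
  have zi: "norm (z $ i) < 1" for i using z by (simp add: polydisc_iff)
  have ui: "norm (u $ i) < 1" if "u \<in> polydisc" for u :: "complex ^ 'n" and i using that by (simp add: polydisc_iff)
  note mf = moebius_facts[OF zi ui]
  have gp: "g u \<in> polydisc" if "u \<in> polydisc" for u
    unfolding polydisc_iff using mf(2)[OF that] by (simp add: g_def)
  have gg: "g (g u) = u" if "u \<in> polydisc" for u
    using mf(3)[OF that] by (simp add: g_def vec_eq_iff)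
  have bij: "bij_betw g polydisc polydisc"
    by (rule bij_betw_byWitness[where f' = g]) (use gp gg in auto)
  have der: "((\<lambda>w. g w $ i) has_derivative (\<lambda>v. c w i * v $ i)) (at w)" if w: "w \<in> polydisc" for w i
  proof -
    have "((\<lambda>w :: complex ^ 'n. w $ i) has_derivative (\<lambda>v. v $ i)) (at w)"
      by (intro bounded_linear_imp_has_derivative bounded_linear_vec_nth)
    from diff_chain_at[OF this mf(4)[OF w, unfolded has_field_derivative_def]]
    show ?thesis by (simp add: o_def g_def c_def)
  qed
  have dm: "d \<in> borel_measurable borel" unfolding d_def c_def by measurable
  note cov = bij_betw_polydisc_change[OF bij der dm d_def[THEN fun_cong]]
  have Gi: "integrable ?M G" unfolding G_def by (rule integrable_poly_kernel[OF z int])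
  hence Gm: "G \<in> borel_measurable ?M" by simp
  have gd: "g \<in> measurable (density ?M (\<lambda>w. ennreal (d w))) ?M" using cov(2) by simp
  have d0: "d u \<ge> 0" for u unfolding d_def by (intro prod_nonneg) auto
  have Ggm: "(\<lambda>u. G (g u)) \<in> borel_measurable ?M" by (rule measurable_compose[OF cov(2) Gm])
  have dm': "d \<in> borel_measurable ?M" by (rule borel_measurable_polydiscI[OF dm])
  have eq: "d u *\<^sub>R G (g u) = F u" if u: "u \<in> polydisc" for u
  proof -
    have "d u *\<^sub>R G (g u) = (\<Prod>i\<in>UNIV. complex_of_real ((norm (c u i))\<^sup>2)) * (\<Prod>i\<in>UNIV. 1 / (1 - z $ i * cnj (g u $ i))\<^sup>2) * \<psi> (g u)"
      by (simp add: G_def poly_kernel_def scaleR_conv_of_real d_def mult.assoc)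
    also have "(\<Prod>i\<in>UNIV. complex_of_real ((norm (c u i))\<^sup>2)) * (\<Prod>i\<in>UNIV. 1 / (1 - z $ i * cnj (g u $ i))\<^sup>2)
       = (\<Prod>i\<in>UNIV. 1 / (1 - cnj (z $ i) * u $ i)\<^sup>2)"
      unfolding prod.distrib[symmetric] c_def g_def using mf(5)[OF u] by (intro prod.cong refl) (simp only: vec_lambda_beta)
    finally show ?thesis by (simp add: F_def)
  qed
  have "integrable (distr (density ?M (\<lambda>w. ennreal (d w))) ?M g) G" using Gi cov(1) by simp
  hence "integrable (density ?M (\<lambda>w. ennreal (d w))) (\<lambda>u. G (g u))"
    by (subst (asm) integrable_distr_eq[OF gd Gm])
  hence "integrable ?M (\<lambda>u. d u *\<^sub>R G (g u))"
    by (subst (asm) integrable_density) (use Ggm dm' d0 in auto)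
  hence Fi: "integrable ?M F"
    by (subst (asm) Bochner_Integration.integrable_cong[OF refl, of _ _ F]) (auto simp: eq)
  have "(\<integral>w. G w \<partial>?M) = (\<integral>w. G w \<partial>distr (density ?M (\<lambda>w. ennreal (d w))) ?M g)" using cov(1) by simp
  also have "\<dots> = (\<integral>u. G (g u) \<partial>density ?M (\<lambda>w. ennreal (d w)))" by (rule integral_distr[OF gd Gm])
  also have "\<dots> = (\<integral>u. d u *\<^sub>R G (g u) \<partial>?M)"
    by (rule integral_density) (use Ggm dm' d0 in auto)
  also have "\<dots> = (\<integral>u. F u \<partial>?M)" by (intro Bochner_Integration.integral_cong refl) (auto simp: eq)
  also have "\<dots> = of_real (measure ?M polydisc) * F 0"
  proof (rule polydisc_mean_value[OF _ Fi])
    have h1: "holo_on (\<lambda>w :: complex ^ 'n. 1 / (1 - cnj (z $ i) * w $ i)\<^sup>2) polydisc" for i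
    proof (rule holo_on_coord)
      fix w :: "complex ^ 'n" assume w: "w \<in> polydisc"
      show "((\<lambda>u. 1 / (1 - cnj (z $ i) * u)\<^sup>2) has_field_derivative 
         (\<lambda>u. 2 * cnj (z $ i) * (1 - cnj (z $ i) * u) / ((1 - cnj (z $ i) * u)\<^sup>2 * (1 - cnj (z $ i) * u)\<^sup>2)) (w $ i)) (at (w $ i))"
        using mf(1)[OF w, of i] by (auto intro!: derivative_eq_intros)
    qed
    have "(g has_derivative (\<lambda>v. (\<chi> i j. if i = j then c w i else 0) *v v)) (at w)" if "w \<in> polydisc" for w
    proof (rule has_derivative_vecI)
      fix m
      have "(\<lambda>v. ((\<chi> i j. if i = j then c w i else 0) *v v) $ m) = (\<lambda>v. c w m * v $ m)"
        by (simp add: matrix_vector_mult_def if_distrib[of "\<lambda>t. t * _"] fun_eq_iff cong: if_cong)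
      thus "((\<lambda>x. g x $ m) has_derivative (\<lambda>v. ((\<chi> i j. if i = j then c w i else 0) *v v) $ m)) (at w)"
        using der[OF that, of m] by simp
    qed
    hence "holo_on (\<lambda>u. \<psi> (g u)) polydisc" by (rule holo_on_compose[OF holo]) (use gp in auto)
    thus "holo_on F polydisc" unfolding F_def by (intro holo_on_cmult_prod holo_on_prod h1) auto
  qed
  also have "F 0 = \<psi> z" by (simp add: F_def g_def moebius_def)
  finally show ?thesis by (simp add: G_def)
qed

section \<open>Lebesgue measure on the symmetrized polydisc\<close>

lemma lborel_permute_coords:
  fixes p :: "'n::finite \<Rightarrow> 'n"
  assumes p: "bij p"
  shows "distr lborel borel (\<lambda>w. \<chi> i. w $ p i) = (lborel :: (complex ^ 'n) measure)"
proof (rule lborel_distr_basis)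
  show "linear (\<lambda>w :: complex ^ 'n. \<chi> i. w $ p i)" by (rule linearI) (auto simp: vec_eq_iff)
  have ax: "(\<chi> i. axis (p j) b $ p i) = axis j b" for j and b :: complex
    using p by (auto simp: axis_def vec_eq_iff bij_def inj_eq)
  show "bij_betw (\<lambda>w :: complex ^ 'n. \<chi> i. w $ p i) Basis Basis"
  proof (rule bij_betw_imageI)
    show "inj_on (\<lambda>w :: complex ^ 'n. \<chi> i. w $ p i) Basis"
    proof (rule inj_onI)
      fix x y :: "complex ^ 'n" assume "(\<chi> i. x $ p i) = (\<chi> i. y $ p i)"
      hence "x $ p i = y $ p i" for i by (simp add: vec_eq_iff)
      hence "x $ i = y $ i" for i using bij_is_surj[OF p] by (metis surjD)
      thus "x = y" by (simp add: vec_eq_iff)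
    qed
    have B: "(Basis :: (complex ^ 'n) set) = (\<lambda>(i, b). axis i b) ` (UNIV \<times> Basis)" by (auto simp: Basis_vec_def)
    have B': "(Basis :: (complex ^ 'n) set) = (\<lambda>(i, b). axis (p i) b) ` (UNIV \<times> Basis)"
    proof -
      have "(\<lambda>(i, b). axis (p i) b) ` (UNIV \<times> Basis) = (\<lambda>(i, b). axis i b :: complex ^ 'n) ` (map_prod p id ` (UNIV \<times> Basis))"
        unfolding image_image by (intro image_cong) auto
      also have "map_prod p id ` (UNIV \<times> Basis) = UNIV \<times> (Basis :: complex set)"
        using bij_is_surj[OF p] by (simp add: map_prod_surj_on)
      finally show ?thesis by (simp add: B)
    qed
    have "(\<lambda>w :: complex ^ 'n. \<chi> i. w $ p i) ` Basis = (\<lambda>(i, b). axis i b) ` (UNIV \<times> Basis)"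
      unfolding B' image_image using ax by (intro image_cong) auto
    thus "(\<lambda>w :: complex ^ 'n. \<chi> i. w $ p i) ` Basis = Basis" using B by simp
  qed
qed

lemma permute_coords_measurable: "(\<lambda>w :: complex ^ 'n::finite. \<chi> i. w $ p i) \<in> borel_measurable borel"
  by (intro borel_measurable_continuous_onI continuous_intros)

section \<open>A fundamental domain for coordinate permutations\<close>

definition sorted_domain :: "('n::finite \<Rightarrow> nat) \<Rightarrow> (complex ^ 'n) set" where
  "sorted_domain \<iota> = {w \<in> polydisc. \<forall>i j. \<iota> i < \<iota> j \<longrightarrow> Re (w $ i) < Re (w $ j)}"

lemma open_sorted_domain: "open (sorted_domain \<iota>)"
proof -
  have "sorted_domain \<iota> = polydisc \<inter> (\<Inter>i. \<Inter>j. {w. \<iota> i < \<iota> j \<longrightarrow> Re (w $ i) < Re (w $ j)})"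
    by (auto simp: sorted_domain_def)
  also have "open \<dots>"
  proof (intro open_Int open_polydisc open_INT ballI finite)
    fix i j
    show "open {w :: complex ^ 'a. \<iota> i < \<iota> j \<longrightarrow> Re (w $ i) < Re (w $ j)}"
      by (cases "\<iota> i < \<iota> j") (auto intro!: open_Collect_less continuous_intros)
  qed
  finally show ?thesis .
qed

context
  fixes \<iota> :: "'n::finite \<Rightarrow> nat"
  assumes \<iota>: "bij_betw \<iota> UNIV {1..CARD('n)}"
begin

lemma index_inj: "inj \<iota>" using \<iota> by (simp add: bij_betw_def)

lemma index_range: "1 \<le> \<iota> m" "\<iota> m \<le> CARD('n)" using \<iota> by (auto simp: bij_betw_def)

lemma sorted_less_iff:
  assumes "v \<in> sorted_domain \<iota>"
  shows "Re (v $ i) < Re (v $ j) \<longleftrightarrow> \<iota> i < \<iota> j"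
proof
  assume l: "Re (v $ i) < Re (v $ j)"
  show "\<iota> i < \<iota> j"
  proof (rule ccontr)
    assume "\<not> \<iota> i < \<iota> j"
    hence "\<iota> j < \<iota> i \<or> i = j" using index_inj by (auto simp: inj_eq not_less order.order_iff_strict)
    thus False using l assms by (auto simp: sorted_domain_def dest: less_trans)
  qed
qed (use assms in \<open>auto simp: sorted_domain_def\<close>)

lemma card_index_less: "card {k. \<iota> k < \<iota> i} = \<iota> i - 1"
proof -
  have "\<iota> ` {k. \<iota> k < \<iota> i} = {1..<\<iota> i}"
  proof (intro set_eqI iffI)
    fix x assume x: "x \<in> {1..<\<iota> i}"
    hence "x \<in> {1..CARD('n)}" using index_range[of i] by auto
    hence "x \<in> range \<iota>" using \<iota> by (simp add: bij_betw_def)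
    thus "x \<in> \<iota> ` {k. \<iota> k < \<iota> i}" using x by auto
  qed (use index_range in auto)
  moreover have "card (\<iota> ` {k. \<iota> k < \<iota> i}) = card {k. \<iota> k < \<iota> i}"
    by (rule card_image) (rule inj_on_subset[OF index_inj], simp)
  ultimately show ?thesis by simp
qed

lemma esym_eq_of_sym_map:
  assumes "sym_map \<iota> v = sym_map \<iota> w" "k \<le> CARD('n)"
  shows "esym k v = esym k w"
proof (cases "k = 0")
  case False
  hence "k \<in> range \<iota>" using \<iota> assms(2) by (auto simp: bij_betw_def)
  then obtain j where "k = \<iota> j" by auto
  thus ?thesis using assms(1) by (auto simp: sym_map_def vec_eq_iff)
qed (simp add: esym_eq_esym_on)

text \<open>By Vieta the two vectors are the roots of the same polynomial. Only the sets of roots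
  are compared, which is enough on the sorted domain, where coordinates are distinct.\<close>

lemma sym_map_range_eq:
  assumes "sym_map \<iota> v = sym_map \<iota> w"
  shows "range (($) v) \<subseteq> range (($) w)"
proof
  fix x assume "x \<in> range (($) v)"
  then obtain i where i: "x = v $ i" by auto
  have "(\<Prod>i\<in>UNIV. x + (-1) * v $ i) = (\<Prod>i\<in>UNIV. x + (-1) * w $ i)"
    unfolding prod_add_eq_esym_on
    by (intro sum.cong refl) (use esym_eq_of_sym_map[OF assms] in \<open>auto simp: esym_eq_esym_on\<close>)
  moreover have "(\<Prod>i\<in>UNIV. x + (-1) * v $ i) = 0" by (rule prod_zero) (auto simp: i)
  ultimately have "(\<Prod>i\<in>UNIV. x + (-1) * w $ i) = 0" by simp
  thus "x \<in> range (($) w)" by auto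
qed

text \<open>For a sorted vector the number of coordinate values with real part below that of
  coordinate i is \<iota> i - 1. So the set of values already determines the position of each
  value.\<close>

lemma inj_on_sym_map: "inj_on (sym_map \<iota>) (sorted_domain \<iota>)"
proof (rule inj_onI)
  fix v w assume v: "v \<in> sorted_domain \<iota>" and w: "w \<in> sorted_domain \<iota>" and eq: "sym_map \<iota> v = sym_map \<iota> w"
  have R: "range (($) v) = range (($) w)" using sym_map_range_eq[OF eq] sym_map_range_eq[OF eq[symmetric]] by auto
  have card: "card {x \<in> range (($) u). Re x < Re (u $ i)} = \<iota> i - 1" if u: "u \<in> sorted_domain \<iota>" for u i
  proof -
    have "{x \<in> range (($) u). Re x < Re (u $ i)} = ($) u ` {k. \<iota> k < \<iota> i}"
      using sorted_less_iff[OF u] by auto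
    moreover have "inj (($) u)"
    proof (rule injI)
      fix k l assume "u $ k = u $ l"
      hence "\<not> \<iota> k < \<iota> l" "\<not> \<iota> l < \<iota> k" using sorted_less_iff[OF u, of k l] sorted_less_iff[OF u, of l k] by auto
      thus "k = l" using index_inj by (simp add: inj_eq)
    qed
    ultimately show ?thesis using card_index_less[of i] card_image[of "($) u" "{k. \<iota> k < \<iota> i}"]
      by (simp add: inj_on_subset[OF \<open>inj (($) u)\<close>])
  qed
  have "v $ i = w $ i" for i
  proof -
    obtain j where j: "v $ i = w $ j" using R by (metis rangeE rangeI)
    have "\<iota> i - 1 = \<iota> j - 1" using card[OF v, of i] card[OF w, of j] R j by simp
    hence "\<iota> i = \<iota> j" using index_range[of i] index_range[of j] by simp
    thus ?thesis using j index_inj by (simp add: inj_eq)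
  qed
  thus "v = w" by (simp add: vec_eq_iff)
qed

text \<open>The rank of a coordinate counts the smaller real parts, plus 1 to match the range of
  \<iota>. Sorting means that the permutation sends i to the index of rank \<iota> i, which gives
  existence and uniqueness at once.\<close>

lemma ex1_sorting_permutation:
  assumes w: "w \<in> polydisc" and inj: "inj (\<lambda>i. Re (w $ i))"
  shows "\<exists>!p. p permutes UNIV \<and> (\<chi> i. w $ p i) \<in> sorted_domain \<iota>"
proof -
  define rank where "rank = (\<lambda>i. card {j. Re (w $ j) < Re (w $ i)} + 1)"
  have rank_less: "rank i < rank j" if "Re (w $ i) < Re (w $ j)" for i j
    unfolding rank_def using that by (intro add_strict_right_mono psubset_card_mono) auto
  have rank_iff: "rank i < rank j \<longleftrightarrow> Re (w $ i) < Re (w $ j)" for i j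
  proof (cases "Re (w $ i)" "Re (w $ j)" rule: linorder_cases)
    case equal
    hence "i = j" using inj by (auto dest: injD)
    thus ?thesis by simp
  qed (use rank_less[of i j] rank_less[of j i] in auto)
  have rank_inj: "inj rank"
  proof (rule injI)
    fix i j assume "rank i = rank j"
    hence "Re (w $ i) = Re (w $ j)" using rank_less[of i j] rank_less[of j i] by (cases "Re (w $ i)" "Re (w $ j)" rule: linorder_cases) auto
    thus "i = j" using inj by (auto dest: injD)
  qed
  have rank_range: "rank i \<in> {1..CARD('n)}" for i
  proof -
    have "card {j. Re (w $ j) < Re (w $ i)} < CARD('n)" by (intro psubset_card_mono) auto
    thus ?thesis by (simp add: rank_def)
  qed
  have bij: "bij_betw rank UNIV {1..CARD('n)}"
    by (rule bij_betw_imageI[OF rank_inj], rule card_subset_eq) (use rank_range in \<open>auto simp: card_image[OF rank_inj]\<close>)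
  define p where "p = inv_into UNIV rank \<circ> \<iota>"
  have rp: "rank (p i) = \<iota> i" for i
    using bij index_range[of i] by (auto simp: p_def bij_betw_def intro!: f_inv_into_f)
  have "inj p" by (rule injI) (metis rp index_inj injD)
  hence "bij p" by (simp add: bij_def finite_UNIV_inj_surj)
  hence pp: "p permutes UNIV" by (intro bij_imp_permutes) auto
  have "(\<chi> i. w $ p i) \<in> sorted_domain \<iota>"
    using w rank_iff[of "p _" "p _"] by (auto simp: sorted_domain_def polydisc_iff rp)
  moreover have "q = p" if q: "q permutes UNIV" and s: "(\<chi> i. w $ q i) \<in> sorted_domain \<iota>" for q
  proof
    fix i
    have b: "bij q" using q by (simp add: permutes_bij)
    have "{j. Re (w $ j) < Re (w $ q i)} = q ` {k. \<iota> k < \<iota> i}"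
    proof (intro set_eqI iffI)
      fix j assume j: "j \<in> {j. Re (w $ j) < Re (w $ q i)}"
      obtain k where k: "j = q k" using bij_is_surj[OF b] by (metis surjD)
      thus "j \<in> q ` {k. \<iota> k < \<iota> i}" using j sorted_less_iff[OF s, of k i] by auto
    qed (use sorted_less_iff[OF s, of _ i] in auto)
    hence "rank (q i) = card {k. \<iota> k < \<iota> i} + 1"
      unfolding rank_def by (simp add: card_image inj_on_subset[OF bij_is_inj[OF b]])
    also have "\<dots> = \<iota> i" using index_range[of i] by (simp add: card_index_less)
    finally have "rank (q i) = rank (p i)" by (simp add: rp)
    thus "q i = p i" using rank_inj by (auto dest: injD)
  qed
  ultimately show ?thesis using pp by blast
qed

text \<open>Almost every point of the polydisc is sorted by exactly one permutation, so the
  indicator of the polydisc is almost everywhere the sum of the permuted indicators of the sorted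
  domain. Each of the n! terms has the same integral.\<close>

lemma nn_integral_sorted_domain:
  assumes H: "H \<in> borel_measurable borel" and sym: "\<And>p w. p permutes UNIV \<Longrightarrow> H (\<chi> i. w $ p i) = H w"
  shows "(\<integral>\<^sup>+w. indicator polydisc w * H w \<partial>lborel) = of_nat (fact CARD('n)) * (\<integral>\<^sup>+w. indicator (sorted_domain \<iota>) w * H w \<partial>lborel)"
proof -
  let ?P = "{p. p permutes (UNIV :: 'n set)}"
  let ?S = "sorted_domain \<iota>"
  have Sb: "?S \<in> sets borel" using open_sorted_domain[of \<iota>] by simp
  have HS: "(\<lambda>w. indicator ?S w * H w) \<in> borel_measurable borel" using H Sb by measurable
  have "(\<integral>\<^sup>+w. indicator polydisc w * H w \<partial>lborel) = (\<integral>\<^sup>+w. (\<Sum>p\<in>?P. indicator ?S (\<chi> i. w $ p i) * H (\<chi> i. w $ p i)) \<partial>lborel)"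
  proof (rule nn_integral_cong_AE)
    show "AE w in lborel. indicator polydisc w * H w = (\<Sum>p\<in>?P. indicator ?S (\<chi> i. w $ p i) * H (\<chi> i. w $ p i))"
      using AE_distinct_coords
    proof eventually_elim
      case (elim w)
      have "(\<Sum>p\<in>?P. indicator ?S (\<chi> i. w $ p i) * H (\<chi> i. w $ p i)) = (\<Sum>p\<in>?P. indicator ?S (\<chi> i. w $ p i) * H w)"
        by (intro sum.cong refl) (simp add: sym)
      also have "\<dots> = indicator polydisc w * H w"
      proof (cases "w \<in> polydisc")
        case True
        from ex1_sorting_permutation[OF True elim] obtain p where p: "p permutes UNIV" "(\<chi> i. w $ p i) \<in> ?S"
          and u: "\<And>q. q permutes UNIV \<Longrightarrow> (\<chi> i. w $ q i) \<in> ?S \<Longrightarrow> q = p" by blast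
        have z: "indicator ?S (\<chi> i. w $ q i) * H w = 0" if "q \<in> ?P - {p}" for q
          using u[of q] that by (auto simp: indicator_def)
        have "(\<Sum>q\<in>?P. indicator ?S (\<chi> i. w $ q i) * H w) = (\<Sum>q\<in>{p}. indicator ?S (\<chi> i. w $ q i) * H w)"
        proof (rule sum.mono_neutral_right)
          show "\<forall>q\<in>?P - {p}. indicator ?S (\<chi> i. w $ q i) * H w = 0" using z by blast
        qed (use p(1) in \<open>auto simp: finite_permutations\<close>)
        thus ?thesis using p True by simp
      next
        case False
        have "(\<chi> i. w $ p i) \<notin> ?S" if "p permutes UNIV" for p
        proof
          assume "(\<chi> i. w $ p i) \<in> ?S"
          hence "norm (w $ p i) < 1" for i by (simp add: sorted_domain_def polydisc_iff)
          hence "w \<in> polydisc" unfolding polydisc_iff using permutes_surj[OF that] by (metis surjD)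
          with False show False ..
        qed
        thus ?thesis using False by (simp add: indicator_def)
      qed
      finally show ?case ..
    qed
  qed
  also have "\<dots> = (\<Sum>p\<in>?P. \<integral>\<^sup>+w. indicator ?S (\<chi> i. w $ p i) * H (\<chi> i. w $ p i) \<partial>lborel)"
    using measurable_compose[OF permute_coords_measurable HS] by (intro nn_integral_sum) simp
  also have "\<dots> = (\<Sum>p\<in>?P. \<integral>\<^sup>+w. indicator ?S w * H w \<partial>lborel)"
  proof (intro sum.cong refl)
    fix p assume "p \<in> ?P"
    hence b: "bij p" by (simp add: permutes_bij)
    have "(\<integral>\<^sup>+w. indicator ?S w * H w \<partial>lborel) = (\<integral>\<^sup>+w. indicator ?S w * H w \<partial>distr lborel borel (\<lambda>w. \<chi> i. w $ p i))"
      by (simp only: lborel_permute_coords[OF b])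
    also have "\<dots> = (\<integral>\<^sup>+w. indicator ?S (\<chi> i. w $ p i) * H (\<chi> i. w $ p i) \<partial>lborel)"
      using permute_coords_measurable HS by (intro nn_integral_distr) auto
    finally show "(\<integral>\<^sup>+w. indicator ?S (\<chi> i. w $ p i) * H (\<chi> i. w $ p i) \<partial>lborel) = (\<integral>\<^sup>+w. indicator ?S w * H w \<partial>lborel)" ..
  qed
  also have "\<dots> = of_nat (fact CARD('n)) * (\<integral>\<^sup>+w. indicator ?S w * H w \<partial>lborel)"
    by (simp add: card_permutations)
  finally show ?thesis .
qed

lemma continuous_sym_map: "continuous_on UNIV (sym_map \<iota>)"
  by (intro continuous_at_imp_continuous_on ballI has_derivative_continuous[OF has_derivative_sym_map] index_range)

lemma symm_polydisk_borel: "symm_polydisk \<iota> \<in> sets borel"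
  unfolding symm_polydisk_eq
  by (rule borel_image_of_open[OF open_polydisc continuous_on_subset[OF continuous_sym_map]]) simp

lemma bounded_symm_polydisk: "bounded (symm_polydisk \<iota>)"
proof -
  have "compact (sym_map \<iota> ` {w. \<forall>i. w $ i \<in> cball 0 1})"
  proof (intro compact_continuous_image continuous_on_subset[OF continuous_sym_map])
    have "bounded {w :: complex ^ 'n. \<forall>i. w $ i \<in> cball 0 1}"
    proof (rule boundedI)
      fix w :: "complex ^ 'n" assume w: "w \<in> {w. \<forall>i. w $ i \<in> cball 0 1}"
      have "norm w \<le> (\<Sum>i\<in>UNIV. norm (w $ i))" by (simp add: norm_vec_def L2_set_le_sum)
      also have "\<dots> \<le> (\<Sum>i\<in>(UNIV::'n set). 1)" using w by (intro sum_mono) auto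
      finally show "norm w \<le> (\<Sum>i\<in>(UNIV::'n set). 1)" .
    qed
    moreover have "{w :: complex ^ 'n. \<forall>i. w $ i \<in> cball 0 1} = (\<Inter>i. (\<lambda>w. w $ i) -` cball 0 1)" by auto
    moreover have "closed \<dots>" by (intro closed_INT ballI closed_vimage continuous_intros) auto
    ultimately show "compact {w :: complex ^ 'n. \<forall>i. w $ i \<in> cball 0 1}" by (simp add: compact_eq_bounded_closed)
  qed simp
  from compact_imp_bounded[OF this] show ?thesis
    by (rule bounded_subset) (auto simp: symm_polydisk_eq polydisc_def less_imp_le)
qed

lemma vdm_measurable: "vdm \<iota> \<in> borel_measurable borel"
proof -
  have "(\<lambda>w. esym_on A k w) \<in> borel_measurable borel" for A k unfolding esym_on_def by measurable
  thus ?thesis unfolding vdm_def[abs_def] det_def sym_jac_def vec_lambda_beta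
    by (intro borel_measurable_sum borel_measurable_times borel_measurable_prod borel_measurable_const)
qed

text \<open>Vectors with a coincidence of real parts form a null set, and differentiable images of
  null sets are null. Any other preimage can be sorted without changing its symmetric
  coordinates.\<close>

lemma AE_symm_polydisk_sorted:
  "AE s in lborel. s \<in> symm_polydisk \<iota> \<longleftrightarrow> s \<in> sym_map \<iota> ` sorted_domain \<iota>"
proof -
  let ?N = "{w :: complex ^ 'n. \<not> inj (\<lambda>i. Re (w $ i))}"
  have "?N = (\<Union>p\<in>{p. fst p \<noteq> snd p}. {w. Re (w $ fst p) = Re (w $ snd p)})"
    by (auto simp: inj_def) blast
  also have "\<dots> \<in> sets borel"
    by (intro sets.finite_UN borel_closed closed_Collect_eq continuous_intros) auto
  finally have Nb: "?N \<in> sets borel" .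
  hence "?N \<in> null_sets lborel" using AE_iff_null_sets[of ?N lborel] AE_distinct_coords[where 'n = 'n] by simp
  hence "negligible ?N" by (simp add: negligible_iff_null_sets null_sets_completionI)
  moreover have "sym_map \<iota> differentiable_on ?N"
    unfolding differentiable_on_def differentiable_def
    by (intro ballI exI) (rule has_derivative_at_withinI[OF has_derivative_sym_map], rule index_range(1))
  ultimately have "negligible (sym_map \<iota> ` ?N)"
    by (intro negligible_differentiable_image_negligible) auto
  hence "AE s in lebesgue. s \<notin> sym_map \<iota> ` ?N"
    by (intro AE_not_in) (simp add: negligible_iff_null_sets)
  hence "AE s in lborel. s \<notin> sym_map \<iota> ` ?N" by (simp add: AE_completion_iff)
  thus ?thesis
  proof eventually_elim
    case (elim s)
    have "s \<in> sym_map \<iota> ` sorted_domain \<iota>" if s: "s \<in> symm_polydisk \<iota>"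
    proof -
      obtain w where w: "w \<in> polydisc" "s = sym_map \<iota> w" using s by (auto simp: symm_polydisk_eq)
      hence "inj (\<lambda>i. Re (w $ i))" using elim by auto
      from ex1_sorting_permutation[OF w(1) this] obtain p where p: "p permutes UNIV" "(\<chi> i. w $ p i) \<in> sorted_domain \<iota>" by blast
      have "s = sym_map \<iota> (\<chi> i. w $ p i)" using p(1) w(2) by (simp add: sym_map_permute permutes_bij)
      thus ?thesis using p(2) by blast
    qed
    thus ?case by (auto simp: symm_polydisk_eq sorted_domain_def)
  qed
qed

text \<open>The change of variables is injective on the sorted domain only. The pulled back
  integrand is symmetric, so passing to the whole polydisc costs the factor n!, which the density
  divides out.\<close>

lemma nn_integral_symm_polydisk:
  assumes F: "F \<in> borel_measurable borel"
  shows "(\<integral>\<^sup>+s. indicator (symm_polydisk \<iota>) s * F s \<partial>lborel) = 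
    (\<integral>\<^sup>+w. indicator polydisc w * (ennreal ((norm (vdm \<iota> w))\<^sup>2 / fact CARD('n)) * F (sym_map \<iota> w)) \<partial>lborel)"
proof -
  let ?S = "sorted_domain \<iota>"
  have sm: "sym_map \<iota> \<in> borel_measurable borel" by (rule borel_measurable_continuous_onI[OF continuous_sym_map])
  have "(\<integral>\<^sup>+s. indicator (symm_polydisk \<iota>) s * F s \<partial>lborel) = (\<integral>\<^sup>+s. indicator (sym_map \<iota> ` ?S) s * F s \<partial>lborel)"
    by (rule nn_integral_cong_AE, use AE_symm_polydisk_sorted in eventually_elim) (auto simp: indicator_def)
  also have "\<dots> = (\<integral>\<^sup>+w. indicator ?S w * (ennreal ((norm (vdm \<iota> w))\<^sup>2) * F (sym_map \<iota> w)) \<partial>lborel)"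
  proof (rule complex_change_of_variables[OF open_sorted_domain _ inj_on_sym_map])
    show "emeasure lborel (sym_map \<iota> ` ?S) < \<infinity>"
      by (rule emeasure_bounded_finite, rule bounded_subset[OF bounded_symm_polydisk])
         (auto simp: symm_polydisk_eq sorted_domain_def)
    show "(\<lambda>w. (norm (vdm \<iota> w))\<^sup>2) \<in> borel_measurable borel" using vdm_measurable by measurable
  qed (use F in \<open>auto simp: norm_vdm_sq[OF \<iota>] intro!: has_derivative_sym_map index_range\<close>)
  finally have 1: "(\<integral>\<^sup>+s. indicator (symm_polydisk \<iota>) s * F s \<partial>lborel) = 
    (\<integral>\<^sup>+w. indicator ?S w * (ennreal ((norm (vdm \<iota> w))\<^sup>2) * F (sym_map \<iota> w)) \<partial>lborel)" .
  define H where "H = (\<lambda>w. ennreal ((norm (vdm \<iota> w))\<^sup>2 / fact CARD('n)) * F (sym_map \<iota> w))"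
  have vm: "(\<lambda>w. (norm (vdm \<iota> w))\<^sup>2 / fact CARD('n)) \<in> borel_measurable borel" using vdm_measurable by measurable
  have Hm: "H \<in> borel_measurable borel" 
    unfolding H_def using measurable_compose[OF sm F] vm by measurable
  have "(\<integral>\<^sup>+w. indicator polydisc w * H w \<partial>lborel) = of_nat (fact CARD('n)) * (\<integral>\<^sup>+w. indicator ?S w * H w \<partial>lborel)"
  proof (rule nn_integral_sorted_domain[OF Hm])
    fix p :: "'n \<Rightarrow> 'n" and w :: "complex ^ 'n" assume p: "p permutes UNIV"
    have "norm (vdm \<iota> (\<chi> i. w $ p i)) = norm (vdm \<iota> w)"
      by (simp add: vdm_permute[OF p] norm_mult sign_def)
    thus "H (\<chi> i. w $ p i) = H w" using p by (simp add: H_def sym_map_permute permutes_bij)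
  qed
  also have "\<dots> = (\<integral>\<^sup>+w. of_nat (fact CARD('n)) * (indicator ?S w * H w) \<partial>lborel)"
    using Hm open_sorted_domain[of \<iota>] by (intro nn_integral_cmult[symmetric]) simp
  also have "\<dots> = (\<integral>\<^sup>+w. indicator ?S w * (ennreal ((norm (vdm \<iota> w))\<^sup>2) * F (sym_map \<iota> w)) \<partial>lborel)"
  proof (intro nn_integral_cong)
    fix w
    have "of_nat (fact CARD('n)) * ennreal ((norm (vdm \<iota> w))\<^sup>2 / fact CARD('n)) = ennreal ((norm (vdm \<iota> w))\<^sup>2)"
      by (simp add: ennreal_of_nat_eq_real_of_nat flip: ennreal_mult)
    thus "of_nat (fact CARD('n)) * (indicator ?S w * H w) = indicator ?S w * (ennreal ((norm (vdm \<iota> w))\<^sup>2) * F (sym_map \<iota> w))"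
      by (simp add: H_def indicator_def mult.assoc[symmetric])
  qed
  finally show ?thesis using 1 by (simp add: H_def)
qed

lemma symm_polydisk_measure:
  shows "restrict_space lborel (symm_polydisk \<iota>) = 
    distr (density polydisc_measure (\<lambda>w. ennreal ((norm (vdm \<iota> w))\<^sup>2 / fact CARD('n)))) (restrict_space lborel (symm_polydisk \<iota>)) (sym_map \<iota>)"
    and "sym_map \<iota> \<in> measurable polydisc_measure (restrict_space lborel (symm_polydisk \<iota>))"
proof -
  show m: "sym_map \<iota> \<in> measurable polydisc_measure (restrict_space lborel (symm_polydisk \<iota>))"
  proof (rule measurable_restrict_space2)
    show "sym_map \<iota> \<in> polydisc_measure \<rightarrow>\<^sub>M lborel"
      using borel_measurable_polydiscI[OF borel_measurable_continuous_onI[OF continuous_sym_map]] by simp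
  qed (auto simp: symm_polydisk_eq)
  show "restrict_space lborel (symm_polydisk \<iota>) = 
    distr (density polydisc_measure (\<lambda>w. ennreal ((norm (vdm \<iota> w))\<^sup>2 / fact CARD('n)))) (restrict_space lborel (symm_polydisk \<iota>)) (sym_map \<iota>)"
    by (rule restrict_space_change_of_variables[OF polydisc_borel symm_polydisk_borel m _ nn_integral_symm_polydisk])
       (use vdm_measurable in measurable)
qed

end

section \<open>The Bergman projection\<close>

lemma ennreal_cmult_finite: "x < \<infinity> \<Longrightarrow> ennreal c * x < \<infinity>"
  by (simp add: ennreal_mult_less_top)

lemma L2_mult_integrable:
  fixes f g :: "'a \<Rightarrow> complex"
  assumes [measurable]: "f \<in> borel_measurable M" "g \<in> borel_measurable M"
    and f: "(\<integral>\<^sup>+x. ennreal (norm (f x) powr 2) \<partial>M) < \<infinity>" and g: "(\<integral>\<^sup>+x. ennreal (norm (g x) powr 2) \<partial>M) < \<infinity>"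
  shows "integrable M (\<lambda>x. f x * g x)"
proof (rule integrableI_bounded)
  have "(\<integral>\<^sup>+x. ennreal (norm (f x * g x)) \<partial>M) \<le> (\<integral>\<^sup>+x. ennreal (norm (f x) powr 2) + ennreal (norm (g x) powr 2) \<partial>M)"
  proof (rule nn_integral_mono)
    fix x
    have "norm (f x) * norm (g x) \<le> 2 * norm (f x) * norm (g x)" by (simp add: mult.assoc)
    also have "\<dots> \<le> (norm (f x))\<^sup>2 + (norm (g x))\<^sup>2" by (rule sum_squares_bound)
    finally have "norm (f x) * norm (g x) \<le> (norm (f x))\<^sup>2 + (norm (g x))\<^sup>2" .
    thus "ennreal (norm (f x * g x)) \<le> ennreal (norm (f x) powr 2) + ennreal (norm (g x) powr 2)"
      by (simp add: norm_mult flip: ennreal_plus)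
  qed
  also have "\<dots> = (\<integral>\<^sup>+x. ennreal (norm (f x) powr 2) \<partial>M) + (\<integral>\<^sup>+x. ennreal (norm (g x) powr 2) \<partial>M)"
    by (rule nn_integral_add) measurable
  also have "\<dots> < \<infinity>" using f g by simp
  finally show "(\<integral>\<^sup>+x. ennreal (norm (f x * g x)) \<partial>M) < \<infinity>" .
qed measurable

lemma L2_diff:
  fixes f g :: "'a \<Rightarrow> complex"
  assumes [measurable]: "f \<in> borel_measurable M" "g \<in> borel_measurable M"
    and f: "(\<integral>\<^sup>+x. ennreal (norm (f x) powr 2) \<partial>M) < \<infinity>" and g: "(\<integral>\<^sup>+x. ennreal (norm (g x) powr 2) \<partial>M) < \<infinity>"
  shows "(\<integral>\<^sup>+x. ennreal (norm (f x - g x) powr 2) \<partial>M) < \<infinity>"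
proof -
  have "(\<integral>\<^sup>+x. ennreal (norm (f x - g x) powr 2) \<partial>M) \<le> (\<integral>\<^sup>+x. ennreal 2 * ennreal (norm (f x) powr 2) + ennreal 2 * ennreal (norm (g x) powr 2) \<partial>M)"
  proof (rule nn_integral_mono)
    fix x
    have "(norm (f x - g x))\<^sup>2 \<le> (norm (f x) + norm (g x))\<^sup>2" by (intro power_mono norm_triangle_ineq4) simp
    also have "\<dots> \<le> 2 * (norm (f x))\<^sup>2 + 2 * (norm (g x))\<^sup>2"
      using sum_squares_bound[of "norm (f x)" "norm (g x)"] by (simp add: power2_sum)
    finally have "ennreal ((norm (f x - g x))\<^sup>2) \<le> ennreal (2 * (norm (f x))\<^sup>2 + 2 * (norm (g x))\<^sup>2)" by (rule ennreal_leI)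
    thus "ennreal (norm (f x - g x) powr 2) \<le> ennreal 2 * ennreal (norm (f x) powr 2) + ennreal 2 * ennreal (norm (g x) powr 2)"
      by (simp add: ennreal_mult)
  qed
  also have "\<dots> = ennreal 2 * (\<integral>\<^sup>+x. ennreal (norm (f x) powr 2) \<partial>M) + ennreal 2 * (\<integral>\<^sup>+x. ennreal (norm (g x) powr 2) \<partial>M)"
    by (subst nn_integral_add) (simp_all add: nn_integral_cmult)
  also have "\<dots> < \<infinity>" using f g by (simp add: ennreal_mult_less_top)
  finally show ?thesis .
qed

lemma L2_imp_integrable_polydisc:
  fixes f :: "complex ^ 'n::finite \<Rightarrow> complex"
  assumes "f \<in> borel_measurable polydisc_measure" "(\<integral>\<^sup>+x. ennreal (norm (f x) powr 2) \<partial>polydisc_measure) < \<infinity>"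
  shows "integrable polydisc_measure f"
proof -
  interpret finite_measure "polydisc_measure :: (complex ^ 'n) measure" by (rule finite_polydisc_measure)
  have "(\<integral>\<^sup>+x. ennreal (norm (1 :: complex) powr 2) \<partial>(polydisc_measure :: (complex ^ 'n) measure)) < \<infinity>"
    by (simp add: less_top[symmetric])
  from L2_mult_integrable[OF assms(1) _ assms(2) this] show ?thesis by simp
qed

lemma holo_on_diff:
  fixes F :: "complex ^ 'n::finite \<Rightarrow> complex"
  assumes F: "holo_on F \<Omega>" and G: "holo_on G \<Omega>"
  shows "holo_on (\<lambda>w. F w - G w) \<Omega>"
  unfolding holo_on_def
proof
  fix z assume z: "z \<in> \<Omega>"
  obtain F' where F': "(F has_derivative F') (at z)" "\<And>c v. F' (c *s v) = c * F' v"
    using F z by (auto simp: holo_on_def)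
  obtain G' where G': "(G has_derivative G') (at z)" "\<And>c v. G' (c *s v) = c * G' v"
    using G z by (auto simp: holo_on_def)
  show "\<exists>f'. ((\<lambda>w. F w - G w) has_derivative f') (at z) \<and> (\<forall>c v. f' (c *s v) = c * f' v)"
    using has_derivative_diff[OF F'(1) G'(1)]
    by (intro exI[of _ "\<lambda>v. F' v - G' v"]) (auto simp: F'(2) G'(2) algebra_simps)
qed

lemma holo_on_const: "holo_on (\<lambda>w. c) \<Omega>"
  unfolding holo_on_def by (auto intro!: exI[of _ "\<lambda>_. 0"])

lemma holo_on_add:
  fixes F :: "complex ^ 'n::finite \<Rightarrow> complex"
  assumes "holo_on F \<Omega>" "holo_on G \<Omega>"
  shows "holo_on (\<lambda>w. F w + G w) \<Omega>"
  using holo_on_diff[OF assms(1) holo_on_diff[OF holo_on_const[of 0] assms(2)]] by simp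

lemma holo_on_sum:
  fixes F :: "'i \<Rightarrow> complex ^ 'n::finite \<Rightarrow> complex"
  assumes "finite A" "\<And>i. i \<in> A \<Longrightarrow> holo_on (F i) \<Omega>"
  shows "holo_on (\<lambda>w. \<Sum>i\<in>A. F i w) \<Omega>"
  using assms by (induction A rule: finite_induct) (auto intro!: holo_on_const holo_on_add)

text \<open>Uniqueness of the orthogonal projection, which makes the choice in the definition of
  the Bergman projection harmless.\<close>
lemma bergman_proj_AE_eq:
  fixes \<Omega> :: "(complex ^ 'n::finite) set"
  assumes h: "h \<in> Lp_space \<Omega> 2" and g: "g \<in> A2_space \<Omega>"
    and orth: "\<And>\<phi>. \<phi> \<in> A2_space \<Omega> \<Longrightarrow> (\<integral>x. (h x - g x) * cnj (\<phi> x) \<partial>(restrict_space lborel \<Omega>)) = 0"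
  shows "AE x in restrict_space lborel \<Omega>. bergman_proj \<Omega> h x = g x"
proof -
  let ?M = "restrict_space lborel \<Omega>"
  define g' where "g' = bergman_proj \<Omega> h"
  have "g' \<in> A2_space \<Omega> \<and> (\<forall>\<phi>\<in>A2_space \<Omega>. (\<integral>x. (h x - g' x) * cnj (\<phi> x) \<partial>?M) = 0)"
    unfolding g'_def bergman_proj_def by (rule someI[where x = g]) (use g orth in auto)
  hence g': "g' \<in> A2_space \<Omega>" and orth': "\<And>\<phi>. \<phi> \<in> A2_space \<Omega> \<Longrightarrow> (\<integral>x. (h x - g' x) * cnj (\<phi> x) \<partial>?M) = 0" by auto
  \<comment> \<open>The difference of the two candidates is itself square integrable and
    holomorphic. Testing both orthogonality relations with it and subtracting gives that its squared
    norm is 0.\<close>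
  define \<phi> where "\<phi> = (\<lambda>x. g x - g' x)"
  note mem = h g g'
  have m[measurable]: "h \<in> borel_measurable ?M" "g \<in> borel_measurable ?M" "g' \<in> borel_measurable ?M"
    using mem by (auto simp: A2_space_def Lp_space_def)
  have fin: "(\<integral>\<^sup>+x. ennreal (norm (h x) powr 2) \<partial>?M) < \<infinity>" "(\<integral>\<^sup>+x. ennreal (norm (g x) powr 2) \<partial>?M) < \<infinity>"
    "(\<integral>\<^sup>+x. ennreal (norm (g' x) powr 2) \<partial>?M) < \<infinity>"
    using mem by (auto simp: A2_space_def Lp_space_def)
  have \<phi>fin: "(\<integral>\<^sup>+x. ennreal (norm (\<phi> x) powr 2) \<partial>?M) < \<infinity>" unfolding \<phi>_def by (intro L2_diff m fin)
  have \<phi>m[measurable]: "\<phi> \<in> borel_measurable ?M" unfolding \<phi>_def by measurable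
  have "holo_on \<phi> \<Omega>" unfolding \<phi>_def using g g' by (intro holo_on_diff) (auto simp: A2_space_def)
  hence \<phi>: "\<phi> \<in> A2_space \<Omega>" using \<phi>m \<phi>fin by (simp add: A2_space_def Lp_space_def)
  have cm: "(\<lambda>x. cnj (\<phi> x)) \<in> borel_measurable ?M" by (rule measurable_compose[OF \<phi>m borel_measurable_cnj])
  have cfin: "(\<integral>\<^sup>+x. ennreal (norm (cnj (\<phi> x)) powr 2) \<partial>?M) < \<infinity>" using \<phi>fin by simp
  have i1: "integrable ?M (\<lambda>x. (h x - g x) * cnj (\<phi> x))"
    by (intro L2_mult_integrable L2_diff m fin cm cfin borel_measurable_diff)
  have i2: "integrable ?M (\<lambda>x. (h x - g' x) * cnj (\<phi> x))"
    by (intro L2_mult_integrable L2_diff m fin cm cfin borel_measurable_diff)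
  have "(\<integral>x. (h x - g' x) * cnj (\<phi> x) - (h x - g x) * cnj (\<phi> x) \<partial>?M) = 0"
    using i1 i2 orth[OF \<phi>] orth'[OF \<phi>] by simp
  also have "(\<lambda>x. (h x - g' x) * cnj (\<phi> x) - (h x - g x) * cnj (\<phi> x)) = (\<lambda>x. complex_of_real ((norm (\<phi> x))\<^sup>2))"
    unfolding complex_norm_square by (auto simp: \<phi>_def algebra_simps)
  finally have I0: "(\<integral>x. (norm (\<phi> x))\<^sup>2 \<partial>?M) = 0"
    by (simp only: integral_complex_of_real of_real_eq_0_iff)
  have "integrable ?M (\<lambda>x. (norm (\<phi> x))\<^sup>2)"
    using integrable_norm[OF L2_mult_integrable[OF \<phi>m \<phi>m \<phi>fin \<phi>fin]] by (simp add: norm_mult power2_eq_square)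
  hence "AE x in ?M. (norm (\<phi> x))\<^sup>2 = 0" using I0 by (subst (asm) integral_nonneg_eq_0_iff_AE) auto
  thus ?thesis by eventually_elim (simp add: \<phi>_def g'_def)
qed

lemma permute_polydisc_measure:
  fixes p :: "'n::finite \<Rightarrow> 'n"
  assumes p: "bij p"
  shows "(polydisc_measure :: (complex ^ 'n) measure) = distr polydisc_measure polydisc_measure (\<lambda>w. \<chi> i. w $ p i)"
    and "(\<lambda>w. \<chi> i. w $ p i) \<in> measurable polydisc_measure (polydisc_measure :: (complex ^ 'n) measure)"
proof -
  let ?P = "\<lambda>w :: complex ^ 'n. \<chi> i. w $ p i"
  show m: "?P \<in> measurable polydisc_measure polydisc_measure"
  proof (rule measurable_restrict_space2)
    show "?P \<in> polydisc_measure \<rightarrow>\<^sub>M lborel"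
      using borel_measurable_polydiscI[OF permute_coords_measurable] by simp
  qed (auto simp: polydisc_iff)
  have iff: "?P w \<in> polydisc \<longleftrightarrow> w \<in> polydisc" for w
    using p unfolding polydisc_iff by (auto simp: bij_def) (metis surjD)
  have "polydisc_measure = distr (density polydisc_measure (\<lambda>w. ennreal 1)) polydisc_measure ?P"
  proof (rule restrict_space_change_of_variables[OF polydisc_borel polydisc_borel m])
    fix F :: "complex ^ 'n \<Rightarrow> ennreal" assume F: "F \<in> borel_measurable borel"
    have "(\<integral>\<^sup>+w. indicator polydisc w * F w \<partial>lborel) = (\<integral>\<^sup>+w. indicator polydisc w * F w \<partial>distr lborel borel ?P)"
      by (simp only: lborel_permute_coords[OF p])
    also have "\<dots> = (\<integral>\<^sup>+w. indicator polydisc (?P w) * F (?P w) \<partial>lborel)"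
      using permute_coords_measurable F by (intro nn_integral_distr) auto
    finally show "(\<integral>\<^sup>+w. indicator polydisc w * F w \<partial>lborel) = (\<integral>\<^sup>+w. indicator polydisc w * (ennreal 1 * F (?P w)) \<partial>lborel)"
      by (simp add: indicator_def iff)
  qed simp
  thus "(polydisc_measure :: (complex ^ 'n) measure) = distr polydisc_measure polydisc_measure ?P"
    by (simp add: density_1)
qed

text \<open>The kernel is a polynomial in s, cnj w and the inverses of the values Q(cnj w_j). So
  everything reduces to a lower bound for these values that is uniform in w over the polydisc and in
  s near s0.\<close>

lemma unif_holo_at_sym_kernel:
  fixes \<iota> :: "'n::finite \<Rightarrow> nat"
  assumes \<iota>: "bij_betw \<iota> UNIV {1..CARD('n)}" and s0: "s0 \<in> symm_polydisk \<iota>"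
  shows "unif_holo_at polydisc_measure (sym_kernel \<iota>) s0"
proof -
  let ?M = "polydisc_measure :: (complex ^ 'n) measure"
  have uw: "unif_holo_at ?M (\<lambda>s w. c * cnj (w $ j) ^ k) s0" for c j k
  proof (rule unif_holo_at_weight[where B = "norm c"])
    show "(\<lambda>w. c * cnj (w $ j) ^ k) \<in> borel_measurable ?M" by (intro borel_measurable_polydiscI) measurable
    show "norm (c * cnj (w $ j) ^ k) \<le> norm c" if "w \<in> space ?M" for w
    proof -
      have "norm (w $ j) ^ k \<le> 1" using that by (intro power_le_one) (auto simp: polydisc_iff less_imp_le)
      thus ?thesis by (simp add: norm_mult norm_power mult_left_le)
    qed
  qed
  have pw: "(- cnj u) ^ k = (- 1) ^ k * cnj u ^ k" for u :: complex and k by (rule power_minus)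
  have ucs: "unif_holo_at ?M (\<lambda>s w. c * cnj (w $ j) ^ k * s $ l) s0" for c j k l
    by (rule unif_holo_at_mult[OF uw unif_holo_at_coord])
  have den: "unif_holo_at ?M (\<lambda>s w. sym_den \<iota> s (cnj (w $ j))) s0" for j
  proof -
    have "unif_holo_at ?M (\<lambda>s w. 1 * cnj (w $ j) ^ 0 + (\<Sum>l\<in>UNIV. (- 1) ^ \<iota> l * cnj (w $ j) ^ \<iota> l * s $ l)) s0"
      by (intro unif_holo_at_add unif_holo_at_sum uw ucs finite)
    thus ?thesis by (simp add: sym_den_def pw)
  qed
  have den': "unif_holo_at ?M (\<lambda>s w. sym_den' \<iota> s (cnj (w $ j))) s0" for j
  proof -
    have "unif_holo_at ?M (\<lambda>s w. (\<Sum>l\<in>UNIV. (- of_nat (\<iota> l) * (- 1) ^ (\<iota> l - 1)) * cnj (w $ j) ^ (\<iota> l - 1) * s $ l)) s0"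
      by (intro unif_holo_at_sum ucs finite)
    thus ?thesis by (simp add: sym_den'_def pw mult.assoc)
  qed
  obtain z where z: "z \<in> polydisc" "s0 = sym_map \<iota> z" using s0 by (auto simp: symm_polydisk_eq)
  define c0 where "c0 = (\<Prod>i\<in>UNIV. 1 - norm (z $ i))"
  have c0: "c0 > 0" unfolding c0_def using z by (intro prod_pos) (auto simp: polydisc_iff)
  define n where "n = real CARD('n)"
  have n: "n > 0" by (simp add: n_def)
  have inv: "unif_holo_at ?M (\<lambda>s w. inverse (sym_den \<iota> s (cnj (w $ j)))) s0" for j
  \<comment> \<open>At s0 the denominator is at least c0 in modulus, as |u| < 1. Its n coefficients
    are powers of modulus at most 1, so moving s by less than c0 / (2 n) changes it by at most c0 /
    2.\<close>
  proof (rule unif_holo_at_inverse[OF den, of "c0 / 2" "c0 / (2 * n)"])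
    fix s w assume s: "norm (s - s0) < c0 / (2 * n)" and w: "w \<in> space ?M"
    define u where "u = cnj (w $ j)"
    have u: "norm u < 1" using w by (auto simp: u_def polydisc_iff)
    have "c0 \<le> norm (sym_den \<iota> s0 u)"
      unfolding z(2) sym_den_sym_map[OF \<iota>] c0_def prod_norm[symmetric]
    proof (intro prod_mono conjI)
      fix i
      have zi: "norm (z $ i) < 1" using z by (simp add: polydisc_iff)
      thus "0 \<le> 1 - norm (z $ i)" by simp
      have "norm (u * z $ i) \<le> norm (z $ i)" using u by (auto simp: norm_mult intro: mult_left_le_one_le)
      thus "1 - norm (z $ i) \<le> norm (1 - u * z $ i)" using norm_triangle_ineq2[of 1 "u * z $ i"] by simp
    qed
    moreover have "norm (sym_den \<iota> s0 u - sym_den \<iota> s u) \<le> n * norm (s - s0)"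
    proof -
      have "sym_den \<iota> s0 u - sym_den \<iota> s u = (\<Sum>l\<in>UNIV. (- u) ^ \<iota> l * (s0 - s) $ l)"
        by (simp add: sym_den_def sum_subtractf algebra_simps)
      also have "norm \<dots> \<le> (\<Sum>l\<in>(UNIV :: 'n set). norm (s - s0))"
      proof (rule sum_norm_le)
        fix l
        have "norm ((- u) ^ \<iota> l) \<le> 1" using u by (auto simp: norm_power power_le_one)
        moreover have "norm ((s0 - s) $ l) \<le> norm (s - s0)"
          using Finite_Cartesian_Product.norm_nth_le[of "s0 - s" l] by (simp add: norm_minus_commute)
        ultimately have "norm ((- u) ^ \<iota> l) * norm ((s0 - s) $ l) \<le> 1 * norm (s - s0)" by (intro mult_mono) auto
        thus "norm ((- u) ^ \<iota> l * (s0 - s) $ l) \<le> norm (s - s0)" by (simp only: norm_mult)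
      qed
      finally show ?thesis by (simp add: n_def)
    qed
    moreover have "n * norm (s - s0) \<le> c0 / 2" using s n by (simp add: field_simps)
    moreover have "norm (sym_den \<iota> s0 u) \<le> norm (sym_den \<iota> s0 u - sym_den \<iota> s u) + norm (sym_den \<iota> s u)"
      using norm_triangle_sub[of "sym_den \<iota> s0 u" "sym_den \<iota> s u"] by simp
    ultimately show "c0 / 2 \<le> norm (sym_den \<iota> s (cnj (w $ j)))" unfolding u_def[symmetric] by linarith
  qed (use c0 n in auto)
  have coeff: "unif_holo_at ?M (\<lambda>s w. sym_coeff \<iota> m s (cnj (w $ j))) s0" for m j
  proof -
    have "unif_holo_at ?M (\<lambda>s w. ((of_nat (\<iota> m) * (- 1) ^ (\<iota> m - 1)) * cnj (w $ j) ^ (\<iota> m - 1) * sym_den \<iota> s (cnj (w $ j)) 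
        + (- ((- 1) ^ (\<iota> m - 1))) * cnj (w $ j) ^ Suc (\<iota> m - 1) * sym_den' \<iota> s (cnj (w $ j)))
        * (inverse (sym_den \<iota> s (cnj (w $ j))) * inverse (sym_den \<iota> s (cnj (w $ j))))) s0"
      by (intro unif_holo_at_mult unif_holo_at_add uw den den' inv)
    thus ?thesis by (simp add: sym_coeff_def pw mult_ac)
  qed
  have sg: "unif_holo_at ?M (\<lambda>s w. of_int (sign p)) s0" for p :: "'n \<Rightarrow> 'n"
    by (rule unif_holo_at_weight[where B = 1]) (auto simp: sign_def)
  show ?thesis unfolding sym_kernel_def[abs_def] det_def vec_lambda_beta
    by (intro unif_holo_at_sum unif_holo_at_mult unif_holo_at_prod sg coeff finite)
qed

section \<open>The projection as an explicit integral operator\<close>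

context
  fixes \<iota> :: "'n::finite \<Rightarrow> nat"
  assumes \<iota>: "bij_betw \<iota> UNIV {1..CARD('n)}"
begin

abbreviation (input) "G \<equiv> symm_polydisk \<iota>"
abbreviation (input) "MG \<equiv> restrict_space lborel G"
abbreviation (input) "MD \<equiv> (polydisc_measure :: (complex ^ 'n) measure)"
abbreviation (input) "pull h \<equiv> (\<lambda>w. vdm \<iota> w * h (sym_map \<iota> w))"

lemma sym_map_measurable_MG: "sym_map \<iota> \<in> measurable MD MG"
  by (rule symm_polydisk_measure(2)[OF \<iota>])

lemma vdm_measurable_MD: "vdm \<iota> \<in> borel_measurable MD"
  by (rule borel_measurable_polydiscI[OF vdm_measurable[OF \<iota>]])

lemma density_measurable_MD: "(\<lambda>w. (norm (vdm \<iota> w))\<^sup>2 / fact CARD('n)) \<in> borel_measurable MD"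
  using vdm_measurable_MD by measurable

lemma pull_measurable: "h \<in> borel_measurable MG \<Longrightarrow> pull h \<in> borel_measurable MD"
  by (intro borel_measurable_times vdm_measurable_MD measurable_compose[OF sym_map_measurable_MG])

lemma nn_integral_MG:
  assumes F: "F \<in> borel_measurable MG"
  shows "(\<integral>\<^sup>+s. F s \<partial>MG) = (\<integral>\<^sup>+w. ennreal ((norm (vdm \<iota> w))\<^sup>2 / fact CARD('n)) * F (sym_map \<iota> w) \<partial>MD)"
proof -
  have "(\<integral>\<^sup>+s. F s \<partial>MG) = (\<integral>\<^sup>+s. F s \<partial>distr (density MD (\<lambda>w. ennreal ((norm (vdm \<iota> w))\<^sup>2 / fact CARD('n)))) MG (sym_map \<iota>))"
    using symm_polydisk_measure(1)[OF \<iota>] by simp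
  also have "\<dots> = (\<integral>\<^sup>+w. F (sym_map \<iota> w) \<partial>density MD (\<lambda>w. ennreal ((norm (vdm \<iota> w))\<^sup>2 / fact CARD('n))))"
    using sym_map_measurable_MG F by (intro nn_integral_distr) auto
  also have "\<dots> = (\<integral>\<^sup>+w. ennreal ((norm (vdm \<iota> w))\<^sup>2 / fact CARD('n)) * F (sym_map \<iota> w) \<partial>MD)"
    using density_measurable_MD measurable_compose[OF sym_map_measurable_MG F] by (intro nn_integral_density) auto
  finally show ?thesis .
qed

lemma integral_MG:
  fixes F :: "complex ^ 'n \<Rightarrow> complex"
  assumes F: "F \<in> borel_measurable MG"
  shows "(\<integral>s. F s \<partial>MG) = (\<integral>w. ((norm (vdm \<iota> w))\<^sup>2 / fact CARD('n)) *\<^sub>R F (sym_map \<iota> w) \<partial>MD)"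
proof -
  have "(\<integral>s. F s \<partial>MG) = (\<integral>s. F s \<partial>distr (density MD (\<lambda>w. ennreal ((norm (vdm \<iota> w))\<^sup>2 / fact CARD('n)))) MG (sym_map \<iota>))"
    using symm_polydisk_measure(1)[OF \<iota>] by simp
  also have "\<dots> = (\<integral>w. F (sym_map \<iota> w) \<partial>density MD (\<lambda>w. ennreal ((norm (vdm \<iota> w))\<^sup>2 / fact CARD('n))))"
    using sym_map_measurable_MG F by (intro integral_distr) auto
  also have "\<dots> = (\<integral>w. ((norm (vdm \<iota> w))\<^sup>2 / fact CARD('n)) *\<^sub>R F (sym_map \<iota> w) \<partial>MD)"
    using density_measurable_MD measurable_compose[OF sym_map_measurable_MG F] by (intro integral_density) auto
  finally show ?thesis .
qed

lemma vdm_weight_eq: "vdm_weight s (($) w) = norm (vdm \<iota> w) powr (- s)"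
proof -
  have "vdm_weight s (($) w) = (\<Prod>p\<in>{p. fst p \<noteq> snd p}. norm (w $ fst p - w $ snd p)) powr (- s / 2)"
    by (simp add: vdm_weight_def prod_powr_distrib)
  also have "(\<Prod>p\<in>{p. fst p \<noteq> snd p}. norm (w $ fst p - w $ snd p)) = (\<Prod>i\<in>UNIV. \<Prod>k\<in>-{i}. norm (w $ i - w $ k))"
  proof -
    have "{p :: 'n \<times> 'n. fst p \<noteq> snd p} = Sigma UNIV (\<lambda>i. -{i})" by auto
    thus ?thesis by (simp add: prod.Sigma case_prod_unfold)
  qed
  also have "\<dots> = norm (vdm \<iota> w) powr 2" by (simp add: norm_vdm_sq(1)[OF \<iota>])
  finally have "vdm_weight s (($) w) = (norm (vdm \<iota> w) powr 2) powr (- s / 2)" .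
  thus ?thesis unfolding powr_powr by simp
qed

text \<open>The pullback contributes |J|^p and the weight |J|^(2-p); their product is the Jacobian
  |J|^2 of the symmetrization map, also where J = 0 because of \<open>0 powr a = 0\<close>.\<close>

lemma nn_integral_pull:
  assumes h: "h \<in> borel_measurable MG"
  shows "(\<integral>\<^sup>+w. ennreal (norm (pull h w) powr p * vdm_weight (p - 2) (($) w)) \<partial>MD) = ennreal (fact CARD('n)) * (\<integral>\<^sup>+s. ennreal (norm (h s) powr p) \<partial>MG)"
proof -
  have m: "(\<lambda>s. ennreal (norm (h s) powr p)) \<in> borel_measurable MG" using h by measurable
  have "(\<integral>\<^sup>+w. ennreal (norm (pull h w) powr p * vdm_weight (p - 2) (($) w)) \<partial>MD) 
     = (\<integral>\<^sup>+w. ennreal (fact CARD('n)) * (ennreal ((norm (vdm \<iota> w))\<^sup>2 / fact CARD('n)) * ennreal (norm (h (sym_map \<iota> w)) powr p)) \<partial>MD)"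
  proof (intro nn_integral_cong)
    fix w
    define J where "J = norm (vdm \<iota> w)"
    have "J powr p * J powr (- (p - 2)) = J\<^sup>2"
      by (cases "J = 0") (simp_all add: powr_add[symmetric] J_def)
    hence "norm (pull h w) powr p * vdm_weight (p - 2) (($) w) = J\<^sup>2 * norm (h (sym_map \<iota> w)) powr p"
      by (simp add: vdm_weight_eq norm_mult powr_mult J_def[symmetric] mult_ac)
    also have "\<dots> = fact CARD('n) * (J\<^sup>2 / fact CARD('n) * norm (h (sym_map \<iota> w)) powr p)" by simp
    finally show "ennreal (norm (pull h w) powr p * vdm_weight (p - 2) (($) w)) = 
      ennreal (fact CARD('n)) * (ennreal ((norm (vdm \<iota> w))\<^sup>2 / fact CARD('n)) * ennreal (norm (h (sym_map \<iota> w)) powr p))"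
      by (simp only: J_def[symmetric]) (simp flip: ennreal_mult')
  qed
  also have "\<dots> = ennreal (fact CARD('n)) * (\<integral>\<^sup>+w. ennreal ((norm (vdm \<iota> w))\<^sup>2 / fact CARD('n)) * ennreal (norm (h (sym_map \<iota> w)) powr p) \<partial>MD)"
    using measurable_compose[OF density_measurable_MD measurable_ennreal] measurable_compose[OF sym_map_measurable_MG m]
    by (intro nn_integral_cmult borel_measurable_times_ennreal)
  also have "\<dots> = ennreal (fact CARD('n)) * (\<integral>\<^sup>+s. ennreal (norm (h s) powr p) \<partial>MG)"
    by (simp only: nn_integral_MG[OF m])
  finally show ?thesis .
qed

text \<open>As \<open>0 powr 0 = 0\<close>, the weight with exponent 0 equals 1 only where the
  coordinates are distinct. This makes the case p = 2 of the weighted bound an unweighted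
  one.\<close>

lemma AE_vdm_nonzero: "AE w in MD. vdm_weight 0 (($) w) = 1"
  using AE_polydisc_distinct
proof eventually_elim
  case (elim w)
  have "norm (w $ fst p - w $ snd p) powr (- 0 / 2) = 1" if "fst p \<noteq> snd p" for p
    using elim that by (auto dest: injD)
  thus ?case unfolding vdm_weight_def by (intro prod.neutral) auto
qed

lemma pull_L2:
  assumes h: "h \<in> borel_measurable MG" 
  shows "(\<integral>\<^sup>+w. ennreal (norm (pull h w) powr 2) \<partial>MD) = ennreal (fact CARD('n)) * (\<integral>\<^sup>+s. ennreal (norm (h s) powr 2) \<partial>MG)"
proof -
  have "(\<integral>\<^sup>+w. ennreal (norm (pull h w) powr 2) \<partial>MD) = (\<integral>\<^sup>+w. ennreal (norm (pull h w) powr 2 * vdm_weight (2 - 2) (($) w)) \<partial>MD)"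
    by (rule nn_integral_cong_AE, use AE_vdm_nonzero in eventually_elim) simp
  thus ?thesis using nn_integral_pull[OF h, of 2] by simp
qed

lemma pull_L2_finite:
  assumes h: "h \<in> Lp_space G 2"
  shows "(\<integral>\<^sup>+w. ennreal (norm (pull h w) powr 2) \<partial>MD) < \<infinity>"
proof -
  have hm: "h \<in> borel_measurable MG" and fin: "(\<integral>\<^sup>+s. ennreal (norm (h s) powr 2) \<partial>MG) < \<infinity>" using h by (auto simp: Lp_space_def)
  show ?thesis unfolding pull_L2[OF hm] using fin by (rule ennreal_cmult_finite)
qed

lemma integrable_pull: "h \<in> Lp_space G 2 \<Longrightarrow> integrable MD (pull h)"
  using pull_L2_finite pull_measurable by (intro L2_imp_integrable_polydisc) (auto simp: Lp_space_def)

lemma pull_permute: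
  assumes p: "p permutes UNIV"
  shows "pull h (\<chi> i. w $ p i) = of_int (sign p) * pull h w"
  using p by (simp add: vdm_permute sym_map_permute permutes_bij mult.assoc)

text \<open>The candidate for the projection. The determinant behind \<open>sym_kernel\<close> sums
  n! permuted polydisc kernels, hence the factor n!; the volume normalizes
  \<open>poly_kernel\<close>.\<close>

definition bergman_op :: "(complex ^ 'n \<Rightarrow> complex) \<Rightarrow> complex ^ 'n \<Rightarrow> complex" where
  "bergman_op h s = (\<integral>w. sym_kernel \<iota> s w * pull h w \<partial>MD) / (fact CARD('n) * of_real (measure MD polydisc))"

text \<open>Multiplying by \<open>vdm\<close> restores the determinant. Its terms and the
  antisymmetric function \<open>pull h\<close> pick up the same sign under a permutation, so all n!
  terms have the same integral.\<close>

lemma vdm_bergman_op: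
  assumes int: "integrable MD (pull h)" and z: "z \<in> polydisc"
  shows "pull (bergman_op h) z = (\<integral>w. poly_kernel z w * pull h w \<partial>MD) / of_real (measure MD polydisc)"
proof -
  let ?P = "{p. p permutes (UNIV :: 'n set)}"
  let ?f = "pull h"
  have fm: "?f \<in> borel_measurable MD" using int by simp
  define k where "k = (\<lambda>w. poly_kernel z w * ?f w)"
  have ki: "integrable MD k" unfolding k_def by (rule integrable_poly_kernel[OF z int])
  have pi: "integrable MD (\<lambda>w. k (\<chi> i. w $ p i))" "(\<integral>w. k (\<chi> i. w $ p i) \<partial>MD) = (\<integral>w. k w \<partial>MD)" if "p \<in> ?P" for p
  proof -
    have b: "bij p" using that by (simp add: permutes_bij)
    have km: "k \<in> borel_measurable MD" using ki by simp
    show "integrable MD (\<lambda>w. k (\<chi> i. w $ p i))"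
      using ki integrable_distr_eq[OF permute_polydisc_measure(2)[OF b] km] permute_polydisc_measure(1)[OF b] by simp
    show "(\<integral>w. k (\<chi> i. w $ p i) \<partial>MD) = (\<integral>w. k w \<partial>MD)"
      using integral_distr[OF permute_polydisc_measure(2)[OF b] km] permute_polydisc_measure(1)[OF b] by simp
  qed
  have eq: "vdm \<iota> z * sym_kernel \<iota> (sym_map \<iota> z) w * ?f w = (\<Sum>p\<in>?P. k (\<chi> i. w $ p i))" if w: "w \<in> polydisc" for w
  proof -
    have "vdm \<iota> z * sym_kernel \<iota> (sym_map \<iota> z) w = (\<Sum>p\<in>?P. of_int (sign p) * poly_kernel z (\<chi> i. w $ p i))"
      unfolding det_kernel_eq[OF \<iota> z w, symmetric] det_def poly_kernel_def by simp
    also have "\<dots> * ?f w = (\<Sum>p\<in>?P. k (\<chi> i. w $ p i))"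
      unfolding sum_distrib_right k_def
    proof (intro sum.cong refl)
      fix p assume p: "p \<in> ?P"
      have "?f (\<chi> i. w $ p i) = of_int (sign p) * ?f w" using p by (intro pull_permute) simp
      thus "of_int (sign p) * poly_kernel z (\<chi> i. w $ p i) * ?f w = poly_kernel z (\<chi> i. w $ p i) * ?f (\<chi> i. w $ p i)"
        by (simp only: mult_ac)
    qed
    finally show ?thesis .
  qed
  have "vdm \<iota> z * (\<integral>w. sym_kernel \<iota> (sym_map \<iota> z) w * ?f w \<partial>MD) = (\<integral>w. vdm \<iota> z * (sym_kernel \<iota> (sym_map \<iota> z) w * ?f w) \<partial>MD)"
    by simp
  also have "\<dots> = (\<integral>w. (\<Sum>p\<in>?P. k (\<chi> i. w $ p i)) \<partial>MD)"
    by (rule Bochner_Integration.integral_cong[OF refl]) (use eq in \<open>simp add: mult.assoc\<close>)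
  also have "\<dots> = (\<Sum>p\<in>?P. \<integral>w. k (\<chi> i. w $ p i) \<partial>MD)"
    by (rule Bochner_Integration.integral_sum) (rule pi(1))
  also have "\<dots> = (\<Sum>p\<in>?P. \<integral>w. k w \<partial>MD)" by (rule sum.cong[OF refl pi(2)])
  also have "\<dots> = fact CARD('n) * (\<integral>w. k w \<partial>MD)" by (simp add: card_permutations)
  finally show ?thesis by (simp add: bergman_op_def k_def)
qed

lemma holo_on_bergman_op:
  assumes int: "integrable MD (pull h)"
  shows "holo_on (bergman_op h) G"
  unfolding holo_on_def
proof
  fix s0 assume s0: "s0 \<in> G"
  obtain g' where g': "((\<lambda>s. \<integral>w. sym_kernel \<iota> s w * pull h w \<partial>MD) has_derivative g') (at s0)" "\<And>c v. g' (c *s v) = c * g' v"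
    using holo_parametric_integral[OF unif_holo_at_sym_kernel[OF \<iota> s0] int] by blast
  let ?c = "fact CARD('n) * of_real (measure MD polydisc) :: complex"
  have "(bergman_op h has_derivative (\<lambda>v. g' v / ?c)) (at s0)"
    unfolding bergman_op_def[abs_def] divide_inverse by (intro has_derivative_mult_left g'(1))
  thus "\<exists>f'. (bergman_op h has_derivative f') (at s0) \<and> (\<forall>c v. f' (c *s v) = c * f' v)"
    by (intro exI[of _ "\<lambda>v. g' v / ?c"]) (simp add: g'(2))
qed

lemma holo_on_measurable:
  assumes "holo_on f G"
  shows "f \<in> borel_measurable MG"
proof -
  have "continuous_on G f"
    using assms by (intro continuous_at_imp_continuous_on) (auto simp: holo_on_def intro: has_derivative_continuous)
  from borel_measurable_continuous_on_restrict[OF this] show ?thesis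
    by (simp cong: measurable_cong_sets add: sets_restrict_space)
qed

lemma norm_bergman_op_le:
  assumes int: "integrable MD (pull h)" and z: "z \<in> polydisc"
  shows "ennreal (norm (pull (bergman_op h) z)) \<le> (\<integral>\<^sup>+w. ennreal (norm (poly_kernel z w) * (norm (pull h w) / measure MD polydisc)) \<partial>MD)"
proof -
  let ?V = "measure MD polydisc"
  have V: "?V > 0" by (rule emeasure_polydisc_pos)
  have i: "integrable MD (\<lambda>w. poly_kernel z w * pull h w / of_real ?V)"
    using integrable_poly_kernel[OF z int] by simp
  have "pull (bergman_op h) z = (\<integral>w. poly_kernel z w * pull h w / of_real ?V \<partial>MD)"
    unfolding vdm_bergman_op[OF int z] by simp
  also have "ennreal (norm \<dots>) \<le> (\<integral>\<^sup>+w. ennreal (norm (poly_kernel z w * pull h w / of_real ?V)) \<partial>MD)"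
    by (rule integral_norm_bound_ennreal[OF i])
  also have "\<dots> = (\<integral>\<^sup>+w. ennreal (norm (poly_kernel z w) * (norm (pull h w) / ?V)) \<partial>MD)"
    using V by (intro nn_integral_cong) (simp add: norm_mult norm_divide)
  finally show ?thesis .
qed

text \<open>The weighted bound is applied with u = |pull (bergman_op h)| and f = |pull h| / V, where
  V is the volume of the polydisc. The factors n! from the two pullback formulas cancel.\<close>

lemma bergman_op_Lp_bound:
  fixes p :: real
  assumes n: "CARD('n) \<ge> 2" and p: "1 < p" "(real CARD('n) - 1) * (p - 2) < 1" 
    "(real CARD('n) - 1) * ((2 - p) / (p - 1)) < 1" "(p - 1) / 2 < 1"
  obtains C where "C > 0"
    "\<And>h. h \<in> Lp_space G 2 \<Longrightarrow> (\<integral>\<^sup>+s. ennreal (norm (bergman_op h s) powr p) \<partial>MG) 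
        \<le> ennreal (C powr p) * (\<integral>\<^sup>+s. ennreal (norm (h s) powr p) \<partial>MG)"
proof -
  obtain C where C: "C > 0" "kernel_bounded TYPE('n) p C"
    by (rule polydisc_schur[OF n p]) blast
  let ?V = "measure MD polydisc" and ?N = "ennreal (fact CARD('n))"
  have V: "?V > 0" by (rule emeasure_polydisc_pos)
  show ?thesis
  proof (rule that[of "C / ?V"])
    show "C / ?V > 0" using C V by simp
    fix h assume h: "h \<in> Lp_space G 2"
    have hm: "h \<in> borel_measurable MG" using h by (simp add: Lp_space_def)
    have pm: "pull h \<in> borel_measurable MD" by (rule pull_measurable[OF hm])
    have int: "integrable MD (pull h)" by (rule integrable_pull[OF h])
    have gm: "bergman_op h \<in> borel_measurable MG" by (rule holo_on_measurable[OF holo_on_bergman_op[OF int]])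
    have "?N * (\<integral>\<^sup>+s. ennreal (norm (bergman_op h s) powr p) \<partial>MG) = (\<integral>\<^sup>+w. ennreal (norm (pull (bergman_op h) w) powr p * vdm_weight (p - 2) (($) w)) \<partial>MD)"
      by (rule nn_integral_pull[OF gm, symmetric])
    also have "\<dots> \<le> ennreal (C powr p) * (\<integral>\<^sup>+w. ennreal ((norm (pull h w) / ?V) powr p * vdm_weight (p - 2) (($) w)) \<partial>MD)"
      by (rule kernel_boundedD[OF C(2)]) (use pull_measurable[OF gm] pm V norm_bergman_op_le[OF int] in auto)
    also have "(\<integral>\<^sup>+w. ennreal ((norm (pull h w) / ?V) powr p * vdm_weight (p - 2) (($) w)) \<partial>MD) = 
       (\<integral>\<^sup>+w. ennreal (1 / ?V powr p) * ennreal (norm (pull h w) powr p * vdm_weight (p - 2) (($) w)) \<partial>MD)"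
      by (intro nn_integral_cong) (simp add: powr_divide flip: ennreal_mult')
    also have "\<dots> = ennreal (1 / ?V powr p) * (\<integral>\<^sup>+w. ennreal (norm (pull h w) powr p * vdm_weight (p - 2) (($) w)) \<partial>MD)"
    proof (rule nn_integral_cmult)
      have [measurable]: "(\<lambda>w. vdm_weight (p - 2) (($) w)) \<in> borel_measurable MD"
        unfolding vdm_weight_def by (intro borel_measurable_polydiscI) measurable
      have nm: "(\<lambda>x :: complex. norm x powr p) \<in> borel_measurable borel" by measurable
      show "(\<lambda>w. ennreal (norm (pull h w) powr p * vdm_weight (p - 2) (($) w))) \<in> borel_measurable MD"
        by (intro measurable_compose[OF _ measurable_ennreal] borel_measurable_times measurable_compose[OF pm nm]) measurable
    qed
    also have "\<dots> = ennreal (1 / ?V powr p) * (?N * (\<integral>\<^sup>+s. ennreal (norm (h s) powr p) \<partial>MG))"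
      by (simp only: nn_integral_pull[OF hm])
    also have "ennreal (C powr p) * \<dots> = ?N * (ennreal ((C / ?V) powr p) * (\<integral>\<^sup>+s. ennreal (norm (h s) powr p) \<partial>MG))"
    proof -
      have "ennreal ((C / ?V) powr p) = ennreal (C powr p) * ennreal (1 / ?V powr p)"
        by (simp add: powr_divide flip: ennreal_mult')
      thus ?thesis by (simp only: mult_ac)
    qed
    finally show "(\<integral>\<^sup>+s. ennreal (norm (bergman_op h s) powr p) \<partial>MG) \<le> ennreal ((C / ?V) powr p) * (\<integral>\<^sup>+s. ennreal (norm (h s) powr p) \<partial>MG)"
      by (subst (asm) ennreal_mult_le_mult_iff) auto
  qed
qed

text \<open>The operator is defined by a kernel, so its square integrability comes from the bound
  just proved, at p = 2.\<close>

lemma bergman_op_A2: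
  assumes n: "CARD('n) \<ge> 2" and h: "h \<in> Lp_space G 2"
  shows "bergman_op h \<in> A2_space G"
proof -
  have p2: "(1 :: real) < 2" "(real CARD('n) - 1) * (2 - 2) < 1" "(real CARD('n) - 1) * ((2 - 2) / (2 - 1)) < 1" "(2 - 1) / 2 < (1 :: real)"
    by simp_all
  obtain C where C: "\<And>h. h \<in> Lp_space G 2 \<Longrightarrow> (\<integral>\<^sup>+s. ennreal (norm (bergman_op h s) powr 2) \<partial>MG) 
        \<le> ennreal (C powr 2) * (\<integral>\<^sup>+s. ennreal (norm (h s) powr 2) \<partial>MG)"
    by (rule bergman_op_Lp_bound[OF n p2]) blast
  have holo: "holo_on (bergman_op h) G" by (rule holo_on_bergman_op[OF integrable_pull[OF h]])
  have "(\<integral>\<^sup>+s. ennreal (norm (bergman_op h s) powr 2) \<partial>MG) \<le> ennreal (C powr 2) * (\<integral>\<^sup>+s. ennreal (norm (h s) powr 2) \<partial>MG)"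
    by (rule C[OF h])
  also have "\<dots> < \<infinity>" using h by (intro ennreal_cmult_finite) (auto simp: Lp_space_def)
  finally show ?thesis using holo holo_on_measurable[OF holo] by (simp add: A2_space_def Lp_space_def)
qed

text \<open>Supplies the absolute convergence for Fubini in the proof of orthogonality: the integral
  against |kernel| is finite at every point and square integrable, by the Schur bound at p =
  2.\<close>

lemma poly_kernel_L2:
  fixes f :: "complex ^ 'n \<Rightarrow> complex"
  assumes n: "CARD('n) \<ge> 2" and f: "integrable MD f" "(\<integral>\<^sup>+w. ennreal (norm (f w) powr 2) \<partial>MD) < \<infinity>"
  defines "u \<equiv> \<lambda>z. enn2real (\<integral>\<^sup>+w. ennreal (norm (poly_kernel z w) * norm (f w)) \<partial>MD)"
  shows "u \<in> borel_measurable MD" "(\<integral>\<^sup>+z. ennreal (norm (u z) powr 2) \<partial>MD) < \<infinity>"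
    "\<And>z. z \<in> polydisc \<Longrightarrow> ennreal (u z) = (\<integral>\<^sup>+w. ennreal (norm (poly_kernel z w) * norm (f w)) \<partial>MD)"
proof -
  interpret MD: finite_measure MD by (rule finite_polydisc_measure)
  have fm: "f \<in> borel_measurable MD" using f(1) by simp
  have fm2: "(\<lambda>p. f (snd p)) \<in> borel_measurable (MD \<Otimes>\<^sub>M MD)" by (rule measurable_compose[OF measurable_snd fm])
  have nm: "norm \<in> borel_measurable (borel :: complex measure)" by measurable
  have km: "(\<lambda>(z, w). ennreal (norm (poly_kernel z w) * norm (f w))) \<in> borel_measurable (MD \<Otimes>\<^sub>M MD)"
    using poly_kernel_pair_measurable[where 'n = 'n] fm2 unfolding case_prod_unfold
    by (intro measurable_compose[OF _ measurable_ennreal] borel_measurable_times measurable_compose[OF _ nm])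
  have "(\<lambda>z. \<integral>\<^sup>+w. ennreal (norm (poly_kernel z w) * norm (f w)) \<partial>MD) \<in> borel_measurable MD"
    using MD.borel_measurable_nn_integral[OF km] by simp
  thus um: "u \<in> borel_measurable MD" unfolding u_def by (rule borel_measurable_enn2real)
  show eq: "ennreal (u z) = (\<integral>\<^sup>+w. ennreal (norm (poly_kernel z w) * norm (f w)) \<partial>MD)" if z: "z \<in> polydisc" for z
  proof -
    have "integrable MD (\<lambda>w. poly_kernel z w * f w)" by (rule integrable_poly_kernel[OF z f(1)])
    hence "(\<integral>\<^sup>+w. ennreal (norm (poly_kernel z w * f w)) \<partial>MD) < \<infinity>" by (simp add: integrable_iff_bounded)
    thus ?thesis by (simp add: u_def norm_mult)
  qed
  have p2: "(1 :: real) < 2" "(real CARD('n) - 1) * (2 - 2) < 1" "(real CARD('n) - 1) * ((2 - 2) / (2 - 1)) < 1" "(2 - 1) / 2 < (1 :: real)"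
    by simp_all
  obtain C where C: "kernel_bounded TYPE('n) 2 C"
    by (rule polydisc_schur[OF n p2]) blast
  have w1: "(\<integral>\<^sup>+z. ennreal (v z powr 2 * vdm_weight (2 - 2) (($) z)) \<partial>MD) = (\<integral>\<^sup>+z. ennreal (v z powr 2) \<partial>MD)" for v :: "complex ^ 'n \<Rightarrow> real"
    by (rule nn_integral_cong_AE, use AE_vdm_nonzero in eventually_elim) simp
  have "(\<integral>\<^sup>+z. ennreal (u z powr 2) \<partial>MD) \<le> ennreal (C powr 2) * (\<integral>\<^sup>+z. ennreal (norm (f z) powr 2) \<partial>MD)"
    unfolding w1[symmetric] by (rule kernel_boundedD[OF C]) (use fm um eq in \<open>auto simp: u_def\<close>)
  also have "\<dots> < \<infinity>" using f(2) by (rule ennreal_cmult_finite)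
  finally show "(\<integral>\<^sup>+z. ennreal (norm (u z) powr 2) \<partial>MD) < \<infinity>" by (simp add: u_def)
qed

lemma holo_on_pull:
  assumes "holo_on \<phi> G"
  shows "holo_on (pull \<phi>) polydisc"
proof (rule holo_on_cmult_prod)
  have der: "(sym_map \<iota> has_derivative (\<lambda>v. sym_jac \<iota> w *v v)) (at w)" for w
    by (rule has_derivative_sym_map) (rule index_range(1)[OF \<iota>])
  show "holo_on (\<lambda>w. \<phi> (sym_map \<iota> w)) polydisc"
    by (rule holo_on_compose[OF assms der]) (auto simp: symm_polydisk_eq)
  have e: "holo_on (\<lambda>w. esym_on A k w) polydisc" for A :: "'n set" and k
    unfolding esym_on_def by (intro holo_on_sum holo_on_prod holo_on_coord[where h = "\<lambda>x. x" and h' = "\<lambda>_. 1"] DERIV_ident finite)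
  show "holo_on (vdm \<iota>) polydisc"
    unfolding vdm_def[abs_def] det_def sym_jac_def vec_lambda_beta
    by (intro holo_on_sum holo_on_cmult_prod holo_on_prod e holo_on_const finite)
qed

text \<open>After pulling back, g is the polydisc kernel integral of f divided by the volume.
  Exchanging the integrals moves the kernel to \<psi>, since it is Hermitian, and there it
  reproduces \<psi>. Hence f and g have the same inner product with \<psi>.\<close>

lemma bergman_op_orthogonal:
  assumes n: "CARD('n) \<ge> 2" and h: "h \<in> Lp_space G 2" and \<phi>: "\<phi> \<in> A2_space G"
  shows "(\<integral>s. (h s - bergman_op h s) * cnj (\<phi> s) \<partial>MG) = 0"
proof -
  interpret MD: finite_measure MD by (rule finite_polydisc_measure)
  interpret PP: pair_sigma_finite MD MD ..
  let ?V = "measure MD polydisc"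
  have V: "?V > 0" by (rule emeasure_polydisc_pos)
  define f \<psi> g where "f = pull h" and "\<psi> = pull \<phi>" and "g = pull (bergman_op h)"
  have gA: "bergman_op h \<in> A2_space G" by (rule bergman_op_A2[OF n h])
  have \<phi>L: "\<phi> \<in> Lp_space G 2" and gL: "bergman_op h \<in> Lp_space G 2" using \<phi> gA by (auto simp: A2_space_def)
  have meas: "h \<in> borel_measurable MG" "\<phi> \<in> borel_measurable MG" "bergman_op h \<in> borel_measurable MG"
    using h \<phi>L gL by (auto simp: Lp_space_def)
  have fi: "integrable MD f" and \<psi>i: "integrable MD \<psi>" and gi: "integrable MD g"
    unfolding f_def \<psi>_def g_def by (intro integrable_pull h \<phi>L gL)+
  have m: "f \<in> borel_measurable MD" "\<psi> \<in> borel_measurable MD" "g \<in> borel_measurable MD" using fi \<psi>i gi by auto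
  have f2: "(\<integral>\<^sup>+w. ennreal (norm (f w) powr 2) \<partial>MD) < \<infinity>" and \<psi>2: "(\<integral>\<^sup>+w. ennreal (norm (\<psi> w) powr 2) \<partial>MD) < \<infinity>"
    and g2: "(\<integral>\<^sup>+w. ennreal (norm (g w) powr 2) \<partial>MD) < \<infinity>"
    unfolding f_def \<psi>_def g_def by (intro pull_L2_finite h \<phi>L gL)+
  have c\<psi>: "(\<lambda>w. cnj (\<psi> w)) \<in> borel_measurable MD" by (rule measurable_compose[OF m(2) borel_measurable_cnj])
  have c\<psi>2: "(\<integral>\<^sup>+w. ennreal (norm (cnj (\<psi> w)) powr 2) \<partial>MD) < \<infinity>" using \<psi>2 by simp
  have i1: "integrable MD (\<lambda>w. f w * cnj (\<psi> w))" and i2: "integrable MD (\<lambda>w. g w * cnj (\<psi> w))"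
    by (intro L2_mult_integrable m c\<psi> f2 g2 c\<psi>2)+
  have kc: "poly_kernel z w = cnj (poly_kernel w z)" for z w :: "complex ^ 'n"
    by (simp add: poly_kernel_def mult.commute)
  define H where "H = (\<lambda>z w. poly_kernel z w * f w * cnj (\<psi> z))"
  have Hm: "(\<lambda>(z, w). H z w) \<in> borel_measurable (MD \<Otimes>\<^sub>M MD)"
    using poly_kernel_pair_measurable[where 'n = 'n] unfolding H_def case_prod_unfold
    by (intro borel_measurable_times measurable_compose[OF measurable_snd m(1)] measurable_compose[OF measurable_fst c\<psi>])
  have Hi: "integrable (MD \<Otimes>\<^sub>M MD) (\<lambda>(z, w). H z w)"
  proof (rule integrableI_bounded[OF Hm])
    note u = poly_kernel_L2[OF n fi f2]
    define u where "u = (\<lambda>z. enn2real (\<integral>\<^sup>+w. ennreal (norm (poly_kernel z w) * norm (f w)) \<partial>MD))"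
    have Hn: "(\<lambda>p. ennreal (norm (case p of (z, w) \<Rightarrow> H z w))) \<in> borel_measurable (MD \<Otimes>\<^sub>M MD)"
      using Hm by measurable
    have "(\<integral>\<^sup>+p. ennreal (norm (case p of (z, w) \<Rightarrow> H z w)) \<partial>(MD \<Otimes>\<^sub>M MD)) = (\<integral>\<^sup>+z. \<integral>\<^sup>+w. ennreal (norm (H z w)) \<partial>MD \<partial>MD)"
      by (subst MD.nn_integral_fst[OF Hn, symmetric]) simp
    also have "\<dots> = (\<integral>\<^sup>+z. ennreal (norm (complex_of_real (u z) * \<psi> z)) \<partial>MD)"
    proof (rule nn_integral_cong)
      fix z assume "z \<in> space MD"
      hence z: "z \<in> polydisc" by simp
      have "(\<lambda>w. poly_kernel z w * f w) \<in> borel_measurable MD" using integrable_poly_kernel[OF z fi] by simp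
      hence km: "(\<lambda>w. ennreal (norm (poly_kernel z w) * norm (f w))) \<in> borel_measurable MD"
        unfolding norm_mult[symmetric] by measurable
      have "(\<integral>\<^sup>+w. ennreal (norm (H z w)) \<partial>MD) = (\<integral>\<^sup>+w. ennreal (norm (poly_kernel z w) * norm (f w)) * ennreal (norm (\<psi> z)) \<partial>MD)"
        by (intro nn_integral_cong) (simp add: H_def norm_mult flip: ennreal_mult)
      also have "\<dots> = (\<integral>\<^sup>+w. ennreal (norm (poly_kernel z w) * norm (f w)) \<partial>MD) * ennreal (norm (\<psi> z))"
        by (rule nn_integral_multc[OF km])
      also have "\<dots> = ennreal (norm (complex_of_real (u z) * \<psi> z))"
        using u(3)[OF z] by (simp add: u_def norm_mult ennreal_mult)
      finally show "(\<integral>\<^sup>+w. ennreal (norm (H z w)) \<partial>MD) = ennreal (norm (complex_of_real (u z) * \<psi> z))" .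
    qed
    also have "\<dots> < \<infinity>"
    proof -
      have um: "(\<lambda>z. complex_of_real (u z)) \<in> borel_measurable MD" using u(1) unfolding u_def by measurable
      have u2: "(\<integral>\<^sup>+z. ennreal (norm (complex_of_real (u z)) powr 2) \<partial>MD) < \<infinity>" using u(2) by (simp add: u_def)
      show ?thesis using L2_mult_integrable[OF um m(2) u2 \<psi>2] by (simp add: integrable_iff_bounded)
    qed
    finally show "(\<integral>\<^sup>+p. ennreal (norm (case p of (z, w) \<Rightarrow> H z w)) \<partial>(MD \<Otimes>\<^sub>M MD)) < \<infinity>" .
  qed
  have holo: "holo_on \<psi> polydisc" unfolding \<psi>_def by (rule holo_on_pull) (use \<phi> in \<open>simp add: A2_space_def\<close>)
  have "of_real ?V * (\<integral>z. g z * cnj (\<psi> z) \<partial>MD) = (\<integral>z. of_real ?V * (g z * cnj (\<psi> z)) \<partial>MD)" by simp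
  also have "\<dots> = (\<integral>z. (\<integral>w. H z w \<partial>MD) \<partial>MD)"
  proof (rule Bochner_Integration.integral_cong[OF refl])
    fix z assume "z \<in> space MD"
    hence z: "z \<in> polydisc" by simp
    have "(\<integral>w. H z w \<partial>MD) = (\<integral>w. poly_kernel z w * f w \<partial>MD) * cnj (\<psi> z)" by (simp add: H_def)
    also have "(\<integral>w. poly_kernel z w * f w \<partial>MD) = of_real ?V * g z"
      using vdm_bergman_op[OF integrable_pull[OF h] z] V by (simp add: f_def g_def)
    finally show "of_real ?V * (g z * cnj (\<psi> z)) = (\<integral>w. H z w \<partial>MD)" by simp
  qed
  also have "\<dots> = (\<integral>w. (\<integral>z. H z w \<partial>MD) \<partial>MD)"
    by (rule PP.Fubini_integral[symmetric]) (rule Hi)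
  also have "\<dots> = (\<integral>w. of_real ?V * (f w * cnj (\<psi> w)) \<partial>MD)"
  proof (rule Bochner_Integration.integral_cong[OF refl])
    fix w assume "w \<in> space MD"
    hence w: "w \<in> polydisc" by simp
    have "(\<integral>z. H z w \<partial>MD) = (\<integral>z. f w * cnj (poly_kernel w z * \<psi> z) \<partial>MD)"
      by (intro Bochner_Integration.integral_cong refl) (simp add: H_def kc[of _ w])
    also have "\<dots> = f w * cnj (\<integral>z. poly_kernel w z * \<psi> z \<partial>MD)"
      by (simp only: integral_mult_right_zero Bochner_Integration.integral_cnj)
    also have "(\<integral>z. poly_kernel w z * \<psi> z \<partial>MD) = of_real ?V * \<psi> w"
      by (rule poly_kernel_reproducing[OF holo \<psi>i w])
    finally show "(\<integral>z. H z w \<partial>MD) = of_real ?V * (f w * cnj (\<psi> w))" by simp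
  qed
  also have "\<dots> = of_real ?V * (\<integral>w. f w * cnj (\<psi> w) \<partial>MD)" by simp
  finally have eq: "(\<integral>z. g z * cnj (\<psi> z) \<partial>MD) = (\<integral>w. f w * cnj (\<psi> w) \<partial>MD)" using V by simp
  have cm: "(\<lambda>s. cnj (\<phi> s)) \<in> borel_measurable MG" by (rule measurable_compose[OF meas(2) borel_measurable_cnj])
  have "(\<integral>s. (h s - bergman_op h s) * cnj (\<phi> s) \<partial>MG) = 
     (\<integral>w. ((norm (vdm \<iota> w))\<^sup>2 / fact CARD('n)) *\<^sub>R ((h (sym_map \<iota> w) - bergman_op h (sym_map \<iota> w)) * cnj (\<phi> (sym_map \<iota> w))) \<partial>MD)"
    by (rule integral_MG) (intro borel_measurable_times borel_measurable_diff meas cm)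
  also have "\<dots> = (\<integral>w. (f w * cnj (\<psi> w) - g w * cnj (\<psi> w)) / fact CARD('n) \<partial>MD)"
  proof (intro Bochner_Integration.integral_cong refl)
    fix w
    have "complex_of_real ((norm (vdm \<iota> w))\<^sup>2) = vdm \<iota> w * cnj (vdm \<iota> w)" by (rule complex_norm_square)
    thus "((norm (vdm \<iota> w))\<^sup>2 / fact CARD('n)) *\<^sub>R ((h (sym_map \<iota> w) - bergman_op h (sym_map \<iota> w)) * cnj (\<phi> (sym_map \<iota> w)))
      = (f w * cnj (\<psi> w) - g w * cnj (\<psi> w)) / fact CARD('n)"
      unfolding f_def g_def \<psi>_def scaleR_conv_of_real of_real_divide by (simp add: algebra_simps diff_divide_distrib)
  qed
  also have "\<dots> = 0" using i1 i2 eq by simp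
  finally show ?thesis .
qed

end

theorem theorem4p3:
  fixes \<iota> :: "'n::finite \<Rightarrow> nat" and p :: real
  assumes "CARD('n) \<ge> 2"
    and "bij_betw \<iota> UNIV {1..CARD('n)}"
    and "(sqrt (real CARD('n)^2 - 1) + real CARD('n) - 1) / sqrt (real CARD('n)^2 - 1) < p"
    and "p < (sqrt (real CARD('n)^2 - 1) + real CARD('n) - 1) / (real CARD('n) - 1)"
  shows "Lp_bounded (symm_polydisk \<iota>) p"
proof -
  note e = exponent_bounds[OF assms(1,3,4)]
  obtain C where C: "C > 0"
    "\<And>h. h \<in> Lp_space (symm_polydisk \<iota>) 2 \<Longrightarrow> 
      (\<integral>\<^sup>+s. ennreal (norm (bergman_op \<iota> h s) powr p) \<partial>restrict_space lborel (symm_polydisk \<iota>)) 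
        \<le> ennreal (C powr p) * (\<integral>\<^sup>+s. ennreal (norm (h s) powr p) \<partial>restrict_space lborel (symm_polydisk \<iota>))"
    by (rule bergman_op_Lp_bound[OF assms(2,1) e]) blast
  show ?thesis unfolding Lp_bounded_def
  proof (intro exI[of _ C] conjI ballI C(1))
    fix h assume "h \<in> Lp_space (symm_polydisk \<iota>) 2 \<inter> Lp_space (symm_polydisk \<iota>) p"
    hence h: "h \<in> Lp_space (symm_polydisk \<iota>) 2" by simp
    have "AE s in restrict_space lborel (symm_polydisk \<iota>). bergman_proj (symm_polydisk \<iota>) h s = bergman_op \<iota> h s"
      by (rule bergman_proj_AE_eq[OF h bergman_op_A2[OF assms(2,1) h] bergman_op_orthogonal[OF assms(2,1) h]])
    hence "(\<integral>\<^sup>+s. ennreal (norm (bergman_proj (symm_polydisk \<iota>) h s) powr p) \<partial>restrict_space lborel (symm_polydisk \<iota>)) 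
      = (\<integral>\<^sup>+s. ennreal (norm (bergman_op \<iota> h s) powr p) \<partial>restrict_space lborel (symm_polydisk \<iota>))"
      by (intro nn_integral_cong_AE) (auto elim!: eventually_mono)
    thus "(\<integral>\<^sup>+s. ennreal (norm (bergman_proj (symm_polydisk \<iota>) h s) powr p) \<partial>restrict_space lborel (symm_polydisk \<iota>)) 
        \<le> ennreal (C powr p) * (\<integral>\<^sup>+s. ennreal (norm (h s) powr p) \<partial>restrict_space lborel (symm_polydisk \<iota>))"
      using C(2)[OF h] by simp
  qed
qed

end
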